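(* Let $G = \langle R \cup D \rangle$ be a constant spinal group such that $\mathfrak{SN}(G) = D$. Assume that every element of $D$ is compatible and that $D$ is nilpotent. If there exist a prime power $p^n$ and a surjective homomorphism $\eta \colon D \to \mathbb{Z}/p^n\mathbb{Z}$ such that the pre-image $\eta^{-1}((\mathbb{Z}/p^n\mathbb{Z})^\times)$ is filling (i.e. each of its elements is filling), then $G \in \mathcal{MF}$.
   Context: $\mathcal{MF}$ is the class of groups all of whose maximal subgroups have finite index. For a finite non-empty set $X$, $X^\ast$ is the rooted tree of finite words over $X$; $\mathrm{Aut}(X^\ast)$ acts on the left. For $g\in\mathrm{Aut}(X^\ast)$, $v\in X^\ast$, the section $g|_v$ is defined by $g(vu)=g(v)\,g|_v(u)$ for all $u$. The stabilised section is $g\|_v=g^k|_v$, where $k\ge1$ is minimal with $g^k(v)=v$. Constant spinal groups: let $R$ be a finite group with identity $e$, $X=\underline{R}$ its underlying set, $\underline r\in X$ the letter corresponding to $r\in R$. $R$ acts on $X$ by $r\underline{s}=\underline{rs}$, and $r\in R$ is identified with the rooted automorphism $\underline{s}w\mapsto \underline{rs}\,w$. An automorphism $d$ is directed if it fixes every word of length $1$, $d|_{\underline{e}}=d$, and $d|_x\in R$ for all $x\in X\smallsetminus\{\underline{e}\}$. Let $D$ be a group of directed automorphisms with $\langle d|_x \mid d\in D,\ x\in X\smallsetminus\{\underline{e}\}\rangle = R$. Then $G=\langle R\cup D\rangle$ is a constant spinal group. Stabilised nucleus: $\mathfrak{SN}(G)=\bigcup_{g\in G}\bigcap_{n\in\mathbb{N}}\{g\|_{uv}\mid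 u\in X^n,\ v\in X^\ast\}$. Let $R'$ be the commutator subgroup of $R$, and for $r\in R$ let $m(r)$ be the order of $rR'$ in $R/R'$. An element $d\in D$ is compatible if $d|_{\underline{rs}}\equiv d|_{\underline{r}} \pmod{R'}$ for all $r\in R$, $s\in R'$ with $r\ne e\ne rs$. For $d\in D$, let $\mathcal{R}^{\mathrm{ab}}(d)$ be the edge-labelled directed graph (loops and multiple edges allowed) with vertex set $R/R'$ in which, for each vertex $rR'$ and each $l\in\{1,\dots,m(r)-1\}$, there is an edge labelled $l$ from $rR'$ to $sR'$ if and only if there exists $t\in R'$ with $d|_{\underline{(rt)^l}}\equiv s\pmod{R'}$. A path is a finite non-empty sequence of consecutive directed edges; its length is the number of edges. For compatible $d$, a vertex $rR'$ is a forking point of $d$ if (1) there is a directed path of some length $\ell$ from $rR'$ to itself whose first edge has a label $k\in\{1,\dots,m(r)-1\}$ coprime to the order of $d$; (2) there is a directed path of some length $\ell'$ from $rR'$ to itself whose first edge has a label $k'\in\{1,\dots,m(r)-1\}$ with $k'\neq k$; and (3) $\ell$ and $\ell'$ are coprime. For a set $W$ of vertices, $\mathrm{reach}(W)$ is the set of vertices that are endpoints of directed paths in $\mathcal{R}^{\mathrm{ab}}(d)$ starting in $W$. The reach-closure $\overline{\mathrm{reach}}_d(W)$ is the smallest subgroup $S$ of $R/R'$ containing $W$ with $\mathrm{reach}(S)\subseteq S$. A compatible $d\in D$ is filling if there is a forking point $rR'$ of $d$ such that, for every $D$-conjugate $t$ of $d$ and every map $\sigma\colon \overline{\mathrm{reach}}_d(\{rR'\})\to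 R$ selecting from each coset one of its elements, the group generated by all $t|_{\underline{\sigma(c)}}$, with $c\in\overline{\mathrm{reach}}_d(\{rR'\})$ and $\sigma(c)\neq e$, equals $R$. *)

theory Defs
  imports
    "HOL-Algebra.Bij"
    "HOL-Algebra.Generated_Groups"
    "HOL-Number_Theory.Residues"
    "HOL-Library.Sublist"
    "Graph_Theory.Arc_Walk"
begin

section \<open>Groups\<close>

definition maximal_subgroup :: "'a set \<Rightarrow> ('a, 'b) monoid_scheme \<Rightarrow> bool" where
  "maximal_subgroup M G \<longleftrightarrow>
     subgroup M G \<and> M \<noteq> carrier G \<and>
     (\<forall>H. subgroup H G \<longrightarrow> M \<subseteq> H \<longrightarrow> H = M \<or> H = carrier G)"

definition MF :: "('a, 'b) monoid_scheme \<Rightarrow> bool" where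
  "MF G \<longleftrightarrow> group G \<and> (\<forall>M. maximal_subgroup M G \<longrightarrow> finite (rcosets\<^bsub>G\<^esub> M))"

primrec lower_central :: "('a, 'b) monoid_scheme \<Rightarrow> nat \<Rightarrow> 'a set" where
  "lower_central G 0 = carrier G"
| "lower_central G (Suc k) =
     generate G {g \<otimes>\<^bsub>G\<^esub> h \<otimes>\<^bsub>G\<^esub> inv\<^bsub>G\<^esub> g \<otimes>\<^bsub>G\<^esub> inv\<^bsub>G\<^esub> h | g h.
       g \<in> lower_central G k \<and> h \<in> carrier G}"

definition nilpotent_group :: "('a, 'b) monoid_scheme \<Rightarrow> bool" where
  "nilpotent_group G \<longleftrightarrow> group G \<and> (\<exists>c. lower_central G c = {\<one>\<^bsub>G\<^esub>})"

abbreviation comm_subgroup :: "('a, 'b) monoid_scheme \<Rightarrow> 'a set" where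
  "comm_subgroup R \<equiv> derived R (carrier R)"

text \<open>The abelianisation \<open>R/R'\<close>; since \<open>R'\<close> is normal, its elements \<open>R' #> r\<close> are
  the cosets \<open>r R'\<close>.\<close>

abbreviation abelianisation :: "('a, 'b) monoid_scheme \<Rightarrow> 'a set monoid" where
  "abelianisation R \<equiv> R Mod comm_subgroup R"

abbreviation ab_class :: "('a, 'b) monoid_scheme \<Rightarrow> 'a \<Rightarrow> 'a set" where
  "ab_class R r \<equiv> comm_subgroup R #>\<^bsub>R\<^esub> r"


section \<open>Automorphisms of the tree of finite words\<close>

text \<open>The vertices of \<open>X\<^sup>*\<close> are the lists over \<open>X\<close>, and the rooted tree structure is
  the prefix order. As in \<^const>\<open>BijGroup\<close>, automorphisms are extensional functions, and
  the product of \<open>g\<close> and \<open>h\<close> is \<open>g\<close> after \<open>h\<close>.\<close>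

definition tree_aut :: "'a set \<Rightarrow> ('a list \<Rightarrow> 'a list) monoid" where
  "tree_aut X = (BijGroup (lists X))
     \<lparr>carrier := {f \<in> Bij (lists X).
        \<forall>u\<in>lists X. \<forall>v\<in>lists X. prefix (f u) (f v) \<longleftrightarrow> prefix u v}\<rparr>"

definition tree_section ::
  "'a set \<Rightarrow> ('a list \<Rightarrow> 'a list) \<Rightarrow> 'a list \<Rightarrow> 'a list \<Rightarrow> 'a list" where
  "tree_section X g v = (\<lambda>u\<in>lists X. drop (length v) (g (v @ u)))"

definition stabilised_section ::
  "'a set \<Rightarrow> ('a list \<Rightarrow> 'a list) \<Rightarrow> 'a list \<Rightarrow> 'a list \<Rightarrow> 'a list" where
  "stabilised_section X g v =
     tree_section X
       (g [^]\<^bsub>tree_aut X\<^esub> (LEAST k::nat. 1 \<le> k \<and> (g [^]\<^bsub>tree_aut X\<^esub> k) v = v)) v"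

definition stabilised_nucleus :: "'a set \<Rightarrow> ('a list \<Rightarrow> 'a list) set \<Rightarrow> ('a list \<Rightarrow> 'a list) set" where
  "stabilised_nucleus X G =
     (\<Union>g\<in>G. \<Inter>n::nat. {stabilised_section X g (u @ v) | u v.
        u \<in> lists X \<and> length u = n \<and> v \<in> lists X})"


section \<open>Constant spinal groups\<close>

text \<open>The alphabet is \<open>carrier R\<close>.\<close>

definition rooted :: "('a, 'b) monoid_scheme \<Rightarrow> 'a \<Rightarrow> 'a list \<Rightarrow> 'a list" where
  "rooted R r = (\<lambda>w\<in>lists (carrier R). case w of [] \<Rightarrow> [] | s # w' \<Rightarrow> (r \<otimes>\<^bsub>R\<^esub> s) # w')"

definition directed :: "('a, 'b) monoid_scheme \<Rightarrow> ('a list \<Rightarrow> 'a list) \<Rightarrow> bool" where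
  "directed R d \<longleftrightarrow>
     d \<in> carrier (tree_aut (carrier R)) \<and>
     (\<forall>x\<in>carrier R. d [x] = [x]) \<and>
     tree_section (carrier R) d [\<one>\<^bsub>R\<^esub>] = d \<and>
     (\<forall>x\<in>carrier R - {\<one>\<^bsub>R\<^esub>}. tree_section (carrier R) d [x] \<in> rooted R ` carrier R)"

text \<open>The section of a directed automorphism \<open>d\<close> at a letter \<open>x \<noteq> e\<close>, as an element of
  \<open>R\<close>. It is well defined because \<open>rooted R\<close> is injective on \<open>carrier R\<close>; the value at
  \<open>x = e\<close> is meaningless.\<close>

definition letter_section ::
  "('a, 'b) monoid_scheme \<Rightarrow> ('a list \<Rightarrow> 'a list) \<Rightarrow> 'a \<Rightarrow> 'a" where
  "letter_section R d x =
     (THE r. r \<in> carrier R \<and> tree_section (carrier R) d [x] = rooted R r)"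

locale constant_spinal = group R for R :: "('a, 'b) monoid_scheme" (structure) +
  fixes D :: "('a list \<Rightarrow> 'a list) set"
  assumes finite_R: "finite (carrier R)"
    and subgroup_D: "subgroup D (tree_aut (carrier R))"
    and directed_D: "\<And>d. d \<in> D \<Longrightarrow> directed R d"
    and generate_R:
      "generate R {letter_section R d x | d x. d \<in> D \<and> x \<in> carrier R - {\<one>}} = carrier R"

definition spinal_group ::
  "('a, 'b) monoid_scheme \<Rightarrow> ('a list \<Rightarrow> 'a list) set \<Rightarrow> ('a list \<Rightarrow> 'a list) monoid" where
  "spinal_group R D = subgroup_generated (tree_aut (carrier R)) (rooted R ` carrier R \<union> D)"

definition directed_group ::
  "('a, 'b) monoid_scheme \<Rightarrow> ('a list \<Rightarrow> 'a list) set \<Rightarrow> ('a list \<Rightarrow> 'a list) monoid" where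
  "directed_group R D = (tree_aut (carrier R))\<lparr>carrier := D\<rparr>"


section \<open>Compatible and filling elements\<close>

definition compatible :: "('a, 'b) monoid_scheme \<Rightarrow> ('a list \<Rightarrow> 'a list) \<Rightarrow> bool" where
  "compatible R d \<longleftrightarrow>
     (\<forall>r\<in>carrier R. \<forall>s\<in>comm_subgroup R. r \<noteq> \<one>\<^bsub>R\<^esub> \<and> r \<otimes>\<^bsub>R\<^esub> s \<noteq> \<one>\<^bsub>R\<^esub> \<longrightarrow>
        ab_class R (letter_section R d (r \<otimes>\<^bsub>R\<^esub> s)) = ab_class R (letter_section R d r))"

text \<open>The arc \<open>(c, l, c')\<close> is the edge from \<open>c\<close> to \<open>c'\<close> labelled \<open>l\<close>. As
  \<open>1 \<le> l < m(r)\<close>, the element \<open>(r t)\<^sup>l\<close> is not in \<open>R'\<close>, so the section is only taken at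
  letters other than \<open>e\<close>.\<close>

definition ab_graph ::
  "('a, 'b) monoid_scheme \<Rightarrow> ('a list \<Rightarrow> 'a list) \<Rightarrow>
   ('a set, 'a set \<times> nat \<times> 'a set) pre_digraph" where
  "ab_graph R d =
     \<lparr>verts = carrier (abelianisation R),
      arcs = {(ab_class R r, l, ab_class R s) | r l s.
        r \<in> carrier R \<and> s \<in> carrier R \<and>
        l \<in> {1..<group.ord (abelianisation R) (ab_class R r)} \<and>
        (\<exists>t\<in>comm_subgroup R.
          ab_class R (letter_section R d ((r \<otimes>\<^bsub>R\<^esub> t) [^]\<^bsub>R\<^esub> l)) = ab_class R s)},
      tail = (\<lambda>(c, l, c'). c),
      head = (\<lambda>(c, l, c'). c')\<rparr>"

definition ab_path ::
  "('a, 'b) monoid_scheme \<Rightarrow> ('a list \<Rightarrow> 'a list) \<Rightarrow>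
   'a set \<Rightarrow> ('a set \<times> nat \<times> 'a set) list \<Rightarrow> 'a set \<Rightarrow> bool" where
  "ab_path R d c p c' \<longleftrightarrow> p \<noteq> [] \<and> pre_digraph.awalk (ab_graph R d) c p c'"

definition first_label :: "('v \<times> nat \<times> 'v) list \<Rightarrow> nat" where
  "first_label p = fst (snd (hd p))"

definition forking_point ::
  "('a, 'b) monoid_scheme \<Rightarrow> ('a list \<Rightarrow> 'a list) \<Rightarrow> 'a set \<Rightarrow> bool" where
  "forking_point R d c \<longleftrightarrow>
     c \<in> carrier (abelianisation R) \<and>
     (\<exists>p p'. ab_path R d c p c \<and> ab_path R d c p' c \<and>
        coprime (first_label p) (group.ord (tree_aut (carrier R)) d) \<and>
        first_label p' \<noteq> first_label p \<and>
        coprime (length p) (length p'))"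

definition reach ::
  "('a, 'b) monoid_scheme \<Rightarrow> ('a list \<Rightarrow> 'a list) \<Rightarrow> 'a set set \<Rightarrow> 'a set set" where
  "reach R d W = {c'. \<exists>c\<in>W. \<exists>p. ab_path R d c p c'}"

definition reach_closure ::
  "('a, 'b) monoid_scheme \<Rightarrow> ('a list \<Rightarrow> 'a list) \<Rightarrow> 'a set set \<Rightarrow> 'a set set" where
  "reach_closure R d W =
     \<Inter>{S. subgroup S (abelianisation R) \<and> W \<subseteq> S \<and> reach R d S \<subseteq> S}"

definition filling ::
  "('a, 'b) monoid_scheme \<Rightarrow> ('a list \<Rightarrow> 'a list) set \<Rightarrow> ('a list \<Rightarrow> 'a list) \<Rightarrow> bool" where
  "filling R D d \<longleftrightarrow>
     d \<in> D \<and> compatible R d \<and>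
     (\<exists>c. forking_point R d c \<and>
        (\<forall>g\<in>D. \<forall>\<sigma>\<in>(\<Pi> b\<in>reach_closure R d {c}. b).
           let t = g \<otimes>\<^bsub>tree_aut (carrier R)\<^esub> d \<otimes>\<^bsub>tree_aut (carrier R)\<^esub>
                   inv\<^bsub>tree_aut (carrier R)\<^esub> g
           in generate R {letter_section R t (\<sigma> b) | b.
                b \<in> reach_closure R d {c} \<and> \<sigma> b \<noteq> \<one>\<^bsub>R\<^esub>} = carrier R))"

end

theory Submission
  imports Defs
begin

text \<open>As the stabilised nucleus is the finite group \<open>D\<close>, deep stabilised sections of every
  element lie in \<open>D\<close>; hence \<open>G\<close> is a torsion group. A maximal subgroup \<open>M\<close> of infinite index
  is dense in the profinite topology, and so are all its sections. The number of letters from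
  \<open>D\<close> in a word does not increase under stabilised sections, and a homomorphism \<open>\<Phi>\<close> from \<open>D\<close>
  to an abelian group extends to \<open>G\<close> with \<open>\<Phi> g\<close> the sum of all \<open>\<Phi> (g|\<^sub>x)\<close>. Applied to \<open>\<eta>\<close>
  modulo \<open>p\<close> this yields a section of \<open>M\<close> containing a filling element \<open>d\<close> of \<open>D\<close>. Conjugating
  \<open>d\<close> by elements of \<open>M\<close> and passing to sections follows the edges of the graph of \<open>d\<close>; a
  forking point allows us to choose the edge that shortens the conjugator, until a rooted
  element is reached. Filling then gives all of \<open>R\<close>, and the nilpotency of \<open>D\<close> all of \<open>D\<close>, so
  some iterated section of \<open>M\<close> is \<open>G\<close>. On the other hand, filling and torsion make \<open>G\<close> a
  just infinite branch group, in which a dense subgroup with a full section is \<open>G\<close> itself.\<close>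

section \<open>Subgroups of finite index\<close>

text \<open>The proof shows that every dense subgroup of \<open>G\<close> equals \<open>G\<close>.
  Density is a better invariant than maximality because it passes directly to sections and to
  conjugates by arbitrary elements. The main obstacle is the way back up: one full section must
  force a full subgroup. This rests on a rigid stabiliser of finite index, obtained by contradiction
  modulo a normal subgroup \<open>N\<close> that is maximal among those of infinite index. As
  \<open>G\<close> is finitely generated and torsion, \<open>G\<close> modulo \<open>N\<close> has
  no two commuting non-trivial normal subgroups. For non-abelian \<open>R\<close> filling survives
  the omission of one letter, since each coset of the commutator subgroup offers a second
  representative. For abelian \<open>R\<close> there is no such choice, and a rooted element of
  \<open>N\<close> is produced instead. Word length in \<open>D\<close> is used twice: it confines
  the stabilised sections of an element to a finite set, which makes the nucleus hypothesis
  applicable, and it is the quantity minimised over conjugators. At a forking point the two labels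
  give two competing length inequalities, while the coprime path lengths bring rooted elements of
  all relevant cosets to one common level.\<close>

definition fin_index :: "('a, 'b) monoid_scheme \<Rightarrow> 'a set \<Rightarrow> bool" where
  "fin_index G H \<longleftrightarrow> subgroup H G \<and> finite (rcosets\<^bsub>G\<^esub> H)"

definition commutator :: "('a, 'b) monoid_scheme \<Rightarrow> 'a \<Rightarrow> 'a \<Rightarrow> 'a" where
  "commutator G a b = a \<otimes>\<^bsub>G\<^esub> b \<otimes>\<^bsub>G\<^esub> inv\<^bsub>G\<^esub> a \<otimes>\<^bsub>G\<^esub> inv\<^bsub>G\<^esub> b"

definition torsion :: "('a, 'b) monoid_scheme \<Rightarrow> bool" where
  "torsion G \<longleftrightarrow> (\<forall>g\<in>carrier G. \<exists>n>0. g [^]\<^bsub>G\<^esub> (n::nat) = \<one>\<^bsub>G\<^esub>)"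

definition prodense :: "('a, 'b) monoid_scheme \<Rightarrow> 'a set \<Rightarrow> bool" where
  "prodense G M \<longleftrightarrow> subgroup M G \<and>
     (\<forall>H. fin_index G H \<longrightarrow> (\<forall>g\<in>carrier G. \<exists>m\<in>M. \<exists>h\<in>H. g = m \<otimes>\<^bsub>G\<^esub> h))"

text \<open>Equivalently, the quotient of \<open>G\<close> by \<open>N\<close> is just
  infinite.\<close>

definition maximal_infinite_index :: "('a, 'b) monoid_scheme \<Rightarrow> 'a set \<Rightarrow> bool" where
  "maximal_infinite_index G N \<longleftrightarrow> N \<lhd> G \<and> \<not> fin_index G N \<and>
     (\<forall>K. K \<lhd> G \<longrightarrow> N \<subseteq> K \<longrightarrow> \<not> fin_index G K \<longrightarrow> K = N)"

context group
begin

lemma commutator_closed [simp]: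
  "a \<in> carrier G \<Longrightarrow> b \<in> carrier G \<Longrightarrow> commutator G a b \<in> carrier G"
  by (simp add: commutator_def)

lemma mult_inv_cancel_right [simp]:
  "a \<in> carrier G \<Longrightarrow> b \<in> carrier G \<Longrightarrow> a \<otimes> b \<otimes> inv b = a"
  "a \<in> carrier G \<Longrightarrow> b \<in> carrier G \<Longrightarrow> a \<otimes> inv b \<otimes> b = a"
  by (simp_all add: m_assoc)

lemma mult_inv_cancel_left [simp]:
  "a \<in> carrier G \<Longrightarrow> b \<in> carrier G \<Longrightarrow> b \<otimes> (inv b \<otimes> a) = a"
  "a \<in> carrier G \<Longrightarrow> b \<in> carrier G \<Longrightarrow> inv b \<otimes> (b \<otimes> a) = a"
  by (simp_all flip: m_assoc)

lemma rcoset_eq_iff: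
  assumes "subgroup H G" "a \<in> carrier G" "b \<in> carrier G"
  shows "H #> a = H #> b \<longleftrightarrow> a \<otimes> inv b \<in> H"
proof
  assume "H #> a = H #> b"
  then have "a \<in> H #> b" using assms rcos_self by blast
  then show "a \<otimes> inv b \<in> H" using assms by (meson subgroup.rcos_module_imp is_group)
next
  assume "a \<otimes> inv b \<in> H"
  then have "a \<in> H #> b" using assms by (meson subgroup.rcos_module_rev is_group)
  then show "H #> a = H #> b" using assms repr_independence by blast
qed

text \<open>The form in which finite index is usually proved below: a finite-valued \<open>F\<close>
  that separates cosets is enough, and it need be neither a homomorphism nor constant on
  cosets.\<close>

lemma fin_indexI:
  assumes "subgroup H G" "finite (F ` carrier G)"
    and F: "\<And>a b. a \<in> carrier G \<Longrightarrow> b \<in> carrier G \<Longrightarrow> F a = F b \<Longrightarrow> a \<otimes> inv b \<in> H"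
  shows "fin_index G H"
proof -
  define \<tau> where "\<tau> z = (SOME a. a \<in> carrier G \<and> F a = z)" for z
  have \<tau>: "\<tau> (F a) \<in> carrier G \<and> F (\<tau> (F a)) = F a" if "a \<in> carrier G" for a
    unfolding \<tau>_def by (rule someI[of _ a]) (use that in auto)
  have "rcosets H \<subseteq> (\<lambda>z. H #> \<tau> z) ` (F ` carrier G)"
  proof
    fix C assume "C \<in> rcosets H"
    then obtain a where a: "a \<in> carrier G" "C = H #> a" unfolding RCOSETS_def by auto
    have "C = H #> \<tau> (F a)" using \<tau>[OF a(1)] F a rcoset_eq_iff[OF assms(1)] by metis
    with a show "C \<in> (\<lambda>z. H #> \<tau> z) ` (F ` carrier G)" by blast
  qed
  then have "finite (rcosets H)" using assms(2) by (meson finite_imageI finite_subset)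
  then show ?thesis using assms(1) by (simp add: fin_index_def)
qed

lemma fin_index_cosets: "fin_index G H \<Longrightarrow> finite ((\<lambda>a. H #> a) ` carrier G)"
  unfolding fin_index_def RCOSETS_def by (simp add: UNION_singleton_eq_range)

lemma fin_index_inter:
  assumes "fin_index G H" "fin_index G K" shows "fin_index G (H \<inter> K)"
proof (rule fin_indexI[where F = "\<lambda>a. (H #> a, K #> a)"])
  have s: "subgroup H G" "subgroup K G" using assms by (auto simp: fin_index_def)
  then show "subgroup (H \<inter> K) G" by (rule subgroups_Inter_pair)
  show "finite ((\<lambda>a. (H #> a, K #> a)) ` carrier G)"
    by (rule finite_subset[OF _ finite_cartesian_product[OF fin_index_cosets[OF assms(1)]
            fin_index_cosets[OF assms(2)]]]) (rule image_subsetI, simp)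
  show "a \<otimes> inv b \<in> H \<inter> K" if "a \<in> carrier G" "b \<in> carrier G" "(H #> a, K #> a) = (H #> b, K #> b)"
    for a b using that rcoset_eq_iff s by auto
qed

lemma fin_index_mono:
  assumes "fin_index G H" "subgroup K G" "H \<subseteq> K" shows "fin_index G K"
proof (rule fin_indexI[where F = "\<lambda>a. H #> a"])
  show "a \<otimes> inv b \<in> K" if "a \<in> carrier G" "b \<in> carrier G" "H #> a = H #> b" for a b
    using that assms rcoset_eq_iff[of H a b] unfolding fin_index_def by blast
qed (use assms fin_index_cosets in blast)+

text \<open>The normal core is the kernel of the action of \<open>G\<close> on the finitely many
  right cosets of \<open>H\<close>.\<close>

lemma fin_index_core:
  assumes "fin_index G H" shows "\<exists>K. K \<lhd> G \<and> fin_index G K \<and> K \<subseteq> H"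
proof -
  have H: "subgroup H G" using assms by (simp add: fin_index_def)
  interpret H: subgroup H G by fact
  define K where "K = {g \<in> carrier G. \<forall>t\<in>carrier G. t \<otimes> g \<otimes> inv t \<in> H}"
  have K: "subgroup K G"
  proof
    fix x y assume xy: "x \<in> K" "y \<in> K"
    have "t \<otimes> (x \<otimes> y) \<otimes> inv t \<in> H" if "t \<in> carrier G" for t
    proof -
      have "t \<otimes> (x \<otimes> y) \<otimes> inv t = (t \<otimes> x \<otimes> inv t) \<otimes> (t \<otimes> y \<otimes> inv t)"
        using xy that by (simp add: K_def m_assoc)
      then show ?thesis using xy that by (simp add: K_def)
    qed
    then show "x \<otimes> y \<in> K" using xy by (simp add: K_def)
  next
    fix x assume x: "x \<in> K"
    have "t \<otimes> inv x \<otimes> inv t \<in> H" if "t \<in> carrier G" for t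
    proof -
      have "t \<otimes> inv x \<otimes> inv t = inv (t \<otimes> x \<otimes> inv t)"
        using x that by (simp add: K_def m_assoc inv_mult_group)
      then show ?thesis using x that by (simp add: K_def)
    qed
    then show "inv x \<in> K" using x by (simp add: K_def)
  qed (auto simp: K_def)
  have "K \<lhd> G"
  proof (rule normal_invI[OF K])
    fix x h assume xh: "x \<in> carrier G" "h \<in> K"
    have "t \<otimes> (x \<otimes> h \<otimes> inv x) \<otimes> inv t \<in> H" if "t \<in> carrier G" for t
    proof -
      have "t \<otimes> (x \<otimes> h \<otimes> inv x) \<otimes> inv t = (t \<otimes> x) \<otimes> h \<otimes> inv (t \<otimes> x)"
        using xh that by (simp add: K_def m_assoc inv_mult_group)
      then show ?thesis using xh that by (simp add: K_def)
    qed
    then show "x \<otimes> h \<otimes> inv x \<in> K" using xh by (simp add: K_def)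
  qed
  moreover have "fin_index G K"
  \<comment> \<open>The value at \<open>a\<close> is the permutation of the cosets of
    \<open>H\<close> induced by right multiplication with \<open>a\<close>.\<close>
  proof (rule fin_indexI[OF K, where F = "\<lambda>a. \<lambda>C\<in>rcosets H. C #> a"])
    have "(\<lambda>a. \<lambda>C\<in>rcosets H. C #> a) ` carrier G \<subseteq> rcosets H \<rightarrow>\<^sub>E rcosets H"
    proof (intro image_subsetI PiE_I)
      fix a C assume "a \<in> carrier G" "C \<in> rcosets H"
      then obtain t where "t \<in> carrier G" "C = H #> t" unfolding RCOSETS_def by blast
      then show "(\<lambda>C\<in>rcosets H. C #> a) C \<in> rcosets H"
        using \<open>a \<in> carrier G\<close> \<open>C \<in> rcosets H\<close> by (simp add: coset_mult_assoc H.subset rcosetsI)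
    qed simp
    then show "finite ((\<lambda>a. \<lambda>C\<in>rcosets H. C #> a) ` carrier G)"
      using assms unfolding fin_index_def by (meson finite_PiE finite_subset)
  next
    fix a b assume ab: "a \<in> carrier G" "b \<in> carrier G"
      and "(\<lambda>C\<in>rcosets H. C #> a) = (\<lambda>C\<in>rcosets H. C #> b)"
    then have eq: "C #> a = C #> b" if "C \<in> rcosets H" for C
      using that by (metis restrict_apply')
    have "t \<otimes> (a \<otimes> inv b) \<otimes> inv t \<in> H" if t: "t \<in> carrier G" for t
    proof -
      have "H #> (t \<otimes> a) = H #> (t \<otimes> b)"
        using eq[of "H #> t"] t ab H.subset by (simp add: coset_mult_assoc rcosetsI)
      then have "(t \<otimes> a) \<otimes> inv (t \<otimes> b) \<in> H" using rcoset_eq_iff[OF H] t ab by simp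
      then show ?thesis using t ab by (simp add: m_assoc inv_mult_group)
    qed
    then show "a \<otimes> inv b \<in> K" using ab by (simp add: K_def)
  qed
  moreover have "K \<subseteq> H"
  proof
    fix g assume "g \<in> K"
    then have "g \<in> carrier G" "\<one> \<otimes> g \<otimes> inv \<one> \<in> H" unfolding K_def by blast+
    then show "g \<in> H" by simp
  qed
  ultimately show ?thesis by blast
qed

section \<open>Schreier's lemma and quotients of finitely generated torsion groups\<close>

lemma schreier:
  assumes S: "finite S" "S \<subseteq> carrier G" "generate G S = carrier G" and H: "fin_index G H"
  shows "\<exists>U. finite U \<and> U \<subseteq> carrier G \<and> H = generate G U"
proof -
  have sH: "subgroup H G" using H by (simp add: fin_index_def)
  interpret H: subgroup H G by fact
  \<comment> \<open>A choice of coset representatives that is \<open>\<one>\<close> on all of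
    \<open>H\<close>, so that for \<open>h\<close> in \<open>H\<close> the product
    \<open>h \<otimes> inv (\<tau> h)\<close> is \<open>h\<close> itself.\<close>
  define \<tau> where "\<tau> g = (if g \<in> H then \<one> else (SOME t. t \<in> carrier G \<and> H #> t = H #> g))" for g
  have \<tau>: "\<tau> g \<in> carrier G" "H #> \<tau> g = H #> g" if "g \<in> carrier G" for g
  proof -
    have "(SOME t. t \<in> carrier G \<and> H #> t = H #> g) \<in> carrier G \<and>
       H #> (SOME t. t \<in> carrier G \<and> H #> t = H #> g) = H #> g"
      by (rule someI[of _ g]) (use that in auto)
    then show "\<tau> g \<in> carrier G" "H #> \<tau> g = H #> g"
      unfolding \<tau>_def using that coset_join2[OF _ sH] coset_join2[OF one_closed sH] by auto
  qed
  have \<tau>_cong: "\<tau> a = \<tau> b" if "a \<in> carrier G" "b \<in> carrier G" "H #> a = H #> b" for a b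
  proof -
    have "a \<in> H \<longleftrightarrow> b \<in> H"
      using that coset_join1[OF _ _ sH] coset_join2[OF _ sH] H.subset by metis
    then show ?thesis using that by (simp add: \<tau>_def)
  qed
  define T where "T = \<tau> ` carrier G"
  have "\<tau> ` carrier G \<subseteq> insert \<one> ((\<lambda>C. SOME t. t \<in> carrier G \<and> H #> t = C) ` (\<lambda>a. H #> a) `
      carrier G)"
    by (auto simp: \<tau>_def)
  then have finT: "finite T" unfolding T_def
    using fin_index_cosets[OF H] by (meson finite.insertI finite_imageI finite_subset)
  define S' where "S' = S \<union> m_inv G ` S"
  have S': "S' \<subseteq> carrier G" using S by (auto simp: S'_def)
  define U where "U = (\<lambda>(t, s). t \<otimes> s \<otimes> inv (\<tau> (t \<otimes> s))) ` (T \<times> S')"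
  have T: "T \<subseteq> carrier G" using \<tau> by (auto simp: T_def)
  have UH: "U \<subseteq> H"
  proof
    fix u assume "u \<in> U"
    then obtain t s where ts: "t \<in> carrier G" "s \<in> carrier G" "u = t \<otimes> s \<otimes> inv (\<tau> (t \<otimes> s))"
      unfolding U_def using T S' by auto
    then show "u \<in> H" using \<tau>[of "t \<otimes> s"] rcoset_eq_iff[OF sH, of "t \<otimes> s" "\<tau> (t \<otimes> s)"] by simp
  qed
  have U: "U \<subseteq> carrier G" using UH H.subset by blast
  interpret U: subgroup "generate G U" G using U by (rule generate_is_subgroup)
  have step: "g \<otimes> s \<otimes> inv (\<tau> (g \<otimes> s)) \<in> generate G U"
    if g: "g \<in> carrier G" "g \<otimes> inv (\<tau> g) \<in> generate G U" and s: "s \<in> S'" for g s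
  proof -
    have sc: "s \<in> carrier G" using s S' by blast
    have "\<tau> (\<tau> g \<otimes> s) = \<tau> (g \<otimes> s)"
      by (rule \<tau>_cong) (use g sc \<tau> in \<open>simp_all flip: coset_mult_assoc add: H.subset\<close>)
    then have "g \<otimes> s \<otimes> inv (\<tau> (g \<otimes> s)) = (g \<otimes> inv (\<tau> g)) \<otimes> (\<tau> g \<otimes> s \<otimes> inv (\<tau> (\<tau> g \<otimes> s)))"
      using g sc \<tau> by (simp add: m_assoc)
    moreover have "\<tau> g \<otimes> s \<otimes> inv (\<tau> (\<tau> g \<otimes> s)) \<in> U"
      unfolding U_def T_def using g s by (auto intro!: image_eqI[where x = "(\<tau> g, s)"])
    ultimately show ?thesis using g generate.incl by (metis U.m_closed)
  qed
  \<comment> \<open>The prefix \<open>x\<close> must be arbitrary, because \<open>generate\<close>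
    builds words as trees of products and not letter by letter: in a product the second factor is
    appended to \<open>x\<close> times the first.\<close>
  have "g \<in> generate G S \<Longrightarrow> x \<in> carrier G \<Longrightarrow> x \<otimes> inv (\<tau> x) \<in> generate G U \<Longrightarrow>
      x \<otimes> g \<otimes> inv (\<tau> (x \<otimes> g)) \<in> generate G U" for g x
  proof (induction arbitrary: x rule: generate.induct)
    case one then show ?case by simp
  next
    case (incl h) then show ?case using step S'_def by blast
  next
    case (inv h) then show ?case using step[of x "inv h"] S'_def by blast
  next
    case (eng h1 h2)
    then have "h1 \<in> carrier G" "h2 \<in> carrier G" using generate_in_carrier[OF S(2)] by auto
    then show ?case using eng.IH(2)[OF _ eng.IH(1)[OF eng.prems]] eng.prems by (simp add: m_assoc)
  qed
  from this[of _ \<one>] have all: "g \<otimes> inv (\<tau> g) \<in> generate G U" if "g \<in> carrier G" for g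
    using that S by (simp add: \<tau>_def)
  have "H \<subseteq> generate G U"
  proof
    fix h assume "h \<in> H"
    then show "h \<in> generate G U" using all[of h] by (simp add: \<tau>_def)
  qed
  moreover have "generate G U \<subseteq> H" using UH generate_subgroup_incl sH by blast
  moreover have "finite U" unfolding U_def S'_def using finT S by simp
  ultimately show ?thesis using U by blast
qed

text \<open>Adjoining a generator \<open>s\<close> with \<open>s [^] n = \<one>\<close> multiplies
  the order by at most \<open>n\<close>: every element takes the form
  \<open>s [^] i \<otimes> h\<close> with \<open>i < n\<close>.\<close>

lemma finite_generate_torsion_comm:
  assumes "finite S" "S \<subseteq> carrier G"
    and "\<And>a b. a \<in> generate G S \<Longrightarrow> b \<in> generate G S \<Longrightarrow> a \<otimes> b = b \<otimes> a"
    and "\<And>s. s \<in> S \<Longrightarrow> \<exists>n>0. s [^] (n::nat) = \<one>"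
  shows "finite (generate G S)"
  using assms
proof (induction S rule: finite_induct)
  case empty
  then show ?case by (simp add: generate_empty)
next
  case (insert s S)
  have sub: "generate G S \<subseteq> generate G (insert s S)" by (rule mono_generate) auto
  have c: "s \<in> carrier G" "S \<subseteq> carrier G" using insert by auto
  have fin: "finite (generate G S)" using insert sub by blast
  obtain n where n: "n > 0" "s [^] (n::nat) = \<one>" using insert by blast
  interpret S: subgroup "generate G S" G using c by (simp add: generate_is_subgroup)
  interpret sS: subgroup "generate G (insert s S)" G using c by (simp add: generate_is_subgroup)
  define T where "T = (\<lambda>(i::nat, h). s [^] i \<otimes> h) ` ({..<n} \<times> generate G S)"
  have T: "s [^] i \<otimes> h \<in> T" if "h \<in> generate G S" for i :: nat and h
  proof -
    have "s [^] i = s [^] (i mod n)"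
    proof -
      have "s [^] i = s [^] (n * (i div n) + i mod n)" by simp
      also have "\<dots> = (s [^] n) [^] (i div n) \<otimes> s [^] (i mod n)"
        using c by (simp only: nat_pow_mult nat_pow_pow)
      finally show ?thesis using n c by simp
    qed
    then show ?thesis unfolding T_def using that n
        by (auto intro!: image_eqI[where x = "(i mod n, h)"])
  qed
  have "generate G (insert s S) \<subseteq> T"
  proof
    fix g assume "g \<in> generate G (insert s S)"
    then show "g \<in> T"
    proof (induction rule: generate.induct)
      case one show ?case using T[of \<one> 0] by simp
    next
      case (incl h)
      then show ?case
        using T[of \<one> 1] T[of h 0] c generate.incl[of h S G] by fastforce
    next
      case (inv h)
      have "inv s = s [^] (n - 1)"
      proof -
        have "s [^] (n - 1) \<otimes> s = \<one>" using n c by (metis Suc_diff_1 nat_pow_Suc)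
        then show ?thesis using c inv_equality by force
      qed
      then show ?case
        using T[of \<one> "n - 1"] T[of "inv h" 0] c inv generate.inv[of h S G]
        by (cases "h = s") (auto simp: S.mem_carrier)
    next
      case (eng h1 h2)
      then obtain i h j k where *: "h1 = s [^] i \<otimes> h" "h2 = s [^] j \<otimes> k"
        "h \<in> generate G S" "k \<in> generate G S" "(i::nat) < n" "(j::nat) < n" by (auto simp: T_def)
      have hk: "h \<in> carrier G" "k \<in> carrier G" using * S.mem_carrier by auto
      have "s \<in> generate G (insert s S)" by (rule generate.incl) simp
      then have "s [^] j \<in> generate G (insert s S)"
        by (induction j) (auto intro: sS.m_closed)
      then have "h \<otimes> s [^] j = s [^] j \<otimes> h" using insert.prems(2) * sub by blast
      then have "h1 \<otimes> h2 = s [^] (i + j) \<otimes> (h \<otimes> k)"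
        using * hk c by (simp add: m_assoc flip: nat_pow_mult) (metis hk c m_assoc nat_pow_closed)
      then show ?case using T * by simp
    qed
  qed
  moreover have "finite T" unfolding T_def using fin by simp
  ultimately show ?case using finite_subset by blast
qed

text \<open>By Schreier's lemma \<open>C\<close> is finitely generated, so its image modulo
  \<open>N\<close> is a finitely generated abelian torsion group, hence finite; and \<open>C\<close>
  itself has finite index.\<close>

lemma fin_index_of_commutators:
  assumes S: "finite S" "S \<subseteq> carrier G" "generate G S = carrier G" and tor: "torsion G"
    and C: "fin_index G C" and N: "N \<lhd> G"
    and comm: "\<And>a b. a \<in> C \<Longrightarrow> b \<in> C \<Longrightarrow> commutator G a b \<in> N"
  shows "fin_index G N"
proof -
  interpret N: normal N G by fact
  have sC: "subgroup C G" using C by (simp add: fin_index_def)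
  interpret C: subgroup C G by fact
  obtain U where U: "finite U" "U \<subseteq> carrier G" "C = generate G U" using schreier[OF S C] by blast
  interpret Q: group "G Mod N" by (rule N.factorgroup_is_group)
  interpret h: group_hom G "G Mod N" "\<lambda>a. N #> a"
    by unfold_locales (rule N.r_coset_hom_Mod)
  have img: "generate (G Mod N) ((\<lambda>a. N #> a) ` U) = (\<lambda>a. N #> a) ` C"
    using h.generate_img[OF U(2)] U by simp
  have "finite (generate (G Mod N) ((\<lambda>a. N #> a) ` U))"
  proof (rule Q.finite_generate_torsion_comm)
    fix a b assume "a \<in> generate (G Mod N) ((\<lambda>a. N #> a) ` U)" "b \<in> generate (G Mod N) ((\<lambda>a. N #>
        a) ` U)"
    then obtain x y where xy: "x \<in> C" "y \<in> C" "a = N #> x" "b = N #> y" unfolding img by blast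
    have "x \<otimes> y \<otimes> inv (y \<otimes> x) \<in> N"
      using comm[OF xy(1,2)] xy by (simp add: commutator_def inv_mult_group m_assoc)
    then have "N #> (x \<otimes> y) = N #> (y \<otimes> x)"
      using xy(1,2) by (intro rcoset_eq_iff[OF N.subgroup_axioms, THEN iffD2]) auto
    then show "a \<otimes>\<^bsub>G Mod N\<^esub> b = b \<otimes>\<^bsub>G Mod N\<^esub> a"
        using xy h.hom_mult[of x y] h.hom_mult[of y x] C.mem_carrier by metis
  next
    fix s assume "s \<in> (\<lambda>a. N #> a) ` U"
    then obtain u where u: "u \<in> U" "s = N #> u" by blast
    then obtain n where "n > 0" "u [^] (n::nat) = \<one>" using tor U by (auto simp: torsion_def)
    then show "\<exists>n>0. s [^]\<^bsub>G Mod N\<^esub> (n::nat) = \<one>\<^bsub>G Mod N\<^esub>"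
      using u U h.hom_nat_pow[of u n] h.hom_one by (metis subsetD)
  qed (use U in \<open>auto simp: carrier_FactGroup\<close>)
  then have finC: "finite ((\<lambda>a. N #> a) ` C)" using img by simp
  define \<tau> where "\<tau> X = (SOME t. t \<in> carrier G \<and> C #> t = X)" for X
  have \<tau>: "\<tau> (C #> g) \<in> carrier G" "C #> \<tau> (C #> g) = C #> g" if "g \<in> carrier G" for g
  proof -
    have "\<tau> (C #> g) \<in> carrier G \<and> C #> \<tau> (C #> g) = C #> g"
      unfolding \<tau>_def by (rule someI[of _ g]) (use that in auto)
    then show "\<tau> (C #> g) \<in> carrier G" "C #> \<tau> (C #> g) = C #> g" by auto
  qed
  show ?thesis
  \<comment> \<open>The element \<open>a\<close> is recorded by its coset of \<open>C\<close> and by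
    the class modulo \<open>N\<close> of the factor in \<open>C\<close> that remains; the latter
    takes finitely many values as the image of \<open>C\<close> is finite.\<close>
  proof (rule fin_indexI[where F = "\<lambda>a. (C #> a, N #> (a \<otimes> inv (\<tau> (C #> a))))"])
    have "(\<lambda>a. (C #> a, N #> (a \<otimes> inv (\<tau> (C #> a))))) ` carrier G \<subseteq>
        (\<lambda>a. C #> a) ` carrier G \<times> (\<lambda>a. N #> a) ` C"
    proof safe
      fix a assume a: "a \<in> carrier G"
      then have "a \<otimes> inv (\<tau> (C #> a)) \<in> C" using \<tau>[OF a] rcoset_eq_iff[OF sC] by metis
      then show "N #> (a \<otimes> inv (\<tau> (C #> a))) \<in> (\<lambda>a. N #> a) ` C" by blast
    qed blast
    then show "finite ((\<lambda>a. (C #> a, N #> (a \<otimes> inv (\<tau> (C #> a))))) ` carrier G)"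
      using fin_index_cosets[OF C] finC by (meson finite_SigmaI finite_subset)
  next
    fix a b assume ab: "a \<in> carrier G" "b \<in> carrier G"
      and eq: "(C #> a, N #> (a \<otimes> inv (\<tau> (C #> a)))) = (C #> b, N #> (b \<otimes> inv (\<tau> (C #> b))))"
    define t where "t = \<tau> (C #> a)"
    have t: "t \<in> carrier G" using \<tau> ab t_def by simp
    have "N #> (a \<otimes> inv t) = N #> (b \<otimes> inv t)" using eq t_def by (metis prod.inject)
    then have "(a \<otimes> inv t) \<otimes> inv (b \<otimes> inv t) \<in> N"
      using ab t rcoset_eq_iff[OF N.subgroup_axioms] by (metis inv_closed m_closed)
    then show "a \<otimes> inv b \<in> N" using ab t by (simp add: inv_mult_group m_assoc)
  qed (rule N.subgroup_axioms)
qed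

text \<open>Zorn's lemma applies because a subgroup of finite index is finitely generated: were the
  union of a chain of finite index, its generators would lie in one member, which would then be the
  union.\<close>

lemma exists_maximal_infinite_index:
  assumes S: "finite S" "S \<subseteq> carrier G" "generate G S = carrier G"
    and N: "N \<lhd> G" "\<not> fin_index G N"
  shows "\<exists>K. maximal_infinite_index G K \<and> N \<subseteq> K"
proof -
  define \<A> where "\<A> = {K. K \<lhd> G \<and> N \<subseteq> K \<and> \<not> fin_index G K}"
  have "\<exists>M\<in>\<A>. \<forall>X\<in>\<A>. M \<subseteq> X \<longrightarrow> X = M"
  proof (rule subset_Zorn_nonempty)
    show "\<A> \<noteq> {}" using N \<A>_def by blast
    fix \<C> assume \<C>: "\<C> \<noteq> {}" "subset.chain \<A> \<C>"
    then have sub: "\<And>C. C \<in> \<C> \<Longrightarrow> C \<in> \<A>" and ch: "\<And>C C'. C \<in> \<C> \<Longrightarrow> C' \<in> \<C> \<Longrightarrow> C \<subseteq> C' \<or> C' \<subseteq> C"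
      by (auto simp: subset_chain_def)
    have sg: "\<And>C. C \<in> \<C> \<Longrightarrow> subgroup C G" using sub normal_imp_subgroup unfolding \<A>_def by blast
    have s: "subgroup (\<Union>\<C>) G"
    proof
      show "\<Union>\<C> \<subseteq> carrier G" using sg subgroup.subset by blast
      show "\<one> \<in> \<Union>\<C>" using \<C> sg subgroup.one_closed by blast
      show "x \<otimes> y \<in> \<Union>\<C>" if xy: "x \<in> \<Union>\<C>" "y \<in> \<Union>\<C>" for x y
      proof -
        obtain C C' where C: "C \<in> \<C>" "x \<in> C" "C' \<in> \<C>" "y \<in> C'" using xy by blast
        then obtain B where B: "B \<in> \<C>" "x \<in> B" "y \<in> B" using ch[of C C'] by blast
        then have "x \<otimes> y \<in> B" using subgroup.m_closed[OF sg[OF B(1)]] by blast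
        then show ?thesis using B(1) by blast
      qed
      show "inv x \<in> \<Union>\<C>" if "x \<in> \<Union>\<C>" for x
        using that sg by (meson UnionE UnionI subgroup.m_inv_closed)
    qed
    have n: "\<Union>\<C> \<lhd> G"
    proof (rule normal_invI[OF s])
      fix x h assume "x \<in> carrier G" "h \<in> \<Union>\<C>"
      then show "x \<otimes> h \<otimes> inv x \<in> \<Union>\<C>"
        using sub unfolding \<A>_def by (metis (mono_tags, lifting) UnionE UnionI mem_Collect_eq
            normal_invE(2))
    qed
    have "\<not> fin_index G (\<Union>\<C>)"
    proof
      assume "fin_index G (\<Union>\<C>)"
      then obtain U where U: "finite U" "U \<subseteq> carrier G" "\<Union>\<C> = generate G U"
        using schreier[OF S] by metis
      have "U \<subseteq> \<Union>\<C>" unfolding U(3) by (simp add: subsetI generate.incl)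
      then obtain C where C: "C \<in> \<C>" "U \<subseteq> C"
        using finite_subset_Union_chain[OF U(1) _ \<C>] by blast
      then have "\<Union>\<C> \<subseteq> C" using U sg generate_subgroup_incl by metis
      then have "\<Union>\<C> = C" using C by blast
      then show False using \<open>fin_index G (\<Union>\<C>)\<close> sub C \<A>_def by auto
    qed
    moreover obtain C where "C \<in> \<C>" using \<C>(1) by blast
    then have "N \<subseteq> \<Union>\<C>" using sub[of C] unfolding \<A>_def by blast
    ultimately show "\<Union>\<C> \<in> \<A>" using n by (simp add: \<A>_def)
  qed
  then obtain M where "M \<in> \<A>" and M: "\<And>X. X \<in> \<A> \<Longrightarrow> M \<subseteq> X \<Longrightarrow> X = M" by metis
  then have *: "M \<lhd> G" "N \<subseteq> M" "\<not> fin_index G M" by (simp_all add: \<A>_def)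
  have "K' = M" if "K' \<lhd> G" "M \<subseteq> K'" "\<not> fin_index G K'" for K'
    using M[of K'] *(2) that by (simp add: \<A>_def)
  then show ?thesis using * unfolding maximal_infinite_index_def by blast
qed

section \<open>Products and commutators modulo a normal subgroup\<close>

lemma subset_set_mult:
  assumes "subgroup H G" "subgroup K G" shows "H \<subseteq> H <#> K" "K \<subseteq> H <#> K"
proof -
  interpret H: subgroup H G by fact
  interpret K: subgroup K G by fact
  show "H \<subseteq> H <#> K"
  proof
    fix h assume "h \<in> H"
    then have "h = h \<otimes> \<one>" by simp
    then show "h \<in> H <#> K" using \<open>h \<in> H\<close> K.one_closed unfolding set_mult_def by blast
  qed
  show "K \<subseteq> H <#> K"
  proof
    fix k assume "k \<in> K"
    then have "k = \<one> \<otimes> k" by simp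
    then show "k \<in> H <#> K" using \<open>k \<in> K\<close> H.one_closed unfolding set_mult_def by blast
  qed
qed

lemma subgroup_set_mult_normal:
  assumes "subgroup H G" "K \<lhd> G" shows "subgroup (H <#> K) G"
proof -
  interpret H: subgroup H G by fact
  interpret K: normal K G by fact
  have mem: "x \<in> H <#> K \<longleftrightarrow> (\<exists>h\<in>H. \<exists>k\<in>K. x = h \<otimes> k)" for x unfolding set_mult_def by blast
  show ?thesis
  proof
    show "H <#> K \<subseteq> carrier G" unfolding set_mult_def by auto
    show "\<one> \<in> H <#> K"
      using subset_set_mult(1)[OF H.subgroup_axioms K.subgroup_axioms] H.one_closed
          by (rule subsetD)
  next
    fix x y assume "x \<in> H <#> K" "y \<in> H <#> K"
    then obtain h k h' k' where *: "h \<in> H" "k \<in> K" "h' \<in> H" "k' \<in> K" "x = h \<otimes> k" "y = h' \<otimes> k'"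
      using mem by metis
    have "x \<otimes> y = (h \<otimes> h') \<otimes> ((inv h' \<otimes> k \<otimes> h') \<otimes> k')" using * by (simp add: m_assoc)
    then show "x \<otimes> y \<in> H <#> K"
      using * mem K.inv_op_closed1[of h' k] by (meson H.m_closed H.mem_carrier K.m_closed)
  next
    fix x assume "x \<in> H <#> K"
    then obtain h k where *: "h \<in> H" "k \<in> K" "x = h \<otimes> k" using mem by metis
    have "inv x = inv h \<otimes> (h \<otimes> inv k \<otimes> inv h)" using * by (simp add: m_assoc inv_mult_group)
    then show "inv x \<in> H <#> K"
      using * mem K.inv_op_closed2[of h "inv k"]
          by (meson H.m_inv_closed H.mem_carrier K.m_inv_closed)
  qed
qed

lemma normal_set_mult:
  assumes "H \<lhd> G" "K \<lhd> G" shows "(H <#> K) \<lhd> G"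
proof (rule normal_invI)
  interpret H: normal H G by fact
  interpret K: normal K G by fact
  show "subgroup (H <#> K) G" using assms subgroup_set_mult_normal H.subgroup_axioms by blast
  fix x y assume x: "x \<in> carrier G" and "y \<in> H <#> K"
  then obtain h k where *: "h \<in> H" "k \<in> K" "y = h \<otimes> k" unfolding set_mult_def by blast
  have "x \<otimes> y \<otimes> inv x = (x \<otimes> h \<otimes> inv x) \<otimes> (x \<otimes> k \<otimes> inv x)" using * x by (simp add: m_assoc)
  then show "x \<otimes> y \<otimes> inv x \<in> H <#> K"
    using H.inv_op_closed2[OF x *(1)] K.inv_op_closed2[OF x *(2)] unfolding set_mult_def by blast
qed

lemma commutator_mod_cong:
  assumes N: "N \<lhd> G" and car: "a \<in> carrier G" "b \<in> carrier G" "x \<in> carrier G" "y \<in> carrier G"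
    and eq: "N #> x = N #> a" "N #> y = N #> b" and c: "commutator G a b \<in> N"
  shows "commutator G x y \<in> N"
proof -
  interpret N: normal N G by fact
  interpret Q: group "G Mod N" by (rule N.factorgroup_is_group)
  interpret h: group_hom G "G Mod N" "\<lambda>a. N #> a"
    by unfold_locales (rule N.r_coset_hom_Mod)
  have hc: "N #> commutator G u v = commutator (G Mod N) (N #> u) (N #> v)"
    if "u \<in> carrier G" "v \<in> carrier G" for u v
    using that h.hom_mult h.hom_inv by (simp add: commutator_def del: mult_FactGroup)
  have "N #> commutator G x y = N #> commutator G a b"
    using eq hc car by simp
  also have "\<dots> = N" using c by (simp add: N.rcos_const)
  finally show ?thesis using car coset_join1 N.subgroup_axioms
    by (metis commutator_closed N.subset)
qed

text \<open>The set in question is the preimage of the centre of \<open>G\<close> modulo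
  \<open>N\<close>.\<close>

lemma commutes_mod_normal:
  assumes N: "N \<lhd> G" shows "{a \<in> carrier G. \<forall>g\<in>carrier G. commutator G a g \<in> N} \<lhd> G"
proof (rule normal_invI)
  interpret N: normal N G by fact
  let ?Z = "{a \<in> carrier G. \<forall>g\<in>carrier G. commutator G a g \<in> N}"
  show "subgroup ?Z G"
  proof
    show "\<one> \<in> ?Z" by (simp add: commutator_def)
  next
    fix a b assume ab: "a \<in> ?Z" "b \<in> ?Z"
    have "commutator G (a \<otimes> b) g \<in> N" if g: "g \<in> carrier G" for g
    proof -
      have "commutator G (a \<otimes> b) g = (a \<otimes> commutator G b g \<otimes> inv a) \<otimes> commutator G a g"
        using ab g by (simp add: commutator_def m_assoc inv_mult_group)
      then show ?thesis using ab g N.inv_op_closed2 by simp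
    qed
    then show "a \<otimes> b \<in> ?Z" using ab by simp
  next
    fix a assume a: "a \<in> ?Z"
    have "commutator G (inv a) g \<in> N" if g: "g \<in> carrier G" for g
    proof -
      have "commutator G (inv a) g = inv a \<otimes> inv (commutator G a g) \<otimes> a"
        using a g by (simp add: commutator_def m_assoc inv_mult_group)
      then show ?thesis using a g N.inv_op_closed1 by simp
    qed
    then show "inv a \<in> ?Z" using a by simp
  qed auto
  fix x a assume x: "x \<in> carrier G" and a: "a \<in> ?Z"
  have "commutator G (x \<otimes> a \<otimes> inv x) g \<in> N" if g: "g \<in> carrier G" for g
  proof -
    have "commutator G (x \<otimes> a \<otimes> inv x) g = x \<otimes> commutator G a (inv x \<otimes> g \<otimes> x) \<otimes> inv x"
      using a g x by (simp add: commutator_def m_assoc inv_mult_group)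
    then show ?thesis using a g x N.inv_op_closed2 by simp
  qed
  then show "x \<otimes> a \<otimes> inv x \<in> ?Z" using a x by simp
qed

lemma commutes_mod_generators:
  assumes N: "N \<lhd> G" and S: "S \<subseteq> carrier G" and a: "a \<in> carrier G"
    and c: "\<And>s. s \<in> S \<Longrightarrow> commutator G a s \<in> N" and g: "g \<in> generate G S"
  shows "commutator G a g \<in> N"
proof -
  interpret N: normal N G by fact
  from g show ?thesis
  proof (induction g rule: generate.induct)
    case one then show ?case using a by (simp add: commutator_def)
  next
    case (incl h) then show ?case using c by blast
  next
    case (inv h)
    then have h: "h \<in> carrier G" using S by blast
    have "commutator G a (inv h) = inv h \<otimes> inv (commutator G a h) \<otimes> h"
      using a h by (simp add: commutator_def m_assoc inv_mult_group)
    then show ?case using c[OF inv] h N.inv_op_closed1 by simp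
  next
    case (eng h k)
    then have h: "h \<in> carrier G" "k \<in> carrier G" using generate_in_carrier[OF S] by auto
    have "commutator G a (h \<otimes> k) = commutator G a h \<otimes> (h \<otimes> commutator G a k \<otimes> inv h)"
      using a h by (simp add: commutator_def m_assoc inv_mult_group)
    then show ?case using eng h N.inv_op_closed2 by simp
  qed
qed

text \<open>If all these commutators were in \<open>N\<close>, then \<open>A <#> N\<close> and
  \<open>B <#> N\<close>, both of finite index by maximality, would commute modulo \<open>N\<close>.
  Their intersection would be a subgroup of finite index that is abelian modulo \<open>N\<close>, so
  \<open>N\<close> would have finite index.\<close>

lemma prime_of_maximal_infinite_index:
  assumes S: "finite S" "S \<subseteq> carrier G" "generate G S = carrier G" and tor: "torsion G"
    and mN: "maximal_infinite_index G N"
    and A: "A \<lhd> G" "\<not> A \<subseteq> N" and B: "B \<lhd> G" "\<not> B \<subseteq> N"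
  shows "\<exists>a\<in>A. \<exists>b\<in>B. commutator G a b \<notin> N"
proof (rule ccontr)
  assume "\<not> ?thesis"
  then have c: "\<And>a b. a \<in> A \<Longrightarrow> b \<in> B \<Longrightarrow> commutator G a b \<in> N" by blast
  have N: "N \<lhd> G" "\<not> fin_index G N"
    and max: "\<And>K. K \<lhd> G \<Longrightarrow> N \<subseteq> K \<Longrightarrow> \<not> fin_index G K \<Longrightarrow> K = N"
    using mN unfolding maximal_infinite_index_def by blast+
  interpret N: normal N G by fact
  interpret A: normal A G by fact
  interpret B: normal B G by fact
  have fi: "fin_index G (A' <#> N)" if "A' \<lhd> G" "\<not> A' \<subseteq> N" for A'
  proof -
    have n: "(A' <#> N) \<lhd> G" using that N by (simp add: normal_set_mult)
    interpret A': normal A' G by fact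
    have "N \<subseteq> A' <#> N" "A' \<subseteq> A' <#> N"
      using subset_set_mult A'.subgroup_axioms N.subgroup_axioms by auto
    then show ?thesis using max[OF n] that by blast
  qed
  have C: "fin_index G ((A <#> N) \<inter> (B <#> N))" using fi A B fin_index_inter by blast
  have "fin_index G N"
  proof (rule fin_index_of_commutators[OF S tor C N(1)])
    fix x y assume "x \<in> (A <#> N) \<inter> (B <#> N)" "y \<in> (A <#> N) \<inter> (B <#> N)"
    then obtain a n b n' where x: "x = a \<otimes> n" "a \<in> A" "n \<in> N" and y: "y = b \<otimes> n'" "b \<in> B" "n' \<in> N"
      unfolding set_mult_def by blast
    have car: "a \<in> carrier G" "b \<in> carrier G" "x \<in> carrier G" "y \<in> carrier G" "n \<in> carrier G" "n'
        \<in> carrier G"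
      using x y by auto
    have coset1: "N #> (u \<otimes> v) = N #> u" if "u \<in> carrier G" "v \<in> N" for u v
      using that rcoset_eq_iff[OF N.subgroup_axioms, of "u \<otimes> v" u] N.inv_op_closed2 by simp
    have xa: "N #> x = N #> a" "N #> y = N #> b" using coset1 x y by auto
    show "commutator G x y \<in> N"
      by (rule commutator_mod_cong[OF N(1) _ _ _ _ xa]) (use car c x y in auto)
  qed
  then show False using N by simp
qed

text \<open>The identity \<open>[s, h k] = [s, h] (h [s, k] h^-1)\<close> reduces the second
  argument to generators, and \<open>[y, x] = [x, y]^-1\<close> exchanges the arguments. It suffices
  that \<open>K\<close> is invariant under conjugation by the generated subgroup; \<open>K\<close>
  need not be normal in \<open>G\<close>.\<close>

lemma commutator_generate:
  assumes "S \<subseteq> carrier G" and K: "subgroup K G"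
    and conj: "\<And>g k. g \<in> generate G S \<Longrightarrow> k \<in> K \<Longrightarrow> g \<otimes> k \<otimes> inv g \<in> K"
    and c: "\<And>a b. a \<in> S \<Longrightarrow> b \<in> S \<Longrightarrow> commutator G a b \<in> K"
    and a: "a \<in> generate G S" and b: "b \<in> generate G S"
  shows "commutator G a b \<in> K"
proof -
  interpret K: subgroup K G by fact
  interpret S: subgroup "generate G S" G using assms(1) by (rule generate_is_subgroup)
  have left: "(\<And>b. b \<in> T \<Longrightarrow> commutator G s b \<in> K) \<Longrightarrow> T \<subseteq> generate G S \<Longrightarrow> s \<in> generate G S
      \<Longrightarrow> b \<in> generate G T \<Longrightarrow> commutator G s b \<in> K" for s b T
  proof -
    assume T: "\<And>b. b \<in> T \<Longrightarrow> commutator G s b \<in> K" "T \<subseteq> generate G S" and s: "s \<in> generate G S"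
    have sub: "generate G T \<subseteq> generate G S" using T(2) S.subgroup_axioms generate_subgroup_incl
        by blast
    show "b \<in> generate G T \<Longrightarrow> commutator G s b \<in> K"
    proof (induction b rule: generate.induct)
      case one then show ?case using s S.mem_carrier by (simp add: commutator_def)
    next
      case (incl h) then show ?case using T by blast
    next
      case (inv h)
      have h: "h \<in> generate G S" using inv T by blast
      then have "commutator G s (inv h) = inv h \<otimes> inv (commutator G s h) \<otimes> inv (inv h)"
        using S.mem_carrier s by (simp add: commutator_def m_assoc inv_mult_group)
      then show ?case using conj[of "inv h"] h T inv by simp
    next
      case (eng h1 h2)
      then have h: "h1 \<in> generate G S" "h2 \<in> generate G S" using sub by auto
      then have "commutator G s (h1 \<otimes> h2) = commutator G s h1 \<otimes> (h1 \<otimes> commutator G s h2 \<otimes> inv h1)"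
        using S.mem_carrier s by (simp add: commutator_def m_assoc inv_mult_group)
      then show ?case using conj h eng by simp
    qed
  qed
  have sym: "commutator G y x \<in> K"
      if "commutator G x y \<in> K" "x \<in> generate G S" "y \<in> generate G S" for x y
  proof -
    have "commutator G y x = inv (commutator G x y)"
      using that S.mem_carrier by (simp add: commutator_def m_assoc inv_mult_group)
    then show ?thesis using that by simp
  qed
  have S: "S \<subseteq> generate G S" by (simp add: subsetI generate.incl)
  have "commutator G s b \<in> K" if "s \<in> S" for s
  proof (rule left[OF _ S _ b])
    show "s \<in> generate G S" using S that by blast
  qed (use c that in blast)
  then have "commutator G b s \<in> K" if "s \<in> S" for s using sym that S b by blast
  then have "commutator G b a \<in> K" by (rule left[OF _ S b a])
  then show ?thesis using sym a b by blast
qed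

section \<open>Density in the profinite topology\<close>

lemma prodense_fin_index_eq:
  assumes "prodense G M" "fin_index G M" shows "M = carrier G"
proof -
  have "subgroup M G" using assms by (simp add: prodense_def)
  then interpret M: subgroup M G .
  have "g \<in> M" if "g \<in> carrier G" for g
    using assms that unfolding prodense_def by (metis M.m_closed)
  then show ?thesis using M.subset by blast
qed

text \<open>For \<open>K\<close> normal of finite index, \<open>M <#> K\<close> is a subgroup above
  \<open>M\<close>. It cannot be \<open>M\<close>, since \<open>M\<close> would then contain
  \<open>K\<close> and have finite index; by maximality it is everything.\<close>

lemma prodense_of_maximal:
  assumes M: "maximal_subgroup M G" and inf: "\<not> fin_index G M"
  shows "prodense G M"
  unfolding prodense_def
proof (intro conjI allI impI ballI)
  show sM: "subgroup M G" using M by (simp add: maximal_subgroup_def)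
  interpret M: subgroup M G by fact
  fix H g assume H: "fin_index G H" and g: "g \<in> carrier G"
  obtain K where K: "K \<lhd> G" "fin_index G K" "K \<subseteq> H" using fin_index_core[OF H] by blast
  interpret K: normal K G by fact
  have "subgroup (M <#> K) G" using sM K(1) by (rule subgroup_set_mult_normal)
  moreover have "M \<subseteq> M <#> K" "K \<subseteq> M <#> K"
    using subset_set_mult sM K.subgroup_axioms by auto
  ultimately have "M <#> K = carrier G"
    using M inf K(2) fin_index_mono[OF K(2) sM] unfolding maximal_subgroup_def by metis
  then show "\<exists>m\<in>M. \<exists>h\<in>H. g = m \<otimes> h" using g K unfolding set_mult_def by blast
qed

lemma fin_index_of_finite_complement:
  assumes N: "N \<lhd> G" and F: "finite F" "F \<subseteq> carrier G"
    and cov: "\<And>g. g \<in> carrier G \<Longrightarrow> \<exists>f\<in>F. g \<otimes> inv f \<in> N"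
  shows "fin_index G N"
proof (rule fin_indexI[where F = "\<lambda>g. SOME f. f \<in> F \<and> g \<otimes> inv f \<in> N"])
  interpret N: normal N G by fact
  show "subgroup N G" by (rule N.subgroup_axioms)
  have ex: "(SOME f. f \<in> F \<and> g \<otimes> inv f \<in> N) \<in> F \<and> g \<otimes> inv (SOME f. f \<in> F \<and> g \<otimes> inv f \<in> N) \<in> N"
    if "g \<in> carrier G" for g using someI_ex[of "\<lambda>f. f \<in> F \<and> g \<otimes> inv f \<in> N"] cov[OF that] by blast
  then have "(\<lambda>g. SOME f. f \<in> F \<and> g \<otimes> inv f \<in> N) ` carrier G \<subseteq> F" by blast
  then show "finite ((\<lambda>g. SOME f. f \<in> F \<and> g \<otimes> inv f \<in> N) ` carrier G)" using F(1) finite_subset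
      by blast
  fix a b assume ab: "a \<in> carrier G" "b \<in> carrier G"
    and eq: "(SOME f. f \<in> F \<and> a \<otimes> inv f \<in> N) = (SOME f. f \<in> F \<and> b \<otimes> inv f \<in> N)"
  define f where "f = (SOME f. f \<in> F \<and> a \<otimes> inv f \<in> N)"
  have f: "f \<in> carrier G" "a \<otimes> inv f \<in> N" "b \<otimes> inv f \<in> N"
    using ex[OF ab(1)] ex[OF ab(2)] eq F(2) by (auto simp: f_def)
  then have "(a \<otimes> inv f) \<otimes> inv (b \<otimes> inv f) \<in> N" by blast
  then show "a \<otimes> inv b \<in> N" using ab f by (simp add: inv_mult_group m_assoc)
qed

lemma normal_conj_coset:
  assumes N: "N \<lhd> G" and "u \<in> N" "g \<in> carrier G"
  shows "N #> (u \<otimes> g \<otimes> inv u) = N #> g"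
proof -
  interpret N: normal N G by fact
  have u: "u \<in> carrier G" using assms by simp
  have "(u \<otimes> g \<otimes> inv u) \<otimes> inv g = u \<otimes> (g \<otimes> inv u \<otimes> inv g)" using u assms by (simp add: m_assoc)
  also have "\<dots> \<in> N" using assms N.inv_op_closed2 by simp
  finally show ?thesis using rcoset_eq_iff[OF N.subgroup_axioms] u assms by simp
qed

lemma comm_quotient_of_commutators:
  assumes E: "subgroup E G" and c: "\<And>a b. a \<in> carrier G \<Longrightarrow> b \<in> carrier G \<Longrightarrow> commutator G a b \<in> E"
  shows "E \<lhd> G" "comm_group (G Mod E)"
proof -
  interpret E: subgroup E G by fact
  show n: "E \<lhd> G"
  proof (rule normal_invI[OF E])
    fix x h assume xh: "x \<in> carrier G" "h \<in> E"
    then have "commutator G x h \<otimes> h \<in> E" using c by simp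
    moreover have "x \<otimes> h \<otimes> inv x = commutator G x h \<otimes> h"
      using xh by (simp add: commutator_def)
    ultimately show "x \<otimes> h \<otimes> inv x \<in> E" by simp
  qed
  interpret E: normal E G by (rule n)
  interpret Q: group "G Mod E" by (rule E.factorgroup_is_group)
  show "comm_group (G Mod E)"
  proof (rule Q.group_comm_groupI)
    fix x y assume "x \<in> carrier (G Mod E)" "y \<in> carrier (G Mod E)"
    then obtain a b where ab: "a \<in> carrier G" "b \<in> carrier G" "x = E #> a" "y = E #> b"
      by (auto simp: carrier_FactGroup)
    have "a \<otimes> b \<otimes> inv (b \<otimes> a) \<in> E" using c[OF ab(1,2)] ab
        by (simp add: commutator_def inv_mult_group m_assoc)
    then have "E #> (a \<otimes> b) = E #> (b \<otimes> a)"
      using ab(1,2) by (intro rcoset_eq_iff[OF E, THEN iffD2]) auto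
    then show "x \<otimes>\<^bsub>G Mod E\<^esub> y = y \<otimes>\<^bsub>G Mod E\<^esub> x"
      using ab by (simp add: E.rcos_sum)
  qed
qed

section \<open>Proper subgroups of finite nilpotent groups\<close>

lemma lower_central_subgroup: "subgroup (lower_central G k) G"
proof (induction k)
  case 0 show ?case by (simp add: subgroup_self)
next
  case (Suc k)
  show ?case unfolding lower_central.simps
    by (rule generate_is_subgroup) (use subgroup.mem_carrier[OF Suc] in auto)
qed

lemma lower_central_commutator:
  "a \<in> lower_central G k \<Longrightarrow> b \<in> carrier G \<Longrightarrow> commutator G a b \<in> lower_central G (Suc k)"
  unfolding lower_central.simps commutator_def by (rule generate.incl) blast

text \<open>A maximal subgroup of a finite nilpotent group contains all commutators. This turns any
  proper subgroup of \<open>D\<close> into one with abelian quotient, to which the characters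
  constructed later apply.\<close>

lemma nilpotent_proper_subgroup:
  assumes fin: "finite (carrier G)" and nil: "nilpotent_group G"
    and E0: "subgroup E0 G" "E0 \<noteq> carrier G"
  shows "\<exists>E. subgroup E G \<and> E0 \<subseteq> E \<and> E \<noteq> carrier G \<and>
    (\<forall>a\<in>carrier G. \<forall>b\<in>carrier G. commutator G a b \<in> E)"
proof -
  define \<A> where "\<A> = {E. subgroup E G \<and> E0 \<subseteq> E \<and> E \<noteq> carrier G}"
  have "\<A> \<subseteq> Pow (carrier G)" unfolding \<A>_def using subgroup.subset by blast
  then have "finite \<A>" using fin finite_subset by blast
  moreover have "E0 \<in> \<A>" using E0 by (simp add: \<A>_def)
  ultimately obtain E where E: "E \<in> \<A>" and max: "\<And>H. H \<in> \<A> \<Longrightarrow> E \<subseteq> H \<Longrightarrow> H = E"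
    using finite_has_maximal[of \<A>] by blast
  then have E': "subgroup E G" "E0 \<subseteq> E" "E \<noteq> carrier G" by (auto simp: \<A>_def)
  interpret E: subgroup E G by (rule E'(1))
  obtain c where "lower_central G c = {\<one>}" using nil by (auto simp: nilpotent_group_def)
  then have "lower_central G c \<subseteq> E" by simp
  \<comment> \<open>The first term of the lower central series inside \<open>E\<close>. Its
    predecessor \<open>K\<close> is not contained in \<open>E\<close>, hence generates everything
    together with \<open>E\<close>, and yet its commutators with all elements lie in
    \<open>E\<close>.\<close>
  define m where "m = (LEAST n. lower_central G n \<subseteq> E)"
  have m: "lower_central G m \<subseteq> E" unfolding m_def using \<open>lower_central G c \<subseteq> E\<close> by (rule LeastI)
  have "m \<noteq> 0" using m E'(3) E.subset by (metis lower_central.simps(1) subset_antisym)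
  then obtain k where k: "m = Suc k" using not0_implies_Suc by blast
  then have nk: "\<not> lower_central G k \<subseteq> E" using not_less_Least[of k
      "\<lambda>n. lower_central G n \<subseteq> E"] m_def by simp
  define K where "K = lower_central G k"
  interpret K: subgroup K G unfolding K_def by (rule lower_central_subgroup)
  have cK: "commutator G a b \<in> E" if "a \<in> K" "b \<in> carrier G" for a b
    using lower_central_commutator[of a k b] that m k K_def by blast
  have EK: "E \<union> K \<subseteq> carrier G" using E.subset K.subset by blast
  interpret EK: subgroup "generate G (E \<union> K)" G using EK by (rule generate_is_subgroup)
  have sub: "E \<union> K \<subseteq> generate G (E \<union> K)" by (simp add: subsetI generate.incl)
  have "generate G (E \<union> K) \<noteq> E" using sub nk K_def by blast
  then have "generate G (E \<union> K) \<notin> \<A>" using max sub by blast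
  then have gen: "generate G (E \<union> K) = carrier G"
    using EK.subgroup_axioms sub E'(2) unfolding \<A>_def by blast
  have conj1: "x \<otimes> e \<otimes> inv x \<in> E" if x: "x \<in> E \<union> K" and e: "e \<in> E" for x e
  proof (cases "x \<in> E")
    case False
    then have "x \<in> K" using x by blast
    then have "x \<otimes> e \<otimes> inv x = commutator G x e \<otimes> e" using e by (simp add: commutator_def)
    then show ?thesis using cK \<open>x \<in> K\<close> e by simp
  qed (use e in simp)
  have conj: "g \<otimes> e \<otimes> inv g \<in> E" if "g \<in> generate G (E \<union> K)" "e \<in> E" for g e
    using that
  proof (induction g arbitrary: e rule: generate.induct)
    case one then show ?case by simp
  next
    case (incl h) then show ?case using conj1 by blast
  next
    case (inv h)
    then have "inv h \<in> E \<union> K" by auto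
    then show ?case using conj1 inv by blast
  next
    case (eng g h)
    then have c: "g \<in> carrier G" "h \<in> carrier G" using EK.mem_carrier by auto
    have "g \<otimes> h \<otimes> e \<otimes> inv (g \<otimes> h) = g \<otimes> (h \<otimes> e \<otimes> inv h) \<otimes> inv g"
      using c eng.prems by (simp add: inv_mult_group m_assoc)
    then show ?case using eng by simp
  qed
  have "commutator G a b \<in> E" if "a \<in> carrier G" "b \<in> carrier G" for a b
  proof (rule commutator_generate[OF EK E.subgroup_axioms conj])
    fix x y assume xy: "x \<in> E \<union> K" "y \<in> E \<union> K"
    show "commutator G x y \<in> E"
    proof (cases "x \<in> K")
      case True then show ?thesis using cK xy EK by blast
    next
      case False
      then have x: "x \<in> E" using xy by blast
      have yc: "y \<in> carrier G" using xy EK by blast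
      have "commutator G x y = x \<otimes> (y \<otimes> inv x \<otimes> inv y)" using x yc
          by (simp add: commutator_def m_assoc)
      then show ?thesis using conj1[OF xy(2), of "inv x"] x by simp
    qed
  qed (use that gen in auto)
  then show ?thesis using E' by blast
qed

end

text \<open>Meant for first return times: \<open>c\<close> will be the orbit length of the first
  letter of a word, and \<open>Q\<close> the return of the remaining word under the stabilised
  section.\<close>

lemma Least_multiple:
  assumes "0 < (c::nat)" and P: "\<And>k. P k \<longleftrightarrow> (\<exists>j. k = c * j \<and> Q j)" and ex: "\<exists>j\<ge>1. Q j"
  shows "(LEAST k. 1 \<le> k \<and> P k) = c * (LEAST j. 1 \<le> j \<and> Q j)"
proof -
  obtain i where "1 \<le> i \<and> Q i" using ex by blast
  then have j: "1 \<le> (LEAST j. 1 \<le> j \<and> Q j) \<and> Q (LEAST j. 1 \<le> j \<and> Q j)" by (rule LeastI)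
  show ?thesis
  proof (rule Least_equality)
    show "1 \<le> c * (LEAST j. 1 \<le> j \<and> Q j) \<and> P (c * (LEAST j. 1 \<le> j \<and> Q j))"
      using j P assms(1) by auto
    fix k assume k: "1 \<le> k \<and> P k"
    then obtain i where "k = c * i" "Q i" "1 \<le> i" using P
        by (metis mult_0_right not_less_eq_eq One_nat_def le0 le_antisym not_less_eq_eq)
    then show "c * (LEAST j. 1 \<le> j \<and> Q j) \<le> k" by (simp add: Least_le)
  qed
qed

lemma coprime_combination:
  fixes a b :: nat
  assumes "coprime a b" "b > 0" "n \<ge> a * b"
  shows "\<exists>i j. n = i * a + j * b"
proof -
  obtain x where x: "[a * x = 1] (mod b)" using cong_solve_coprime_nat[OF assms(1)] by auto
  \<comment> \<open>Up to multiples of \<open>b\<close>, \<open>i\<close> is \<open>n\<close>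
    divided by \<open>a\<close>; being smaller than \<open>b\<close>, it leaves a non-negative
    remainder \<open>n - i * a\<close> by the bound \<open>a * b\<close>.\<close>
  define i where "i = (x * n) mod b"
  have "[a * i = a * (x * n)] (mod b)" by (simp add: i_def cong_def mod_mult_right_eq)
  also have "[a * (x * n) = n] (mod b)" using cong_mult[OF x cong_refl[of n b]]
      by (simp add: mult.assoc)
  finally have c: "[n = i * a] (mod b)" by (simp add: cong_sym mult.commute)
  have "i < b" using assms(2) by (simp add: i_def)
  then have "i * a \<le> n" using assms(3)
      by (metis less_imp_le_nat mult.commute mult_le_mono2 order_trans)
  then have "b dvd n - i * a" using c by (simp add: cong_altdef_nat)
  then obtain j where "n - i * a = b * j" by blast
  then have "n = i * a + j * b" using \<open>i * a \<le> n\<close> by (simp add: mult.commute)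
  then show ?thesis by blast
qed

section \<open>Automorphisms of the tree and their sections\<close>

lemma prefix_card: "card {u. prefix u w} = Suc (length w)"
proof -
  have "{u. prefix u w} = set (prefixes w)" by (auto simp: in_set_prefixes)
  then show ?thesis by (simp add: distinct_card length_prefixes)
qed

lemma prefix_in_lists: "prefix u w \<Longrightarrow> w \<in> lists X \<Longrightarrow> u \<in> lists X"
  by (auto simp: prefix_def)

context
  fixes X :: "'a set"
begin

lemma tree_aut_memI:
  assumes "f \<in> extensional (lists X)" "bij_betw f (lists X) (lists X)"
    and "\<And>u v. u \<in> lists X \<Longrightarrow> v \<in> lists X \<Longrightarrow> prefix (f u) (f v) \<longleftrightarrow> prefix u v"
  shows "f \<in> carrier (tree_aut X)"
  using assms by (simp add: tree_aut_def Bij_def)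

lemma tree_aut_memD:
  assumes "f \<in> carrier (tree_aut X)"
  shows "f \<in> Bij (lists X)" "f \<in> extensional (lists X)" "bij_betw f (lists X) (lists X)"
    and "\<And>u v. u \<in> lists X \<Longrightarrow> v \<in> lists X \<Longrightarrow> prefix (f u) (f v) \<longleftrightarrow> prefix u v"
    and "\<And>u. u \<in> lists X \<Longrightarrow> f u \<in> lists X"
  using assms by (auto simp: tree_aut_def Bij_def dest: bij_betwE)

lemma group_tree_aut: "group (tree_aut X)"
proof -
  interpret B: group "BijGroup (lists X)" by (rule group_BijGroup)
  have "subgroup (carrier (tree_aut X)) (BijGroup (lists X))"
  proof
    show "carrier (tree_aut X) \<subseteq> carrier (BijGroup (lists X))"
      by (auto simp: tree_aut_def BijGroup_def)
    show "\<one>\<^bsub>BijGroup (lists X)\<^esub> \<in> carrier (tree_aut X)"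
      by (auto simp: tree_aut_def BijGroup_def id_Bij)
  next
    fix f g assume f: "f \<in> carrier (tree_aut X)" and g: "g \<in> carrier (tree_aut X)"
    note * = tree_aut_memD[OF f] tree_aut_memD[OF g]
    then show "f \<otimes>\<^bsub>BijGroup (lists X)\<^esub> g \<in> carrier (tree_aut X)"
      by (auto simp: tree_aut_def BijGroup_def compose_Bij compose_eq simp del: in_lists_conv_set)
  next
    fix f assume f: "f \<in> carrier (tree_aut X)"
    note F = tree_aut_memD[OF f]
    have carrier_Bij: "carrier (BijGroup (lists X)) = Bij (lists X)" by (simp add: BijGroup_def)
    have f': "f \<in> carrier (BijGroup (lists X))" using F by (simp add: BijGroup_def)
    define g where "g = inv\<^bsub>BijGroup (lists X)\<^esub> f"
    have g: "g \<in> Bij (lists X)" 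
      using B.inv_closed[OF f'] carrier_Bij unfolding g_def by metis
    have "f \<otimes>\<^bsub>BijGroup (lists X)\<^esub> g = \<one>\<^bsub>BijGroup (lists X)\<^esub>" using f' by (simp add: g_def B.r_inv)
    then have cg: "compose (lists X) f g = (\<lambda>x\<in>lists X. x)" using F(1) g by (simp add: BijGroup_def)
    have fg: "f (g u) = u" if u: "u \<in> lists X" for u
      using fun_cong[OF cg, of u] u by (simp add: compose_eq del: in_lists_conv_set)
    have gl: "g u \<in> lists X" if "u \<in> lists X" for u
      using g that Bij_imp_funcset by blast
    have "prefix (g u) (g v) \<longleftrightarrow> prefix u v" if "u \<in> lists X" "v \<in> lists X" for u v
      using F(4)[of "g u" "g v"] gl that fg by simp
    then show "g \<in> carrier (tree_aut X)"
      using g by (simp add: tree_aut_def)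
  qed
  then have "group (BijGroup (lists X) \<lparr>carrier := carrier (tree_aut X)\<rparr>)"
    by (rule subgroup.subgroup_is_group) (rule group_BijGroup)
  then show ?thesis by (simp add: tree_aut_def)
qed

interpretation A: group "tree_aut X" by (rule group_tree_aut)

lemma tree_aut_one: "\<one>\<^bsub>tree_aut X\<^esub> = (\<lambda>x\<in>lists X. x)"
  by (simp add: tree_aut_def BijGroup_def)

lemma tree_aut_mult:
  assumes "f \<in> carrier (tree_aut X)" "g \<in> carrier (tree_aut X)"
  shows "f \<otimes>\<^bsub>tree_aut X\<^esub> g = compose (lists X) f g"
  using tree_aut_memD(1)[OF assms(1)] tree_aut_memD(1)[OF assms(2)]
  by (simp add: tree_aut_def BijGroup_def)

lemma tree_aut_mult_apply:
  assumes "f \<in> carrier (tree_aut X)" "g \<in> carrier (tree_aut X)" "w \<in> lists X"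
  shows "(f \<otimes>\<^bsub>tree_aut X\<^esub> g) w = f (g w)"
  using assms by (simp add: tree_aut_mult compose_eq)

lemma tree_aut_ext:
  assumes "f \<in> carrier (tree_aut X)" "g \<in> carrier (tree_aut X)" "\<And>w. w \<in> lists X \<Longrightarrow> f w = g w"
  shows "f = g"
  using tree_aut_memD(2)[OF assms(1)] tree_aut_memD(2)[OF assms(2)] assms(3)
      by (rule extensionalityI)

text \<open>Length is an invariant of the prefix order: \<open>f\<close> maps the prefixes of
  \<open>w\<close> bijectively onto those of \<open>f w\<close>, and a word has one prefix more than
  its length.\<close>

lemma tree_aut_length:
  assumes f: "f \<in> carrier (tree_aut X)" and w: "w \<in> lists X"
  shows "length (f w) = length w"
proof -
  note F = tree_aut_memD[OF f]
  have "f ` {u. prefix u w} = {u. prefix u (f w)}"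
  proof safe
    fix u assume "prefix u w" then show "prefix (f u) (f w)" using F(4) w prefix_in_lists by blast
  next
    fix u assume u: "prefix u (f w)"
    then have "u \<in> lists X" using F(5) w prefix_in_lists by blast
    then obtain v where v: "v \<in> lists X" "f v = u" using F(3) by (metis bij_betw_imp_surj_on imageE)
    then show "u \<in> f ` {u. prefix u w}" using F(4) w u by blast
  qed
  moreover have "inj_on f {u. prefix u w}"
    using F(3) by (rule inj_on_subset[OF bij_betw_imp_inj_on]) (use prefix_in_lists w in blast)
  ultimately have "card {u. prefix u (f w)} = card {u. prefix u w}" by (metis card_image)
  then show ?thesis by (simp add: prefix_card)
qed

lemma tree_aut_append:
  assumes f: "f \<in> carrier (tree_aut X)" and "v \<in> lists X" "u \<in> lists X"
  shows "f (v @ u) = f v @ tree_section X f v u"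
proof -
  have "prefix (f v) (f (v @ u))" using tree_aut_memD(4)[OF f] assms by simp
  then obtain z where "f (v @ u) = f v @ z" by (auto simp: prefix_def)
  then show ?thesis using assms tree_aut_length[OF f] by (simp add: tree_section_def)
qed

lemma tree_section_closed:
  assumes f: "f \<in> carrier (tree_aut X)" and v: "v \<in> lists X"
  shows "tree_section X f v \<in> carrier (tree_aut X)"
proof (rule tree_aut_memI)
  note F = tree_aut_memD[OF f]
  note app = tree_aut_append[OF f v]
  show "tree_section X f v \<in> extensional (lists X)" by (simp add: tree_section_def)
  have cl: "tree_section X f v u \<in> lists X" if "u \<in> lists X" for u
    using F(5)[of "v @ u"] that v app by simp
  show "bij_betw (tree_section X f v) (lists X) (lists X)"
  proof (rule bij_betw_imageI)
    show "inj_on (tree_section X f v) (lists X)"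
    proof
      fix u u' assume u: "u \<in> lists X" "u' \<in> lists X" "tree_section X f v u = tree_section X f v u'"
      then have "f (v @ u) = f (v @ u')" by (simp add: app)
      then have "v @ u = v @ u'" using F(3) u v
          by (meson append_in_lists_conv bij_betw_imp_inj_on inj_onD)
      then show "u = u'" by simp
    qed
    show "tree_section X f v ` lists X = lists X"
    proof (intro equalityI subsetI)
      fix w assume w: "w \<in> lists X"
      then have "f v @ w \<in> lists X" using F(5) v by simp
      then obtain z where z: "z \<in> lists X" "f z = f v @ w" using F(3)
          by (metis bij_betw_imp_surj_on imageE)
      then have "prefix v z" using F(4)[OF v z(1)] by simp
      then obtain u where u: "z = v @ u" by (auto simp: prefix_def)
      then have "tree_section X f v u = w" "u \<in> lists X" using z app by auto
      then show "w \<in> tree_section X f v ` lists X" by blast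
    qed (use cl in blast)
  qed
  fix u u' assume u: "u \<in> lists X" "u' \<in> lists X"
  then show "prefix (tree_section X f v u) (tree_section X f v u') \<longleftrightarrow> prefix u u'"
    using F(4)[of "v @ u" "v @ u'"] v by (simp add: app)
qed

lemma tree_section_mult:
  assumes f: "f \<in> carrier (tree_aut X)" and g: "g \<in> carrier (tree_aut X)" and v: "v \<in> lists X"
  shows "tree_section X (f \<otimes>\<^bsub>tree_aut X\<^esub> g) v =
    tree_section X f (g v) \<otimes>\<^bsub>tree_aut X\<^esub> tree_section X g v"
proof (rule tree_aut_ext)
  have gv: "g v \<in> lists X" using tree_aut_memD(5)[OF g v] .
  fix w assume w: "w \<in> lists X"
  have fg: "f \<otimes>\<^bsub>tree_aut X\<^esub> g \<in> carrier (tree_aut X)" using f g by simp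
  have sw: "tree_section X g v w \<in> lists X"
    using tree_aut_memD(5)[OF tree_section_closed[OF g v] w] .
  have "f (g v) @ tree_section X (f \<otimes>\<^bsub>tree_aut X\<^esub> g) v w = (f \<otimes>\<^bsub>tree_aut X\<^esub> g) (v @ w)"
    using tree_aut_append[OF fg v w] tree_aut_mult_apply[OF f g v] by simp
  also have "\<dots> = f (g v @ tree_section X g v w)"
    using tree_aut_mult_apply[OF f g] v w tree_aut_append[OF g v w] by simp
  also have "\<dots> = f (g v) @ tree_section X f (g v) (tree_section X g v w)"
    using tree_aut_append[OF f gv sw] .
  finally show "tree_section X (f \<otimes>\<^bsub>tree_aut X\<^esub> g) v w =
      (tree_section X f (g v) \<otimes>\<^bsub>tree_aut X\<^esub> tree_section X g v) w"
    using tree_aut_mult_apply[OF tree_section_closed[OF f gv] tree_section_closed[OF g v] w] by simp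
qed (use assms tree_section_closed tree_aut_memD(5)[OF g v] in auto)

lemma tree_section_append:
  assumes f: "f \<in> carrier (tree_aut X)" and "v \<in> lists X" "u \<in> lists X"
  shows "tree_section X f (v @ u) = tree_section X (tree_section X f v) u"
proof (rule tree_aut_ext)
  fix w assume w: "w \<in> lists X"
  have s: "tree_section X f v \<in> carrier (tree_aut X)" using tree_section_closed assms by blast
  have "f (v @ u) @ tree_section X f (v @ u) w = f (v @ u @ w)"
    using tree_aut_append[OF f, of "v @ u" w] assms w by simp
  also have "\<dots> = f v @ tree_section X f v (u @ w)" using tree_aut_append[OF f] assms w by simp
  also have "\<dots> = f v @ tree_section X f v u @ tree_section X (tree_section X f v) u w"
    using tree_aut_append[OF s] assms w by simp
  also have "\<dots> = f (v @ u) @ tree_section X (tree_section X f v) u w"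
    using tree_aut_append[OF f] assms by simp
  finally show "tree_section X f (v @ u) w = tree_section X (tree_section X f v) u w" by simp
qed (use assms tree_section_closed in auto)

end

section \<open>Roots and sections of the elements of a constant spinal group\<close>

context constant_spinal
begin

abbreviation "X \<equiv> carrier R"
abbreviation "A \<equiv> tree_aut X"
abbreviation "G \<equiv> spinal_group R D"
abbreviation "rt \<equiv> rooted R"
abbreviation "ls \<equiv> letter_section R"
definition sec :: "('a list \<Rightarrow> 'a list) \<Rightarrow> 'a \<Rightarrow> 'a list \<Rightarrow> 'a list" where
  "sec g x = tree_section X g [x]"
text \<open>Elements of \<open>G\<close> permute the letters by left multiplication with an element
  of \<open>R\<close>; the image of the letter \<open>\<one>\<close> reveals which one.\<close>

definition root :: "('a list \<Rightarrow> 'a list) \<Rightarrow> 'a" where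
  "root g = hd (g [\<one>])"

sublocale A: group A by (rule group_tree_aut)

lemma rooted_apply:
  "rt r [] = []"
  "s \<in> X \<Longrightarrow> w \<in> lists X \<Longrightarrow> rt r (s # w) = (r \<otimes> s) # w"
  by (simp_all add: rooted_def)

lemma rooted_closed_tree: assumes r: "r \<in> X" shows "rt r \<in> carrier A"
proof (rule tree_aut_memI)
  show "rt r \<in> extensional (lists X)" by (simp add: rooted_def)
  show "bij_betw (rt r) (lists X) (lists X)"
  proof (rule bij_betw_byWitness[where f' = "rt (inv r)"])
    have *: "rt (inv s) (rt s a) = a \<and> rt s a \<in> lists X"
      if "s \<in> X" "a \<in> lists X" for s a
      using that by (cases a) (simp_all add: rooted_apply flip: m_assoc)
    show "\<forall>a\<in>lists X. rt (inv r) (rt r a) = a" "\<forall>a\<in>lists X. rt r (rt (inv r) a) = a"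
      using r *[of r] *[of "inv r"] by auto
    show "rt r ` lists X \<subseteq> lists X" "rt (inv r) ` lists X \<subseteq> lists X"
      using r *[of r] *[of "inv r"] by auto
  qed
  fix u v assume "u \<in> lists X" "v \<in> lists X"
  then show "prefix (rt r u) (rt r v) \<longleftrightarrow> prefix u v"
    using r by (cases u; cases v) (auto simp: rooted_apply simp del: in_lists_conv_set)
qed

lemma directed_memD:
  assumes "d \<in> D"
  shows "d \<in> carrier A" "x \<in> X \<Longrightarrow> d [x] = [x]" "sec d \<one> = d"
  using directed_D[OF assms] by (auto simp: directed_def sec_def)

lemma root_rooted [simp]: "r \<in> X \<Longrightarrow> root (rt r) = r"
  by (simp add: root_def rooted_apply)

lemma rooted_inj: "r \<in> X \<Longrightarrow> s \<in> X \<Longrightarrow> rt r = rt s \<Longrightarrow> r = s"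
  by (metis root_rooted)

lemma letter_section:
  assumes "d \<in> D" "x \<in> X" "x \<noteq> \<one>"
  shows "ls d x \<in> X" "sec d x = rt (ls d x)"
proof -
  have "\<exists>!r. r \<in> X \<and> tree_section X d [x] = rt r"
    using directed_D[OF assms(1)] assms rooted_inj by (auto simp: directed_def)
  from theI'[OF this] show "ls d x \<in> X" "sec d x = rt (ls d x)"
    unfolding letter_section_def sec_def by auto
qed

lemma gens_subset: "rt ` X \<union> D \<subseteq> carrier A"
  using rooted_closed_tree directed_memD by auto

lemma carrier_G: "carrier G = generate A (rt ` X \<union> D)"
  using gens_subset by (simp add: spinal_group_def carrier_subgroup_generated Int_absorb1)

lemma subgroup_G: "subgroup (carrier G) A"
  using gens_subset by (simp add: carrier_G A.generate_is_subgroup)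

lemma G_in_A: "g \<in> carrier G \<Longrightarrow> g \<in> carrier A"
  using subgroup.mem_carrier[OF subgroup_G] .

lemma group_G: "group G" by (simp add: spinal_group_def A.group_subgroup_generated)

sublocale G: group G by (rule group_G)

abbreviation G_mult (infixl "\<cdot>" 70) where "g \<cdot> h \<equiv> g \<otimes>\<^bsub>G\<^esub> h"
abbreviation G_inv ("inv\<^sub>G _" [81] 80) where "inv\<^sub>G g \<equiv> inv\<^bsub>G\<^esub> g"
abbreviation G_one ("\<one>\<^sub>G") where "\<one>\<^sub>G \<equiv> \<one>\<^bsub>G\<^esub>"

lemma mult_G: "monoid.mult G = monoid.mult A" and one_G: "\<one>\<^sub>G = \<one>\<^bsub>A\<^esub>"
  by (simp_all add: spinal_group_def)

lemma inv_G: "g \<in> carrier G \<Longrightarrow> inv\<^sub>G g = inv\<^bsub>A\<^esub> g"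
  by (simp add: spinal_group_def)

lemma pow_G: "g [^]\<^bsub>G\<^esub> (n::nat) = g [^]\<^bsub>A\<^esub> n"
  by (simp add: spinal_group_def pow_subgroup_generated)

lemma generate_G:
  assumes S: "S \<subseteq> carrier G" shows "generate A S = generate G S"
proof (intro equalityI subsetI)
  fix x assume "x \<in> generate A S"
  then show "x \<in> generate G S"
  proof (induction rule: generate.induct)
    case one then show ?case using generate.one[of G S] by (simp add: one_G)
  next
    case (incl h) then show ?case by (rule generate.incl)
  next
    case (inv h) then show ?case using generate.inv[of h S G] inv_G S by auto
  next
    case (eng h k) then show ?case using generate.eng[of h G S k] by (simp add: mult_G)
  qed
next
  fix x assume "x \<in> generate G S"
  then show "x \<in> generate A S"
  proof (induction rule: generate.induct)
    case one then show ?case using generate.one[of A S] by (simp add: one_G)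
  next
    case (incl h) then show ?case by (rule generate.incl)
  next
    case (inv h) then show ?case using generate.inv[of h S A] inv_G S by auto
  next
    case (eng h k) then show ?case using generate.eng[of h A S k] by (simp add: mult_G)
  qed
qed

lemma rooted_closed [simp]: "r \<in> X \<Longrightarrow> rt r \<in> carrier G"
  by (simp add: carrier_G generate.incl)

lemma D_closed [simp]: "d \<in> D \<Longrightarrow> d \<in> carrier G"
  by (simp add: carrier_G generate.incl)

lemma generate_spinal: "generate G (rt ` X \<union> D) = carrier G"
proof -
  have "rt ` X \<union> D \<subseteq> carrier G" by auto
  from generate_G[OF this] show ?thesis by (simp only: carrier_G)
qed

lemma rooted_mult: "r \<in> X \<Longrightarrow> s \<in> X \<Longrightarrow> rt (r \<otimes> s) = rt r \<cdot> rt s"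
proof -
  assume rs: "r \<in> X" "s \<in> X"
  show ?thesis unfolding mult_G
  proof (rule tree_aut_ext)
    fix w assume "w \<in> lists X"
    then show "rt (r \<otimes> s) w = (rt r \<otimes>\<^bsub>A\<^esub> rt s) w"
      using rs by (cases w) (auto simp: tree_aut_mult_apply rooted_closed_tree rooted_apply
          m_assoc simp del: in_lists_conv_set)
  qed (use rs rooted_closed_tree in auto)
qed

lemma rooted_one [simp]: "rt \<one> = \<one>\<^sub>G"
  using rooted_mult[of \<one> \<one>] G.l_cancel_one' by (metis G.l_cancel_one one_closed rooted_closed r_one)

lemma rooted_inv: "r \<in> X \<Longrightarrow> rt (inv r) = inv\<^sub>G (rt r)"
  by (metis G.inv_equality inv_closed l_inv rooted_closed rooted_mult rooted_one)

lemma tree_section_one: "v \<in> lists X \<Longrightarrow> tree_section X \<one>\<^bsub>A\<^esub> v = \<one>\<^bsub>A\<^esub>"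
  by (auto simp: tree_section_def tree_aut_one restrict_def fun_eq_iff)

lemma sec_rooted: "r \<in> X \<Longrightarrow> x \<in> X \<Longrightarrow> sec (rt r) x = \<one>\<^sub>G"
  by (auto simp: sec_def tree_section_def one_G tree_aut_one rooted_apply restrict_def fun_eq_iff)

text \<open>The automorphisms that permute the letters through \<open>R\<close> and have all
  first-level sections in \<open>G\<close> form a group \<open>B\<close> containing the generators.
  This is the self-similarity of \<open>G\<close>.\<close>

lemma G_structure:
  assumes "g \<in> carrier G"
  shows "\<exists>r\<in>X. \<forall>x\<in>X. g [x] = [r \<otimes> x] \<and> sec g x \<in> carrier G"
proof -
  interpret GA: subgroup "carrier G" A by (rule subgroup_G)
  define B where "B = {g \<in> carrier A. \<exists>r\<in>X. \<forall>x\<in>X. g [x] = [r \<otimes> x] \<and> sec g x \<in> carrier G}"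
  have "subgroup B A"
  proof
    show "B \<subseteq> carrier A" by (auto simp: B_def)
    show "\<one>\<^bsub>A\<^esub> \<in> B"
      using tree_section_one GA.one_closed
          by (auto simp: B_def sec_def tree_aut_one intro!: bexI[of _ \<one>])
  next
    fix g h assume "g \<in> B" "h \<in> B"
    then obtain r s where *: "g \<in> carrier A" "h \<in> carrier A" "r \<in> X" "s \<in> X"
      and g: "\<And>x. x \<in> X \<Longrightarrow> g [x] = [r \<otimes> x] \<and> sec g x \<in> carrier G"
      and h: "\<And>x. x \<in> X \<Longrightarrow> h [x] = [s \<otimes> x] \<and> sec h x \<in> carrier G"
      by (auto simp: B_def)
    have "(g \<otimes>\<^bsub>A\<^esub> h) [x] = [r \<otimes> s \<otimes> x] \<and> sec (g \<otimes>\<^bsub>A\<^esub> h) x \<in> carrier G" if "x \<in> X" for x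
      using that g[of "s \<otimes> x"] h[of x] *
      by (simp add: tree_aut_mult_apply m_assoc sec_def tree_section_mult GA.m_closed)
    then show "g \<otimes>\<^bsub>A\<^esub> h \<in> B" using * by (auto simp: B_def intro!: bexI[of _ "r \<otimes> s"])
  next
    fix g assume "g \<in> B"
    then obtain r where *: "g \<in> carrier A" "r \<in> X"
      and g: "\<And>x. x \<in> X \<Longrightarrow> g [x] = [r \<otimes> x] \<and> sec g x \<in> carrier G"
      by (auto simp: B_def)
    have "(inv\<^bsub>A\<^esub> g) [x] = [inv r \<otimes> x] \<and> sec (inv\<^bsub>A\<^esub> g) x \<in> carrier G" if x: "x \<in> X" for x
    proof -
      define y where "y = inv r \<otimes> x"
      have y: "y \<in> X" "g [y] = [x]" "sec g y \<in> carrier G" using x * g[of y] by (auto simp: y_def)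
      have i: "inv\<^bsub>A\<^esub> g \<in> carrier A" using * by simp
      have "(inv\<^bsub>A\<^esub> g \<otimes>\<^bsub>A\<^esub> g) [y] = [y]" using * y by (simp add: tree_aut_one)
      then have 1: "(inv\<^bsub>A\<^esub> g) [x] = [y]" using tree_aut_mult_apply[OF i *(1)] y by simp
      have "sec (inv\<^bsub>A\<^esub> g \<otimes>\<^bsub>A\<^esub> g) y = \<one>\<^bsub>A\<^esub>" using * y by (simp add: sec_def tree_section_one)
      then have "sec (inv\<^bsub>A\<^esub> g) x \<otimes>\<^bsub>A\<^esub> sec g y = \<one>\<^bsub>A\<^esub>"
        using tree_section_mult[OF i *(1)] y by (simp add: sec_def)
      moreover have "sec g y \<in> carrier A" "sec (inv\<^bsub>A\<^esub> g) x \<in> carrier A"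
        using i x y * by (auto simp: sec_def tree_section_closed)
      ultimately have "inv\<^bsub>A\<^esub> (sec g y) = sec (inv\<^bsub>A\<^esub> g) x" by (rule A.inv_equality)
      then show ?thesis using 1 y_def GA.m_inv_closed[OF y(3)] by simp
    qed
    then show "inv\<^bsub>A\<^esub> g \<in> B" using * by (auto simp: B_def intro!: bexI[of _ "inv r"])
  qed
  moreover have "rt ` X \<subseteq> B"
    using rooted_closed_tree sec_rooted G.one_closed by (auto simp: B_def rooted_apply)
  moreover have "D \<subseteq> B"
  proof
    fix d assume d: "d \<in> D"
    have "sec d x \<in> carrier G" if "x \<in> X" for x
      using letter_section[OF d that] directed_memD(3)[OF d] d by (cases "x = \<one>") auto
    then show "d \<in> B" using directed_memD[OF d] by (auto simp: B_def intro!: bexI[of _ \<one>])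
  qed
  ultimately have "carrier G \<subseteq> B" unfolding carrier_G by (intro A.generate_subgroup_incl) auto
  then show ?thesis using assms by (auto simp: B_def)
qed

lemma root_closed [simp]: "g \<in> carrier G \<Longrightarrow> root g \<in> X"
  and act_G: "g \<in> carrier G \<Longrightarrow> x \<in> X \<Longrightarrow> g [x] = [root g \<otimes> x]"
  and sec_closed [simp]: "g \<in> carrier G \<Longrightarrow> x \<in> X \<Longrightarrow> sec g x \<in> carrier G"
proof -
  assume g: "g \<in> carrier G"
  then obtain r where r: "r \<in> X" "\<forall>x\<in>X. g [x] = [r \<otimes> x] \<and> sec g x \<in> carrier G"
    using G_structure by blast
  have "root g = r" using r by (simp add: root_def)
  then show "root g \<in> X" "x \<in> X \<Longrightarrow> g [x] = [root g \<otimes> x]"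
    "x \<in> X \<Longrightarrow> sec g x \<in> carrier G" using r by auto
qed

lemma root_mult [simp]: "g \<in> carrier G \<Longrightarrow> h \<in> carrier G \<Longrightarrow> root (g \<cdot> h) = root g \<otimes> root h"
proof -
  assume g: "g \<in> carrier G" and h: "h \<in> carrier G"
  have "(g \<otimes>\<^bsub>A\<^esub> h) [\<one>] = [root g \<otimes> root h]"
    using tree_aut_mult_apply[OF G_in_A[OF g] G_in_A[OF h], of "[\<one>]"] g h by (simp add: act_G)
  then show ?thesis by (simp add: root_def[of "g \<otimes>\<^bsub>A\<^esub> h"] mult_G)
qed

lemma sec_mult:
  "g \<in> carrier G \<Longrightarrow> h \<in> carrier G \<Longrightarrow> x \<in> X \<Longrightarrow>
    sec (g \<cdot> h) x = sec g (root h \<otimes> x) \<cdot> sec h x"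
  by (simp add: sec_def mult_G tree_section_mult G_in_A act_G)

lemma root_one [simp]: "root \<one>\<^sub>G = \<one>"
  using root_rooted[of \<one>] by simp

lemma sec_one [simp]: "x \<in> X \<Longrightarrow> sec \<one>\<^sub>G x = \<one>\<^sub>G"
  using sec_rooted[of \<one>] by simp

lemma root_inv [simp]: "g \<in> carrier G \<Longrightarrow> root (inv\<^sub>G g) = inv (root g)"
  by (metis G.inv_closed G.l_inv inv_equality root_closed root_mult root_one)

lemma sec_inv:
  assumes "g \<in> carrier G" "x \<in> X"
  shows "sec (inv\<^sub>G g) x = inv\<^sub>G (sec g (inv (root g) \<otimes> x))"
proof (rule G.inv_equality[symmetric])
  show "sec (inv\<^sub>G g) x \<cdot> sec g (inv (root g) \<otimes> x) = \<one>\<^sub>G"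
    using sec_mult[of "inv\<^sub>G g" g "inv (root g) \<otimes> x"] assms by simp
qed (use assms in auto)

lemma root_pow [simp]: "g \<in> carrier G \<Longrightarrow> root (g [^]\<^bsub>G\<^esub> (n::nat)) = root g [^] n"
  by (induction n) auto

lemma root_D [simp]: "d \<in> D \<Longrightarrow> root d = \<one>"
  by (simp add: root_def directed_memD)

lemma sec_D_one [simp]: "d \<in> D \<Longrightarrow> sec d \<one> = d"
  by (rule directed_memD)

lemma spinal_ext:
  assumes "g \<in> carrier G" "h \<in> carrier G" "root g = root h"
    and "\<And>x. x \<in> X \<Longrightarrow> sec g x = sec h x"
  shows "g = h"
proof (rule tree_aut_ext)
  fix w assume w: "w \<in> lists X"
  show "g w = h w"
  proof (cases w)
    case Nil
    then show ?thesis using tree_aut_length[OF G_in_A] assms by (metis length_0_conv w)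
  next
    case (Cons x v)
    then have x: "x \<in> X" "v \<in> lists X" using w by auto
    then have "g ([x] @ v) = h ([x] @ v)"
      using tree_aut_append[OF G_in_A[OF assms(1)], of "[x]" v] tree_aut_append[OF G_in_A[OF
          assms(2)], of "[x]" v]
        assms(4)[OF x(1)] assms by (simp add: act_G sec_def)
    then show ?thesis using Cons by simp
  qed
qed (use assms G_in_A in auto)

section \<open>Level stabilisers, defined by recursion on sections, and residual finiteness\<close>

primrec St :: "nat \<Rightarrow> ('a list \<Rightarrow> 'a list) set" where
  "St 0 = carrier G"
| "St (Suc n) = {g \<in> carrier G. root g = \<one> \<and> (\<forall>x\<in>X. sec g x \<in> St n)}"

lemma subgroup_St: "subgroup (St n) G"
proof (induction n)
  case 0 then show ?case by (simp add: G.subgroup_self)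
next
  case (Suc n)
  interpret S: subgroup "St n" G by (rule Suc)
  show ?case
  proof
    show "St (Suc n) \<subseteq> carrier G" by auto
    show "\<one>\<^sub>G \<in> St (Suc n)" using S.one_closed by (simp del: one_G)
    show "x \<cdot> y \<in> St (Suc n)" if "x \<in> St (Suc n)" "y \<in> St (Suc n)" for x y
      using that S.m_closed by (simp add: sec_mult)
    show "inv\<^sub>G x \<in> St (Suc n)" if "x \<in> St (Suc n)" for x
      using that S.m_inv_closed by (simp add: sec_inv)
  qed
qed

lemma fin_index_vertexwise:
  assumes "fin_index G H" "subgroup K G"
    and "{g \<in> carrier G. root g = \<one> \<and> (\<forall>x\<in>X. sec g x \<in> H)} \<subseteq> K"
  shows "fin_index G K"
proof (rule G.fin_indexI[where F = "\<lambda>g. (root g, \<lambda>x\<in>X. H #>\<^bsub>G\<^esub> sec g x)"])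
  have H: "subgroup H G" using assms by (simp add: fin_index_def)
  have "(\<lambda>g. (root g, \<lambda>x\<in>X. H #>\<^bsub>G\<^esub> sec g x)) ` carrier G \<subseteq>
      X \<times> (X \<rightarrow>\<^sub>E (\<lambda>a. H #>\<^bsub>G\<^esub> a) ` carrier G)"
  proof (intro image_subsetI SigmaI)
    fix g assume "g \<in> carrier G"
    then show "(\<lambda>x\<in>X. H #>\<^bsub>G\<^esub> sec g x) \<in> X \<rightarrow>\<^sub>E (\<lambda>a. H #>\<^bsub>G\<^esub> a) ` carrier G"
      by (simp add: restrict_PiE_iff)
  qed simp
  then show "finite ((\<lambda>g. (root g, \<lambda>x\<in>X. H #>\<^bsub>G\<^esub> sec g x)) ` carrier G)"
    by (rule finite_subset) (intro finite_SigmaI finite_R finite_PiE G.fin_index_cosets assms)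
  fix a b assume ab: "a \<in> carrier G" "b \<in> carrier G"
    and eq: "(root a, \<lambda>x\<in>X. H #>\<^bsub>G\<^esub> sec a x) = (root b, \<lambda>x\<in>X. H #>\<^bsub>G\<^esub> sec b x)"
  have "sec (a \<cdot> inv\<^sub>G b) x \<in> H" if x: "x \<in> X" for x
  proof -
    define y where "y = inv (root b) \<otimes> x"
    have y: "y \<in> X" using ab x by (simp add: y_def)
    have eq2: "(\<lambda>x\<in>X. H #>\<^bsub>G\<^esub> sec a x) = (\<lambda>x\<in>X. H #>\<^bsub>G\<^esub> sec b x)"
      using eq by (rule Pair_inject)
    have "H #>\<^bsub>G\<^esub> sec a y = H #>\<^bsub>G\<^esub> sec b y" using fun_cong[OF eq2, of y] y by simp
    then have "sec a y \<cdot> inv\<^sub>G (sec b y) \<in> H" using G.rcoset_eq_iff[OF H] ab y by simp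
    then show ?thesis using ab x by (simp add: sec_mult sec_inv y_def)
  qed
  moreover have "root a = root b" using eq by (rule Pair_inject)
  then have "root (a \<cdot> inv\<^sub>G b) = \<one>" using ab by simp
  ultimately show "a \<cdot> inv\<^sub>G b \<in> K" using ab by (intro subsetD[OF assms(3)]) simp
qed (rule assms(2))

lemma fin_index_St: "fin_index G (St n)"
proof (induction n)
  case 0
  show ?case by (rule G.fin_indexI[where F = "\<lambda>_. ()"]) (auto simp: G.subgroup_self)
next
  case (Suc n)
  then show ?case by (rule fin_index_vertexwise) (rule subgroup_St, simp)
qed

text \<open>An element of all level stabilisers fixes every word.\<close>

lemma St_separates:
  assumes g: "g \<in> carrier G" "g \<noteq> \<one>\<^sub>G"
  shows "\<exists>n. g \<notin> St n"
proof (rule ccontr)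
  assume "\<not> ?thesis"
  then have all: "\<And>n. g \<in> St n" by blast
  have "h \<in> St (length w) \<Longrightarrow> w \<in> lists X \<Longrightarrow> h w = w" for h w
  proof (induction w arbitrary: h)
    case Nil
    then show ?case using tree_aut_length[OF G_in_A, of h "[]"] by simp
  next
    case (Cons x w)
    then have h: "h \<in> carrier G" "root h = \<one>" "sec h x w = w" "x \<in> X" by auto
    then show ?case
      using tree_aut_append[OF G_in_A[OF h(1)], of "[x]" w] Cons.prems by (simp add: act_G sec_def)
  qed
  then have "g = \<one>\<^bsub>A\<^esub>"
    using all by (intro tree_aut_ext[OF G_in_A[OF g(1)] A.one_closed]) (simp add: tree_aut_one)
  then show False using g by (simp add: one_G)
qed

end

section \<open>Rigid stabilisers and normal subgroups\<close>

context constant_spinal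
begin

definition P :: "('a list \<Rightarrow> 'a list) set" where
  "P = {g \<in> carrier G. root g = \<one>}"

definition cj :: "'a \<Rightarrow> ('a list \<Rightarrow> 'a list) \<Rightarrow> 'a list \<Rightarrow> 'a list" where
  "cj s g = rt s \<cdot> g \<cdot> inv\<^sub>G (rt s)"

definition off :: "'a set \<Rightarrow> ('a list \<Rightarrow> 'a list) \<Rightarrow> bool" where
  "off Y g \<longleftrightarrow> root g = \<one> \<and> (\<forall>y\<in>X - Y. sec g y = \<one>\<^sub>G)"

text \<open>The rigid stabiliser of the letter \<open>e\<close>, viewed as a group of sections. Conjugation
  by rooted automorphisms carries it to the rigid stabiliser of any other letter.\<close>

definition Rist :: "('a list \<Rightarrow> 'a list) set" where
  "Rist = {g \<in> carrier G. \<exists>p\<in>carrier G. off {\<one>} p \<and> sec p \<one> = g}"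

lemma cj_closed [simp]: "s \<in> X \<Longrightarrow> g \<in> carrier G \<Longrightarrow> cj s g \<in> carrier G"
  by (simp add: cj_def)

lemma root_cj: "s \<in> X \<Longrightarrow> g \<in> carrier G \<Longrightarrow> root (cj s g) = s \<otimes> root g \<otimes> inv s"
  by (simp add: cj_def)

lemma root_cj_one [simp]: "s \<in> X \<Longrightarrow> g \<in> carrier G \<Longrightarrow> root g = \<one> \<Longrightarrow> root (cj s g) = \<one>"
  by (simp add: root_cj)

lemma sec_cj [simp]:
  "s \<in> X \<Longrightarrow> g \<in> carrier G \<Longrightarrow> x \<in> X \<Longrightarrow> sec (cj s g) x = sec g (inv s \<otimes> x)"
  by (simp add: cj_def sec_mult sec_inv sec_rooted del: one_G)

lemma cj_one [simp]: "g \<in> carrier G \<Longrightarrow> cj \<one> g = g"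
  by (simp add: cj_def)

lemma P_closed: "p \<in> P \<Longrightarrow> p \<in> carrier G" and P_root: "p \<in> P \<Longrightarrow> root p = \<one>"
  by (auto simp: P_def)

lemma P_memI: "g \<in> carrier G \<Longrightarrow> root g = \<one> \<Longrightarrow> g \<in> P"
  by (simp add: P_def)

lemma cj_D_in_P: "s \<in> X \<Longrightarrow> d \<in> D \<Longrightarrow> cj s d \<in> P"
  by (intro P_memI) simp_all

lemma sec_commutator:
  assumes "a \<in> carrier G" "b \<in> carrier G" "root a = \<one>" "root b = \<one>" "x \<in> X"
  shows "sec (commutator G a b) x = commutator G (sec a x) (sec b x)"
  using assms by (simp add: commutator_def sec_mult sec_inv)

lemma root_commutator:
  assumes "a \<in> carrier G" "b \<in> carrier G" "root a = \<one>" "root b = \<one>"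
  shows "root (commutator G a b) = \<one>"
  using assms by (simp add: commutator_def)

lemma commutator_one [simp]:
  "a \<in> carrier G \<Longrightarrow> commutator G a \<one>\<^sub>G = \<one>\<^sub>G"
  "a \<in> carrier G \<Longrightarrow> commutator G \<one>\<^sub>G a = \<one>\<^sub>G"
  by (simp_all add: commutator_def)

lemma P_eq_St: "P = St (Suc 0)"
  by (auto simp: P_def)

lemma subgroup_P: "subgroup P G"
  unfolding P_eq_St by (rule subgroup_St)

lemma normal_P: "P \<lhd> G"
proof (rule G.normal_invI[OF subgroup_P])
  fix g h assume "g \<in> carrier G" "h \<in> P"
  then show "g \<cdot> h \<cdot> inv\<^sub>G g \<in> P" by (simp add: P_def)
qed

lemma fin_index_P: "fin_index G P"
  unfolding P_eq_St by (rule fin_index_St)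

text \<open>As \<open>d\<close> is its own section at \<open>\<one>\<close>, it is determined by its
  sections at the other letters, which lie in the finite group \<open>R\<close>.\<close>

lemma finite_D: "finite D"
proof -
  define F where "F d = (\<lambda>x\<in>X - {\<one>}. ls d x)" for d
  have "inj_on F D"
  proof
    fix d e assume d: "d \<in> D" "e \<in> D" and eq: "F d = F e"
    have ls: "ls d x = ls e x" if "x \<in> X" "x \<noteq> \<one>" for x
      using fun_cong[OF eq, of x] that by (simp add: F_def)
    have "d w = e w" if "w \<in> lists X" for w
      using that
    proof (induction w rule: lists.induct)
      case Nil
      show ?case using tree_aut_length[OF directed_memD(1)[OF d(1)], of "[]"]
        tree_aut_length[OF directed_memD(1)[OF d(2)], of "[]"] by simp
    next
      case (Cons x w)
      have app: "c (x # w) = x # sec c x w" if "c \<in> D" for c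
        using tree_aut_append[OF directed_memD(1)[OF that], of "[x]" w] Cons directed_memD(2)[OF
            that]
        by (simp add: sec_def)
      show ?case
      proof (cases "x = \<one>")
        case True
        then show ?thesis using app[OF d(1)] app[OF d(2)] d Cons.IH by simp
      next
        case False
        then show ?thesis
          using app[OF d(1)] app[OF d(2)] d ls[OF Cons.hyps(1)] letter_section(2) Cons.hyps(1)
              by simp
      qed
    qed
    then show "d = e" using d directed_memD(1) by (intro tree_aut_ext) auto
  qed
  moreover have "F ` D \<subseteq> (X - {\<one>}) \<rightarrow>\<^sub>E X"
  proof (rule image_subsetI)
    fix d assume "d \<in> D"
    then show "F d \<in> (X - {\<one>}) \<rightarrow>\<^sub>E X"
      using letter_section(1) unfolding F_def restrict_PiE_iff by blast
  qed
  then have "finite (F ` D)" using finite_R by (meson finite_Diff finite_PiE finite_subset)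
  ultimately show ?thesis using finite_imageD by blast
qed

abbreviation "gens \<equiv> rt ` X \<union> D"

lemma gens: "finite gens" "gens \<subseteq> carrier G" "generate G gens = carrier G"
proof -
  show "finite gens" using finite_R finite_D by simp
  show "gens \<subseteq> carrier G" by auto
qed (rule generate_spinal)

text \<open>The rooted automorphisms form a complement of \<open>P\<close>. Pushing the rooted
  letters of a word to the right turns its letters from \<open>D\<close> into conjugates
  \<open>cj s d\<close> and leaves the single rooted factor \<open>rt (root g)\<close>.\<close>

lemma generate_P: "generate G {cj s d | s d. s \<in> X \<and> d \<in> D} = P"
proof
  let ?S = "{cj s d | s d. s \<in> X \<and> d \<in> D}"
  have S: "?S \<subseteq> P" by (auto simp: P_def)
  then have SG: "?S \<subseteq> carrier G" by (auto dest: P_closed)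
  show "generate G ?S \<subseteq> P" using S subgroup_P by (rule G.generate_subgroup_incl)
  interpret K: subgroup "generate G ?S" G using SG by (rule G.generate_is_subgroup)
  have cjK: "cj s k \<in> generate G ?S" if "k \<in> generate G ?S" "s \<in> X" for s k
    using that(1)
  proof (induction k rule: generate.induct)
    case one then show ?case using that(2) K.one_closed by (simp add: cj_def)
  next
    case (incl h)
    then obtain t d where t: "t \<in> X" "d \<in> D" "h = cj t d" by blast
    have "cj s h = cj (s \<otimes> t) d"
      using t that(2) by (simp add: cj_def rooted_mult G.inv_mult_group G.m_assoc)
    then show ?case using t that(2) by (intro generate.incl) auto
  next
    case (inv h)
    then obtain t d where t: "t \<in> X" "d \<in> D" "h = cj t d" by blast
    have "cj s (inv\<^sub>G h) = inv\<^sub>G (cj (s \<otimes> t) d)"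
      using t that(2) by (simp add: cj_def rooted_mult G.inv_mult_group G.m_assoc)
    then show ?case using t that(2) generate.inv[of "cj (s \<otimes> t) d" ?S G] by auto
  next
    case (eng h k)
    then have "h \<in> carrier G" "k \<in> carrier G" using K.mem_carrier by auto
    then have "cj s (h \<cdot> k) = cj s h \<cdot> cj s k" using that(2) by (simp add: cj_def G.m_assoc)
    then show ?case using eng K.m_closed by simp
  qed
  have "g \<cdot> inv\<^sub>G (rt (root g)) \<in> generate G ?S" if "g \<in> generate G gens" for g
    using that
  proof (induction g rule: generate.induct)
    case one then show ?case using K.one_closed by simp
  next
    case (incl h)
    then show ?case using K.one_closed generate.incl[of _ ?S G] cj_one by (force intro: exI[of _ \<one>])
  next
    case (inv h)
    then show ?case
    proof
      assume "h \<in> rt ` X"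
      then show ?thesis using K.one_closed by (auto simp: rooted_inv)
    next
      assume h: "h \<in> D"
      then have "cj \<one> h \<in> ?S" by blast
      then have "inv\<^sub>G h \<in> generate G ?S" using h generate.inv[of "cj \<one> h" ?S G] by simp
      then show ?thesis using h by simp
    qed
  next
    case (eng h k)
    then have c: "h \<in> carrier G" "k \<in> carrier G" using gens by auto
    have "h \<cdot> k \<cdot> inv\<^sub>G (rt (root (h \<cdot> k)))
      = (h \<cdot> inv\<^sub>G (rt (root h))) \<cdot> cj (root h) (k \<cdot> inv\<^sub>G (rt (root k)))"
      using c by (simp add: cj_def rooted_mult G.inv_mult_group G.m_assoc)
    then show ?case using eng cjK c K.m_closed by simp
  qed
  then have *: "g \<cdot> inv\<^sub>G (rt (root g)) \<in> generate G ?S" if "g \<in> carrier G" for g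
    using that gens(3) by simp
  show "P \<subseteq> generate G ?S"
  proof
    fix p assume "p \<in> P"
    then show "p \<in> generate G ?S" using *[of p] P_closed P_root by simp
  qed
qed

lemma rooted_generate:
  assumes K: "subgroup K G" and T: "T \<subseteq> X" "\<And>t. t \<in> T \<Longrightarrow> rt t \<in> K"
    and r: "r \<in> generate R T"
  shows "rt r \<in> K"
proof -
  interpret K: subgroup K G by fact
  from r show ?thesis
  proof (induction r rule: generate.induct)
    case one then show ?case using K.one_closed by simp
  next
    case (incl h) then show ?case using T by blast
  next
    case (inv h)
    then have "h \<in> X" "inv\<^sub>G (rt h) \<in> K" using T by auto
    then show ?case by (simp add: rooted_inv)
  next
    case (eng h k)
    then have "h \<in> X" "k \<in> X" using generate_in_carrier[OF T(1)] by auto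
    then show ?case using eng K.m_closed by (simp add: rooted_mult)
  qed
qed

text \<open>\<open>G\<close> is fractal: conjugates of \<open>d\<close> by rooted automorphisms
  exhibit at \<open>x\<close> both \<open>d\<close> itself and every \<open>ls d z\<close>, and by
  assumption the latter generate \<open>R\<close>.\<close>

lemma sec_surj:
  assumes x: "x \<in> X" and g: "g \<in> carrier G"
  shows "\<exists>p\<in>P. sec p x = g"
proof -
  interpret P: subgroup P G by (rule subgroup_P)
  let ?B = "(\<lambda>p. sec p x) ` P"
  have B: "subgroup ?B G"
  proof
    show "?B \<subseteq> carrier G" using x P.mem_carrier by auto
    show "\<one>\<^sub>G \<in> ?B" using x P.one_closed by (auto intro!: image_eqI[of _ _ "\<one>\<^sub>G"])
    fix a b assume "a \<in> ?B" "b \<in> ?B"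
    then obtain p q where pq: "p \<in> P" "q \<in> P" "a = sec p x" "b = sec q x" by blast
    then show "a \<cdot> b \<in> ?B"
      using x P.m_closed[of p q] P_closed P_root
          by (intro image_eqI[of _ _ "p \<cdot> q"]) (auto simp: sec_mult)
  next
    fix a assume "a \<in> ?B"
    then obtain p where pq: "p \<in> P" "a = sec p x" by blast
    then show "inv\<^sub>G a \<in> ?B"
      using x P.m_inv_closed[of p] P_closed P_root
          by (intro image_eqI[of _ _ "inv\<^sub>G p"]) (auto simp: sec_inv)
  qed
  interpret B: subgroup ?B G by (rule B)
  have D: "D \<subseteq> ?B"
  proof
    fix d assume d: "d \<in> D"
    have "cj x d \<in> P" using d x by (rule cj_D_in_P[rotated])
    moreover have "sec (cj x d) x = d" using d x by simp
    ultimately show "d \<in> ?B" by (metis image_eqI)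
  qed
  have "rt h \<in> ?B" if h: "h \<in> {ls d x | d x. d \<in> D \<and> x \<in> X - {\<one>}}" for h
  proof -
    obtain d z where d: "d \<in> D" "z \<in> X" "z \<noteq> \<one>" "h = ls d z" using h by blast
    have "cj (x \<otimes> inv z) d \<in> P" using d x by (intro cj_D_in_P) simp_all
    moreover have "rt h = sec (cj (x \<otimes> inv z) d) x"
      using d x letter_section(2) by (simp add: inv_mult_group m_assoc)
    ultimately show ?thesis by (metis image_eqI)
  qed
  moreover have "{ls d x | d x. d \<in> D \<and> x \<in> X - {\<one>}} \<subseteq> X"
    using letter_section(1) by blast
  ultimately have R: "rt r \<in> ?B" if "r \<in> X" for r
    using rooted_generate[OF B] that generate_R by blast
  have "generate G gens \<subseteq> ?B"
    by (rule G.generate_subgroup_incl[OF _ B]) (use D R in auto)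
  then show ?thesis using g gens(3) by auto
qed

text \<open>As \<open>G\<close> modulo \<open>N\<close> has no commuting non-trivial normal subgroups, commutators of
  elements vanishing at different letters allow us to shrink supports one letter at a time.\<close>

lemma support_dichotomy:
  assumes tor: "torsion G" and mN: "maximal_infinite_index G N"
    and Q: "subgroup Q G" "Q \<subseteq> P" and surj: "\<And>g. g \<in> carrier G \<Longrightarrow> \<exists>q\<in>Q. sec q \<one> = g"
  shows "(\<exists>q\<in>Q. off {\<one>} q \<and> sec q \<one> \<notin> N) \<or>
    (\<exists>y\<in>X. y \<noteq> \<one> \<and> (\<forall>q\<in>Q. sec q y = \<one>\<^sub>G \<longrightarrow> sec q \<one> \<in> N))"
proof (rule ccontr)
  assume "\<not> ?thesis"
  then have no1: "\<And>q. q \<in> Q \<Longrightarrow> off {\<one>} q \<Longrightarrow> sec q \<one> \<in> N"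
    and no2: "\<And>y. y \<in> X \<Longrightarrow> y \<noteq> \<one> \<Longrightarrow> \<exists>q\<in>Q. sec q y = \<one>\<^sub>G \<and> sec q \<one> \<notin> N"
    by blast+
  have N: "N \<lhd> G" "\<not> fin_index G N" using mN unfolding maximal_infinite_index_def by blast+
  interpret Q: subgroup Q G by fact
  \<comment> \<open>The sections at \<open>\<one>\<close> of those elements of \<open>Q\<close> that
    vanish on \<open>F\<close>. They form a normal subgroup of \<open>G\<close>: every
    \<open>g\<close> is the section of some \<open>q\<close> in \<open>Q\<close>, and conjugation by
    \<open>q\<close> preserves vanishing on \<open>F\<close>.\<close>
  define Af where "Af F = (\<lambda>q. sec q \<one>) ` {q \<in> Q. \<forall>y\<in>F. sec q y = \<one>\<^sub>G}" for F
  have Qr: "root q = \<one>" if "q \<in> Q" for q using Q(2) that P_root by blast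
  have normal: "Af F \<lhd> G" if F: "F \<subseteq> X" for F
  proof (rule G.normal_invI)
    show "subgroup (Af F) G"
    proof
      show "Af F \<subseteq> carrier G" by (auto simp: Af_def)
      show "\<one>\<^sub>G \<in> Af F"
        unfolding Af_def using F by (intro image_eqI[of _ _ "\<one>\<^sub>G"]) auto
      fix a b assume "a \<in> Af F" "b \<in> Af F"
      then obtain p q where pq: "p \<in> Q" "q \<in> Q" "a = sec p \<one>" "b = sec q \<one>"
        "\<forall>y\<in>F. sec p y = \<one>\<^sub>G" "\<forall>y\<in>F. sec q y = \<one>\<^sub>G" by (auto simp: Af_def)
      then show "a \<cdot> b \<in> Af F"
        unfolding Af_def using F Qr by (intro image_eqI[of _ _ "p \<cdot> q"]) (auto simp: sec_mult
            subset_iff)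
    next
      fix a assume "a \<in> Af F"
      then obtain p where pq: "p \<in> Q" "a = sec p \<one>" "\<forall>y\<in>F. sec p y = \<one>\<^sub>G" by (auto simp: Af_def)
      then show "inv\<^sub>G a \<in> Af F"
        unfolding Af_def using F Qr by (intro image_eqI[of _ _ "inv\<^sub>G p"]) (auto simp: sec_inv
            subset_iff)
    qed
    fix g a assume g: "g \<in> carrier G" and "a \<in> Af F"
    then obtain p where p: "p \<in> Q" "a = sec p \<one>" "\<forall>y\<in>F. sec p y = \<one>\<^sub>G" by (auto simp: Af_def)
    obtain q where q: "q \<in> Q" "sec q \<one> = g" using surj[OF g] by blast
    have "sec (q \<cdot> p \<cdot> inv\<^sub>G q) y = sec q y \<cdot> sec p y \<cdot> inv\<^sub>G (sec q y)"
      if "y \<in> X" for y using that p q Qr by (simp add: sec_mult sec_inv)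
    then show "g \<cdot> a \<cdot> inv\<^sub>G g \<in> Af F"
      unfolding Af_def using F p q
      by (intro image_eqI[of _ _ "q \<cdot> p \<cdot> inv\<^sub>G q"]) (auto simp: subset_iff)
  qed
  have "\<not> Af F \<subseteq> N" if "finite F" "F \<subseteq> X - {\<one>}" for F
    using that
  proof (induction F rule: finite_induct)
    case empty
    have "N \<noteq> carrier G"
      using N(2) fin_index_St[of 0] by auto
    then have "\<exists>g\<in>carrier G. g \<notin> N" using N(1) normal_imp_subgroup subgroup.subset by blast
    then show ?case using surj unfolding Af_def by force
  next
    case (insert y F)
    have "\<not> Af {y} \<subseteq> N" using no2[of y] insert unfolding Af_def by blast
    moreover have F: "F \<subseteq> X" "{y} \<subseteq> X" "F \<subseteq> X - {\<one>}" using insert.prems by auto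
    ultimately obtain a b where ab: "a \<in> Af F" "b \<in> Af {y}" "commutator G a b \<notin> N"
      using G.prime_of_maximal_infinite_index[OF gens tor mN normal[OF F(1)] insert.IH[OF F(3)]
          normal[OF F(2)]]
      by metis
    obtain p q where pq: "p \<in> Q" "q \<in> Q" "a = sec p \<one>" "b = sec q \<one>"
        "\<forall>y\<in>F. sec p y = \<one>\<^sub>G" "sec q y = \<one>\<^sub>G" using ab by (auto simp: Af_def)
    have sc: "sec (commutator G p q) x = commutator G (sec p x) (sec q x)" if "x \<in> X" for x
      using that pq Qr by (simp add: sec_commutator)
    have "commutator G p q \<in> Q" using pq by (simp add: commutator_def)
    moreover have "sec (commutator G p q) x = \<one>\<^sub>G" if "x \<in> insert y F" for x
      using sc[of x] that pq insert.prems by (auto simp: subset_iff)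
    ultimately have "sec (commutator G p q) \<one> \<in> Af (insert y F)" unfolding Af_def by blast
    then show ?case using sc[of \<one>] pq ab by auto
  qed
  then have "\<not> Af (X - {\<one>}) \<subseteq> N" using finite_R by blast
  then obtain q where "q \<in> Q" "\<forall>y\<in>X - {\<one>}. sec q y = \<one>\<^sub>G" "sec q \<one> \<notin> N"
    by (auto simp: Af_def)
  then show False using no1[of q] Qr by (auto simp: off_def)
qed

text \<open>Conjugation by an element of \<open>Q\<close> with section \<open>g\<close> at
  \<open>\<one>\<close> realises conjugation by \<open>g\<close>. The pair \<open>M\<close>,
  \<open>Q\<close> is kept general for three uses: the rigid stabiliser with \<open>M\<close> all of
  \<open>G\<close>, a normal subgroup with \<open>Q = P\<close>, and a dense subgroup
  \<open>M\<close> with \<open>Q = M \<inter> P\<close>.\<close>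

lemma normal_off_sections:
  assumes M: "subgroup M G" and conj: "\<And>p m. p \<in> Q \<Longrightarrow> m \<in> M \<Longrightarrow> p \<cdot> m \<cdot> inv\<^sub>G p \<in> M"
    and Q: "Q \<subseteq> P" and surj: "\<And>g. g \<in> carrier G \<Longrightarrow> \<exists>q\<in>Q. sec q \<one> = g"
  shows "{g \<in> carrier G. \<exists>p\<in>M. off {\<one>} p \<and> sec p \<one> = g} \<lhd> G" (is "?K \<lhd> G")
proof (rule G.normal_invI)
  interpret M: subgroup M G by fact
  show "subgroup ?K G"
  proof
    show "?K \<subseteq> carrier G" by blast
    have "off {\<one>} \<one>\<^sub>G" by (simp add: off_def)
    then show "\<one>\<^sub>G \<in> ?K" using M.one_closed by (auto intro!: bexI[of _ "\<one>\<^sub>G"])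
  next
    fix a b assume "a \<in> ?K" "b \<in> ?K"
    then obtain p q where pq: "p \<in> M" "q \<in> M" "off {\<one>} p" "off {\<one>} q" "sec p \<one> = a" "sec q \<one> = b"
      by blast
    then have "off {\<one>} (p \<cdot> q)" "sec (p \<cdot> q) \<one> = a \<cdot> b"
      by (auto simp: off_def sec_mult)
    then show "a \<cdot> b \<in> ?K" using pq M.m_closed by auto
  next
    fix a assume "a \<in> ?K"
    then obtain p where pq: "p \<in> M" "off {\<one>} p" "sec p \<one> = a" by blast
    then have "off {\<one>} (inv\<^sub>G p)" "sec (inv\<^sub>G p) \<one> = inv\<^sub>G a"
      by (auto simp: off_def sec_inv)
    then show "inv\<^sub>G a \<in> ?K" using pq M.m_inv_closed by auto
  qed
  fix g a assume g: "g \<in> carrier G" and "a \<in> ?K"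
  then obtain p where p: "p \<in> M" "off {\<one>} p" "sec p \<one> = a" by blast
  obtain q where q: "q \<in> Q" "sec q \<one> = g" using surj[OF g] by blast
  then have qc: "q \<in> carrier G" "root q = \<one>" using Q P_closed P_root by auto
  have "off {\<one>} (q \<cdot> p \<cdot> inv\<^sub>G q)"
    "sec (q \<cdot> p \<cdot> inv\<^sub>G q) \<one> = g \<cdot> a \<cdot> inv\<^sub>G g"
    using p q qc by (auto simp: off_def sec_mult sec_inv)
  then show "g \<cdot> a \<cdot> inv\<^sub>G g \<in> ?K" using conj[OF q(1) p(1)] g p by auto
qed

lemma normal_Rist: "Rist \<lhd> G"
  unfolding Rist_def
  by (rule normal_off_sections[where Q = P]) (use sec_surj P_closed G.subgroup_self in auto)

text \<open>Dividing by an element of \<open>M\<close> supported at one letter removes that letter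
  from the support. So \<open>M\<close> contains every element of root \<open>\<one>\<close> all of
  whose sections are in \<open>K\<close>.\<close>

lemma fin_index_of_off_sections:
  assumes M: "subgroup M G" and K: "fin_index G K"
    and ex: "\<And>k x. k \<in> K \<Longrightarrow> x \<in> X \<Longrightarrow> \<exists>q\<in>M. off {x} q \<and> sec q x = k"
  shows "fin_index G M"
proof (rule fin_index_vertexwise[OF K M])
  interpret M: subgroup M G by fact
  interpret K: subgroup K G using K by (simp add: fin_index_def)
  have *: "g \<in> M" if "finite Y" "Y \<subseteq> X" "g \<in> carrier G" "off Y g" "\<And>x. x \<in> X \<Longrightarrow> sec g x \<in> K"
    for Y g using that
  proof (induction Y arbitrary: g rule: finite_induct)
    case empty
    have "g = \<one>\<^sub>G"
    proof (rule spinal_ext)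
      show "root g = root \<one>\<^sub>G" using empty.prems by (simp add: off_def)
      show "sec g x = sec \<one>\<^sub>G x" if "x \<in> X" for x
        using empty.prems that by (simp add: off_def)
    qed (use empty.prems in simp_all)
    then show ?case using M.one_closed by simp
  next
    case (insert y Y)
    have y: "y \<in> X" using insert.prems by simp
    obtain q where q: "q \<in> M" "off {y} q" "sec q y = sec g y" 
      using ex[of "sec g y" y] insert.prems(4)[OF y] y by blast
    have c: "q \<in> carrier G" "root q = \<one>" "root g = \<one>" using q insert.prems by (auto simp: off_def)
    define h where "h = g \<cdot> inv\<^sub>G q"
    have s: "sec h x = sec g x \<cdot> inv\<^sub>G (sec q x)" if "x \<in> X" for x
      using c insert.prems that by (simp add: h_def sec_mult sec_inv)
    have "h \<in> M"
    proof (rule insert.IH)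
      show "h \<in> carrier G" using c insert.prems by (simp add: h_def)
      show "off Y h"
        unfolding off_def
      proof (intro conjI ballI)
        show "root h = \<one>" using c insert.prems by (simp add: h_def)
        fix x assume x: "x \<in> X - Y"
        show "sec h x = \<one>\<^sub>G"
          using x s[of x] q insert.prems by (cases "x = y") (auto simp: off_def)
      qed
      fix x assume x: "x \<in> X"
      show "sec h x \<in> K"
        using x s[of x] q insert.prems K.one_closed by (cases "x = y") (auto simp: off_def)
    qed (use insert in auto)
    then have "h \<cdot> q \<in> M" using q by simp
    then show ?case using c insert.prems by (simp add: h_def)
  qed
  show "{g \<in> carrier G. root g = \<one> \<and> (\<forall>x\<in>X. sec g x \<in> K)} \<subseteq> M"
    using * [OF finite_R] by (auto simp: off_def)
qed

lemma fin_index_section: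
  assumes K: "fin_index G K" and x: "x \<in> X"
  shows "fin_index G {h \<in> P. sec h x \<in> K}"
proof (rule fin_index_vertexwise[OF K])
  have sK: "subgroup K G" using K by (simp add: fin_index_def)
  show "subgroup {h \<in> P. sec h x \<in> K} G"
  proof
    show "\<one>\<^sub>G \<in> {h \<in> P. sec h x \<in> K}"
      using x subgroup.one_closed[OF sK] by (simp add: P_def)
  next
    fix a b assume "a \<in> {h \<in> P. sec h x \<in> K}" "b \<in> {h \<in> P. sec h x \<in> K}"
    then show "a \<cdot> b \<in> {h \<in> P. sec h x \<in> K}"
      using x subgroup.m_closed[OF sK] by (simp add: P_def sec_mult)
  next
    fix a assume "a \<in> {h \<in> P. sec h x \<in> K}"
    then show "inv\<^sub>G a \<in> {h \<in> P. sec h x \<in> K}"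
      using x subgroup.m_inv_closed[OF sK] by (simp add: P_def sec_inv)
  qed (simp add: P_def)
qed (use x in \<open>auto simp: P_def\<close>)

section \<open>Just infiniteness\<close>

lemma off_translate:
  assumes "g \<in> carrier G" "x \<in> X" "y \<in> X" "off {x} g"
  shows "off {y} (cj (y \<otimes> inv x) g)" "sec (cj (y \<otimes> inv x) g) y = sec g x"
proof -
  show "sec (cj (y \<otimes> inv x) g) y = sec g x" using assms by (simp add: inv_mult_group m_assoc)
  have "inv (y \<otimes> inv x) \<otimes> z \<noteq> x" if "z \<in> X" "z \<noteq> y" for z
  proof
    assume "inv (y \<otimes> inv x) \<otimes> z = x"
    then have "(y \<otimes> inv x) \<otimes> (inv (y \<otimes> inv x) \<otimes> z) = y" using assms by (simp add: m_assoc)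
    then show False using that assms by simp
  qed
  then show "off {y} (cj (y \<otimes> inv x) g)" using assms
      by (auto simp: off_def simp del: inv_mult_group)
qed

text \<open>Induction on the level at which \<open>N\<close> acts non-trivially: \<open>N\<close> contains the commutators
  of its own sections with the rigid stabilisers.\<close>

lemma just_infinite:
  assumes tor: "torsion G" and Rist: "fin_index G Rist"
    and N: "N \<lhd> G" and g: "g \<in> N" "g \<noteq> \<one>\<^sub>G"
  shows "fin_index G N"
proof -
  have "g \<in> carrier G" using subgroup.mem_carrier[OF normal_imp_subgroup[OF N]] g by simp
  then obtain n where "g \<notin> St n" using St_separates g by blast
  then show ?thesis using N g(1)
  proof (induction n arbitrary: N g)
    case 0
    then show ?case using subgroup.mem_carrier[OF normal_imp_subgroup[OF 0(2)]] by simp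
  next
    case (Suc n)
    interpret N: normal N G by fact
    have g: "g \<in> carrier G" using Suc by simp
    define K where "K = {k \<in> carrier G. \<exists>p\<in>N. off {\<one>} p \<and> sec p \<one> = k}"
    have K: "K \<lhd> G" unfolding K_def
      by (rule normal_off_sections[where Q = P]) (use sec_surj P_closed N.inv_op_closed2
          N.subgroup_axioms in auto)
    have rist: "\<exists>p\<in>carrier G. off {\<one>} p \<and> sec p \<one> = a" "a \<in> carrier G" if "a \<in> Rist" for a
      using that by (auto simp: Rist_def)
    have "\<exists>C. fin_index G C \<and> (\<forall>a\<in>C. \<forall>b\<in>C. commutator G a b \<in> K)"
    proof (cases "root g = \<one>")
      case False
      have "commutator G a b \<in> K" if ab: "a \<in> Rist" "b \<in> Rist" for a b
      proof -
        obtain p q where p: "p \<in> carrier G" "off {\<one>} p" "sec p \<one> = a"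
          and q: "q \<in> carrier G" "off {\<one>} q" "sec q \<one> = b" using rist ab by blast
        \<comment> \<open>Since \<open>g\<close> moves the letter \<open>\<one>\<close>, the factor
          \<open>p\<close> and the conjugate of its inverse by \<open>g\<close> live below different
          letters. Hence \<open>h\<close>, which lies in \<open>N\<close>, has section
          \<open>a\<close> at \<open>\<one>\<close>, and the commutator with \<open>q\<close>
          removes what it does elsewhere.\<close>
        define h where "h = p \<cdot> (g \<cdot> inv\<^sub>G p \<cdot> inv\<^sub>G g)"
        have pr: "root p = \<one>" "root q = \<one>" using p q by (auto simp: off_def)
        have h: "h \<in> carrier G" "root h = \<one>" using p pr g by (auto simp: h_def)
        have "h = (p \<cdot> g \<cdot> inv\<^sub>G p) \<cdot> inv\<^sub>G g" using p g by (simp add: h_def G.m_assoc)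
        then have hN: "h \<in> N" using p Suc.prems N.inv_op_closed2 by simp
        have "inv (root g) \<noteq> \<one>" using False g by (metis inv_inv inv_one root_closed)
        then have "sec h \<one> = a"
          using p pr g sec_closed[of p \<one>] by (simp add: h_def sec_mult sec_inv) (simp add: off_def)
        have "commutator G h q = h \<cdot> (q \<cdot> inv\<^sub>G h \<cdot> inv\<^sub>G q)"
          using h q by (simp add: commutator_def G.m_assoc)
        then have cN: "commutator G h q \<in> N" using hN q N.inv_op_closed2 by simp
        have s: "sec (commutator G h q) x = commutator G (sec h x) (sec q x)" if "x \<in> X" for x
          using sec_commutator h q pr that by blast
        have "off {\<one>} (commutator G h q)"
          using s h q pr root_commutator[of h q] by (auto simp: off_def)
        then show ?thesis
          using cN s[of \<one>] \<open>sec h \<one> = a\<close> q ab rist(2) unfolding K_def by auto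
      qed
      then show ?thesis using Rist by blast
    next
      case True
      then obtain x where x: "x \<in> X" "sec g x \<notin> St n" using Suc.prems g by auto
      \<comment> \<open>The induction hypothesis is applied to this group of sections: it contains
        \<open>sec g x\<close>, brought to \<open>\<one>\<close> by a rooted conjugation, which acts
        non-trivially one level higher than \<open>g\<close>.\<close>
      define N1 where "N1 = (\<lambda>q. sec q \<one>) ` (N \<inter> P)"
      have N1: "N1 \<lhd> G"
      proof (rule G.normal_invI)
        show "subgroup N1 G"
        proof
          show "N1 \<subseteq> carrier G" by (auto simp: N1_def)
          show "\<one>\<^sub>G \<in> N1" unfolding N1_def
            by (intro image_eqI[of _ _ "\<one>\<^sub>G"]) (auto simp: P_def)
        next
          fix a b assume "a \<in> N1" "b \<in> N1"
          then obtain p q where "p \<in> N \<inter> P" "q \<in> N \<inter> P" "a = sec p \<one>" "b = sec q \<one>"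
              by (auto simp: N1_def)
          then show "a \<cdot> b \<in> N1" unfolding N1_def
            by (intro image_eqI[of _ _ "p \<cdot> q"]) (auto simp: P_def sec_mult)
        next
          fix a assume "a \<in> N1"
          then obtain p where "p \<in> N \<inter> P" "a = sec p \<one>" by (auto simp: N1_def)
          then show "inv\<^sub>G a \<in> N1" unfolding N1_def
            by (intro image_eqI[of _ _ "inv\<^sub>G p"]) (auto simp: P_def sec_inv)
        qed
        fix u a assume u: "u \<in> carrier G" and "a \<in> N1"
        then obtain p where p: "p \<in> N \<inter> P" "a = sec p \<one>" by (auto simp: N1_def)
        obtain q where q: "q \<in> P" "sec q \<one> = u" using sec_surj[OF one_closed u] by blast
        show "u \<cdot> a \<cdot> inv\<^sub>G u \<in> N1" unfolding N1_def
          by (intro image_eqI[of _ _ "q \<cdot> p \<cdot> inv\<^sub>G q"])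
            (use p q N.inv_op_closed2 in \<open>auto simp: P_def sec_mult sec_inv\<close>)
      qed
      have "cj (inv x) g \<in> N" using Suc.prems x N.inv_op_closed2[of "rt (inv x)" g]
          by (simp add: cj_def)
      moreover have "cj (inv x) g \<in> P" using x g True by (intro P_memI) simp_all
      ultimately have "sec (cj (inv x) g) \<one> \<in> N1" unfolding N1_def by blast
      then have "sec g x \<in> N1" using x g by simp
      then have "fin_index G N1" using Suc.IH[OF x(2) N1] by blast
      then have C: "fin_index G (N1 \<inter> Rist)" using Rist G.fin_index_inter by blast
      have "commutator G a b \<in> K" if ab: "a \<in> N1 \<inter> Rist" "b \<in> N1 \<inter> Rist" for a b
      proof -
        obtain h where h: "h \<in> N" "h \<in> carrier G" "root h = \<one>" "sec h \<one> = a"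
        proof -
          have "a \<in> N1" using ab by blast
          then obtain h where "h \<in> N \<inter> P" "a = sec h \<one>" unfolding N1_def by (rule imageE)
          then show ?thesis using P_closed[of h] P_root[of h] by (intro that) simp_all
        qed
        obtain q where q: "q \<in> carrier G" "off {\<one>} q" "sec q \<one> = b" using rist ab by blast
        have pr: "root q = \<one>" using q by (auto simp: off_def)
        have "commutator G h q = h \<cdot> (q \<cdot> inv\<^sub>G h \<cdot> inv\<^sub>G q)"
          using h q by (simp add: commutator_def G.m_assoc)
        then have cN: "commutator G h q \<in> N" using h q N.inv_op_closed2 by simp
        have s: "sec (commutator G h q) x = commutator G (sec h x) (sec q x)" if "x \<in> X" for x
          using sec_commutator h q pr that by blast
        have "off {\<one>} (commutator G h q)"
          using s h q pr root_commutator[of h q] by (auto simp: off_def)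
        then show ?thesis
          using cN s[of \<one>] h q ab rist(2) unfolding K_def by auto
      qed
      then show ?thesis using C by blast
    qed
    then obtain C where C: "fin_index G C" "\<And>a b. a \<in> C \<Longrightarrow> b \<in> C \<Longrightarrow> commutator G a b \<in> K" by blast
    have fK: "fin_index G K" by (rule G.fin_index_of_commutators[OF gens tor C(1) K C(2)])
    show ?case
    proof (rule fin_index_of_off_sections[OF N.subgroup_axioms fK])
      fix k x assume "k \<in> K" and x: "x \<in> X"
      then obtain p where p: "p \<in> N" "off {\<one>} p" "sec p \<one> = k" unfolding K_def by blast
      have "cj (x \<otimes> inv \<one>) p \<in> N" using p x N.inv_op_closed2 by (simp add: cj_def)
      then show "\<exists>q\<in>N. off {x} q \<and> sec q x = k"
        using off_translate[of p \<one> x] p x N.mem_carrier by auto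
    qed
  qed
qed

end

section \<open>Finite index of the rigid stabiliser, and dense subgroups with a full section\<close>

context constant_spinal
begin

text \<open>The assumption on \<open>y\<close> makes \<open>p|\<^sub>y \<mapsto> p|\<^sub>e\<close> a homomorphism from \<open>G\<close> to \<open>G/N\<close>. The elements
  of \<open>D\<close> are images of rooted ones, and so are the rooted ones; hence \<open>G/N\<close> is finite.\<close>

lemma transported_sections:
  assumes N: "N \<lhd> G" "\<not> fin_index G N" and y: "y \<in> X" "y \<noteq> \<one>"
    and imp: "\<And>p. p \<in> P \<Longrightarrow> sec p y = \<one>\<^sub>G \<Longrightarrow> sec p \<one> \<in> N"
    and d: "d \<in> D" and gen: "generate R {ls d z | z. z \<in> X \<and> z \<noteq> \<one> \<and> z \<noteq> y} = X"
  shows False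
proof -
  interpret N: normal N G by fact
  interpret P: subgroup P G by (rule subgroup_P)
  \<comment> \<open>The conjugate \<open>cj (y \<otimes> inv z) d\<close> has section
    \<open>ls d z\<close> at \<open>y\<close> and \<open>ls d (z \<otimes> inv y)\<close> at
    \<open>\<one>\<close>. Omitting \<open>z = y\<close> keeps the second section rooted as
    well.\<close>
  have *: "\<exists>r\<in>X. \<exists>p\<in>P. sec p y = rt r' \<and> sec p \<one> = rt r"
    if "r' \<in> generate R {ls d z | z. z \<in> X \<and> z \<noteq> \<one> \<and> z \<noteq> y}" for r'
    using that
  proof (induction r' rule: generate.induct)
    case one
    then show ?case using y P.one_closed by (intro bexI[of _ \<one>] bexI[of _ "\<one>\<^sub>G"]) auto
  next
    case (incl h)
    then obtain z where z: "z \<in> X" "z \<noteq> \<one>" "z \<noteq> y" "h = ls d z" by blast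
    have ne: "z \<otimes> inv y \<noteq> \<one>" using z y by (metis inv_closed inv_equality inv_inv)
    have "sec (cj (y \<otimes> inv z) d) y = rt h" "sec (cj (y \<otimes> inv z) d) \<one> = rt (ls d (z \<otimes> inv y))"
      using z y d ne letter_section(2) by (simp_all add: inv_mult_group m_assoc)
    moreover have "cj (y \<otimes> inv z) d \<in> P" using z y d by (intro cj_D_in_P) auto
    ultimately show ?case using letter_section(1)[OF d _ ne] z y by blast
  next
    case (inv h)
    then obtain z where z: "z \<in> X" "z \<noteq> \<one>" "z \<noteq> y" "h = ls d z" by blast
    have ne: "z \<otimes> inv y \<noteq> \<one>" using z y by (metis inv_closed inv_equality inv_inv)
    have h: "h \<in> X" "ls d (z \<otimes> inv y) \<in> X" using letter_section(1) d z y ne by auto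
    have p: "cj (y \<otimes> inv z) d \<in> P" using z y d by (intro cj_D_in_P) auto
    have "sec (cj (y \<otimes> inv z) d) y = rt h" "sec (cj (y \<otimes> inv z) d) \<one> = rt (ls d (z \<otimes> inv y))"
      using z y d ne letter_section(2) by (simp_all add: inv_mult_group m_assoc)
    then have "sec (inv\<^sub>G (cj (y \<otimes> inv z) d)) y = rt (inv h)"
      "sec (inv\<^sub>G (cj (y \<otimes> inv z) d)) \<one> = rt (inv (ls d (z \<otimes> inv y)))"
      using z y d h P_root[OF p] P_closed[OF p] by (simp_all add: sec_inv rooted_inv)
    then show ?case using P.m_inv_closed[OF p] h by blast
  next
    case (eng h k)
    have "{ls d z | z. z \<in> X \<and> z \<noteq> \<one> \<and> z \<noteq> y} \<subseteq> X" using letter_section(1) d by blast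
    then have hk: "h \<in> X" "k \<in> X" using eng generate_in_carrier by blast+
    obtain r s p q where *: "r \<in> X" "s \<in> X" "p \<in> P" "q \<in> P"
      "sec p y = rt h" "sec p \<one> = rt r" "sec q y = rt k" "sec q \<one> = rt s" using eng.IH by blast
    then have "sec (p \<cdot> q) y = rt (h \<otimes> k)" "sec (p \<cdot> q) \<one> = rt (r \<otimes> s)"
      using y hk P_root P_closed by (simp_all add: sec_mult rooted_mult)
    then show ?case using * P.m_closed by (meson m_closed)
  qed
  have D: "\<exists>r\<in>X. e \<cdot> inv\<^sub>G (rt r) \<in> N" if e: "e \<in> D" for e
  proof -
    have "ls e y \<in> X" using letter_section(1) e y by blast
    then obtain r p where p: "r \<in> X" "p \<in> P" "sec p y = rt (ls e y)" "sec p \<one> = rt r"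
      using * gen by blast
    have eP: "e \<in> P" using e by (intro P_memI) auto
    \<comment> \<open>The quotient of \<open>e\<close> by \<open>p\<close> vanishes at
      \<open>y\<close>, so its section at \<open>\<one>\<close>, which compares \<open>e\<close>
      with a rooted element, falls into \<open>N\<close>.\<close>
    have "sec (e \<cdot> inv\<^sub>G p) y = \<one>\<^sub>G"
      using p y e letter_section[OF e y] P_root P_closed by (simp add: sec_mult sec_inv)
    moreover have "sec (e \<cdot> inv\<^sub>G p) \<one> = e \<cdot> inv\<^sub>G (rt r)"
      using p e P_root P_closed by (simp add: sec_mult sec_inv)
    ultimately show ?thesis using imp[of "e \<cdot> inv\<^sub>G p"] p eP by auto
  qed
  have "\<exists>r\<in>X. g \<cdot> inv\<^sub>G (rt r) \<in> N" if "g \<in> generate G gens" for g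
    using that
  proof (induction g rule: generate.induct)
    case one show ?case by (intro bexI[of _ \<one>]) auto
  next
    case (incl h)
    then show ?case
    proof
      assume "h \<in> rt ` X"
      then obtain r where "r \<in> X" "h = rt r" by blast
      then show ?thesis by (intro bexI[of _ r]) simp_all
    qed (rule D)
  next
    case (inv h)
    then show ?case
    proof
      assume "h \<in> rt ` X"
      then obtain r where r: "r \<in> X" "h = rt r" by blast
      have "inv\<^sub>G h \<cdot> inv\<^sub>G (rt (inv r)) \<in> N" using r by (simp add: rooted_inv)
      then show ?thesis using r by blast
    next
      assume h: "h \<in> D"
      then obtain r where r: "r \<in> X" "h \<cdot> inv\<^sub>G (rt r) \<in> N" using D by blast
      have hc: "h \<in> carrier G" using h by simp
      have "inv\<^sub>G h \<cdot> inv\<^sub>G (rt (inv r)) = inv\<^sub>G (rt r) \<cdot> inv\<^sub>G (h \<cdot> inv\<^sub>G (rt r)) \<cdot> inv\<^sub>G (inv\<^sub>G (rt r))"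
        using r hc by (simp add: rooted_inv G.inv_mult_group G.m_assoc)
      also have "\<dots> \<in> N" using r by (intro N.inv_op_closed2) auto
      finally show ?thesis using r by blast
    qed
  next
    case (eng h k)
    then have c: "h \<in> carrier G" "k \<in> carrier G" using gens by auto
    obtain r s where r: "r \<in> X" "s \<in> X" "h \<cdot> inv\<^sub>G (rt r) \<in> N" "k \<cdot> inv\<^sub>G (rt s) \<in> N"
      using eng.IH by blast
    have "(h \<cdot> k) \<cdot> inv\<^sub>G (rt (r \<otimes> s)) = (h \<cdot> (k \<cdot> inv\<^sub>G (rt s)) \<cdot> inv\<^sub>G h) \<cdot> (h \<cdot> inv\<^sub>G (rt r))"
      using r c by (simp add: rooted_mult G.inv_mult_group G.m_assoc)
    also have "\<dots> \<in> N" using r c N.inv_op_closed2 by simp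
    finally show ?case using r by blast
  qed
  then have "\<exists>f\<in>rt ` X. g \<cdot> inv\<^sub>G f \<in> N" if "g \<in> carrier G" for g
    using that gens(3) by auto
  then have "fin_index G N"
    using finite_R by (intro G.fin_index_of_finite_complement[OF N(1), where F = "rt ` X"]) auto
  then show False using N by simp
qed

text \<open>Modulo \<open>N\<close>, the conjugate of \<open>d \<in> D\<close> by \<open>s\<close> depends only on the coset of \<open>s\<close> modulo
  \<open>\<langle>w\<rangle>\<close>. So the commutator subgroup of \<open>P\<close> is covered by elements supported on a transversal
  \<open>T\<close>, and also by elements supported on the disjoint set \<open>w T\<close>: it is abelian modulo \<open>N\<close>.\<close>

lemma abelian_rooted_not_in_normal:
  assumes tor: "torsion G" and comm: "\<And>a b. a \<in> X \<Longrightarrow> b \<in> X \<Longrightarrow> a \<otimes> b = b \<otimes> a"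
    and mN: "maximal_infinite_index G N"
    and w: "w \<in> X" "w \<noteq> \<one>" "rt w \<in> N"
  shows False
proof -
  have N: "N \<lhd> G" "\<not> fin_index G N" using mN unfolding maximal_infinite_index_def by blast+
  interpret N: normal N G by fact
  interpret P: normal P G by (rule normal_P)
  note prime = G.prime_of_maximal_infinite_index[OF gens tor mN]
  define W where "W = generate R {w}"
  have W: "subgroup W R" unfolding W_def by (rule generate_is_subgroup) (use w in simp)
  interpret W: subgroup W R by (rule W)
  have wW: "w \<in> W" by (simp add: W_def generate.incl)
  have rtW: "rt u \<in> N" if "u \<in> W" for u
    using rooted_generate[OF N.subgroup_axioms, of "{w}" u] w that unfolding W_def by blast
  define \<rho> where "\<rho> s = (SOME z. z \<in> W #> s)" for s
  have \<rho>: "\<rho> s \<in> W #> s" if "s \<in> X" for s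
    unfolding \<rho>_def using rcos_self[OF that W] by (rule someI)
  have \<rho>c: "\<rho> s \<in> X" if "s \<in> X" for s
    using \<rho>[OF that] W.elemrcos_carrier[OF group_axioms that] by blast
  have \<rho>_coset: "W #> \<rho> s = W #> s" if "s \<in> X" for s
    using repr_independence[OF \<rho>[OF that] that W] by simp
  define T where "T = \<rho> ` X"
  \<comment> \<open>\<open>T\<close> and its translate by \<open>w\<close> are disjoint, because
    \<open>T\<close> has one representative for each coset of \<open>W\<close> and \<open>w\<close>
    is a non-trivial element of \<open>W\<close>.\<close>
  have disj: "inv w \<otimes> t \<notin> T" if t: "t \<in> T" for t
  proof
    assume "inv w \<otimes> t \<in> T"
    then obtain s' where s': "s' \<in> X" "inv w \<otimes> t = \<rho> s'" unfolding T_def by (elim imageE)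
    obtain s where s: "s \<in> X" "s' \<in> X" "t = \<rho> s" "inv w \<otimes> \<rho> s = \<rho> s'"
      using t s' unfolding T_def by (elim imageE) simp
    have "W #> \<rho> s' = W #> \<rho> s"
    proof (rule rcoset_eq_iff[OF W, THEN iffD2])
      have "inv w \<otimes> \<rho> s \<otimes> inv (\<rho> s) = inv w" using w \<rho>c[OF s(1)] by simp
      then have "\<rho> s' \<otimes> inv (\<rho> s) = inv w" unfolding s(4) .
      then show "\<rho> s' \<otimes> inv (\<rho> s) \<in> W" using W.m_inv_closed[OF wW] by metis
    next
      show "\<rho> s' \<in> X" using \<rho>c[OF s(2)] .
      show "\<rho> s \<in> X" using \<rho>c[OF s(1)] .
    qed
    then have "W #> s = W #> s'" using \<rho>_coset s by simp
    then have "\<rho> s = \<rho> s'" by (simp add: \<rho>_def)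
    then have "inv w \<otimes> \<rho> s = \<rho> s" using s by simp
    then have "inv w \<otimes> \<rho> s = \<one> \<otimes> \<rho> s" using \<rho>c[OF s(1)] by simp
    then have "inv w = \<one>" using right_cancel[of "\<rho> s" "inv w" \<one>] \<rho>c[OF s(1)] w(1) by simp
    then show False using w(1,2) inv_eq_1_iff by blast
  qed
  define K0 where "K0 = {p \<in> carrier G. off T p}"
  have K0: "subgroup K0 G" unfolding K0_def
  proof
    show "{p \<in> carrier G. off T p} \<subseteq> carrier G" by (rule Collect_restrict)
    show "\<one>\<^sub>G \<in> {p \<in> carrier G. off T p}" by (simp add: off_def)
    show "a \<cdot> b \<in> {p \<in> carrier G. off T p}"
      if "a \<in> {p \<in> carrier G. off T p}" "b \<in> {p \<in> carrier G. off T p}" for a b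
      using that by (simp add: off_def sec_mult)
    show "inv\<^sub>G a \<in> {p \<in> carrier G. off T p}" if "a \<in> {p \<in> carrier G. off T p}" for a
      using that by (simp add: off_def sec_inv)
  qed
  have conjK0: "p \<cdot> k \<cdot> inv\<^sub>G p \<in> K0" if "p \<in> P" "k \<in> K0" for p k
    using P_closed[OF that(1)] P_root[OF that(1)] that(2)
        by (simp add: K0_def off_def sec_mult sec_inv)
  define K where "K = K0 <#>\<^bsub>G\<^esub> N"
  have K: "subgroup K G" unfolding K_def using K0 N(1) by (rule G.subgroup_set_mult_normal)
  interpret K: subgroup K G by (rule K)
  have sub: "K0 \<subseteq> K" "N \<subseteq> K"
    unfolding K_def using G.subset_set_mult[OF K0 N.subgroup_axioms] by auto
  have conjN: "n \<cdot> k \<cdot> inv\<^sub>G n \<in> K" if "n \<in> N" "k \<in> K" for n k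
    using that sub(2) by (intro K.m_closed) auto
  have conjP: "p \<cdot> k \<cdot> inv\<^sub>G p \<in> K" if p: "p \<in> P" and k: "k \<in> K" for p k
  proof -
    obtain a n where a: "a \<in> K0" "n \<in> N" "k = a \<cdot> n" using k unfolding K_def set_mult_def by blast
    have ac: "a \<in> carrier G" using a K0_def by simp
    have "p \<cdot> k \<cdot> inv\<^sub>G p = (p \<cdot> a \<cdot> inv\<^sub>G p) \<cdot> (p \<cdot> n \<cdot> inv\<^sub>G p)"
      using a ac P_closed[OF p] by (simp add: G.m_assoc)
    also have "\<dots> \<in> K"
      using conjK0[OF p a(1)] N.inv_op_closed2[OF P_closed[OF p] a(2)] sub
          by (metis K.m_closed subsetD)
    finally show ?thesis .
  qed
  \<comment> \<open>With \<open>N\<close> adjoined, the conjugates over the transversal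
    \<open>T\<close> suffice to generate a group containing \<open>P\<close>, since \<open>N\<close>
    contains the rooted elements of \<open>W\<close>.\<close>
  define S where "S = {cj s d | s d. s \<in> T \<and> d \<in> D} \<union> N"
  have T: "T \<subseteq> X" using \<rho>c by (auto simp: T_def)
  have S: "S \<subseteq> P \<union> N" "S \<subseteq> carrier G" using T cj_D_in_P by (auto simp: S_def)
  interpret S: subgroup "generate G S" G using S(2) by (rule G.generate_is_subgroup)
  have PS: "P \<subseteq> generate G S"
    unfolding generate_P[symmetric]
  proof (rule G.generate_subgroup_incl[OF _ S.subgroup_axioms], safe)
    fix s d assume s: "s \<in> X" and d: "d \<in> D"
    obtain u where u: "u \<in> W" "\<rho> s = u \<otimes> s" using \<rho>[OF s] unfolding r_coset_def by blast
    have "s = inv u \<otimes> \<rho> s" using u s by simp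
    then have "cj s d = inv\<^sub>G (rt u) \<cdot> cj (\<rho> s) d \<cdot> rt u"
      using u s d \<rho>c[OF s] by (simp add: cj_def rooted_mult rooted_inv G.inv_mult_group G.m_assoc)
    moreover have "cj (\<rho> s) d \<in> S" "rt u \<in> S"
      using s d rtW[OF u(1)] unfolding S_def T_def by blast+
    then have "cj (\<rho> s) d \<in> generate G S" "rt u \<in> generate G S" by (simp_all add: generate.incl)
    ultimately show "cj s d \<in> generate G S" using S.m_closed S.m_inv_closed by metis
  qed
  have PK: "commutator G a b \<in> K" if "a \<in> P" "b \<in> P" for a b
  proof (rule G.commutator_generate[OF S(2) K])
    fix g k assume "g \<in> generate G S" "k \<in> K"
    then show "g \<cdot> k \<cdot> inv\<^sub>G g \<in> K"
    proof (induction g arbitrary: k rule: generate.induct)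
      case one then show ?case by simp
    next
      case (incl h) then show ?case using S(1) conjN conjP by blast
    next
      case (inv h)
      then have "inv\<^sub>G h \<in> P \<union> N" using S(1) by auto
      then show ?case using conjN conjP inv by blast
    next
      case (eng g h)
      then have "g \<in> carrier G" "h \<in> carrier G" using S.mem_carrier by auto
      then have "g \<cdot> h \<cdot> k \<cdot> inv\<^sub>G (g \<cdot> h) = g \<cdot> (h \<cdot> k \<cdot> inv\<^sub>G h) \<cdot> inv\<^sub>G g"
        using eng.prems by (simp add: G.inv_mult_group G.m_assoc)
      then show ?case using eng by simp
    qed
  next
    fix a b assume ab: "a \<in> S" "b \<in> S"
    have ac: "a \<in> carrier G" "b \<in> carrier G" using ab S(2) by auto
    show "commutator G a b \<in> K"
    proof (cases "a \<in> N \<or> b \<in> N")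
      case True
      have "commutator G a b = a \<cdot> (b \<cdot> inv\<^sub>G a \<cdot> inv\<^sub>G b)"
        "commutator G a b = (a \<cdot> b \<cdot> inv\<^sub>G a) \<cdot> inv\<^sub>G b"
        using ac by (simp_all add: commutator_def G.m_assoc)
      then have "commutator G a b \<in> N" using True ac N.inv_op_closed2
          by (metis N.m_closed N.m_inv_closed)
      then show ?thesis using sub by blast
    next
      case False
      then obtain s d s' d' where s: "s \<in> T" "d \<in> D" "s' \<in> T" "d' \<in> D" "a = cj s d" "b = cj s' d'"
        using ab unfolding S_def by blast
      have sc: "s \<in> X" "s' \<in> X" using s T by auto
      have r: "root a = \<one>" "root b = \<one>" using s sc by auto
      \<comment> \<open>Away from \<open>T\<close> both sections are rooted, and there the
        commutator vanishes because \<open>R\<close> is abelian.\<close>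
      have "sec (commutator G a b) y = \<one>\<^sub>G" if y: "y \<in> X - T" for y
      proof -
        have ne: "inv s \<otimes> y \<noteq> \<one>" "inv s' \<otimes> y \<noteq> \<one>"
          using y s sc by (metis DiffD1 DiffD2 inv_closed inv_equality inv_inv)+
        have c: "ls d (inv s \<otimes> y) \<in> X" "ls d' (inv s' \<otimes> y) \<in> X"
          using letter_section(1) s sc y ne by auto
        have "sec a y = rt (ls d (inv s \<otimes> y))" "sec b y = rt (ls d' (inv s' \<otimes> y))"
          using letter_section(2) s sc y ne by auto
        then have "sec (commutator G a b) y = commutator G (rt (ls d (inv s \<otimes> y))) (rt (ls d' (inv
            s' \<otimes> y)))"
          using sec_commutator[OF ac r] y by simp
        also have "\<dots> = rt (ls d (inv s \<otimes> y) \<otimes> ls d' (inv s' \<otimes> y)) \<cdot>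
           inv\<^sub>G (rt (ls d' (inv s' \<otimes> y) \<otimes> ls d (inv s \<otimes> y)))"
          using c by (simp add: commutator_def rooted_mult G.inv_mult_group G.m_assoc)
        finally show ?thesis using comm[OF c] c by simp
      qed
      then have "commutator G a b \<in> K0" using ac root_commutator[OF ac r]
          by (simp add: K0_def off_def)
      then show ?thesis using sub by blast
    qed
  qed (use PS that in auto)
  have K0N: "commutator G a b \<in> N" if "a \<in> K0" "b \<in> K0" for a b
  proof -
    have a: "a \<in> carrier G" "off T a" and b: "b \<in> carrier G" "off T b" using that
        by (auto simp: K0_def)
    have r: "root a = \<one>" "root b = \<one>" using a b by (auto simp: off_def)
    \<comment> \<open>Conjugation by \<open>rt w\<close>, an element of \<open>N\<close>, does not
      change \<open>b\<close> modulo \<open>N\<close> but moves its support to the translate of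
      \<open>T\<close>, where \<open>a\<close> is trivial.\<close>
    have "commutator G a (cj w b) = \<one>\<^sub>G"
    proof (rule spinal_ext)
      fix y assume y: "y \<in> X"
      have "sec (commutator G a (cj w b)) y = commutator G (sec a y) (sec b (inv w \<otimes> y))"
        using a b r w y by (subst sec_commutator) auto
      moreover have "sec a y = \<one>\<^sub>G \<or> sec b (inv w \<otimes> y) = \<one>\<^sub>G"
        using a b y w disj by (auto simp: off_def)
      ultimately show "sec (commutator G a (cj w b)) y = sec \<one>\<^sub>G y" using a b y w by auto
    qed (use a b w r root_commutator[of a "cj w b"] in auto)
    then have "commutator G a (cj w b) \<in> N" by simp
    moreover have "N #>\<^bsub>G\<^esub> cj w b = N #>\<^bsub>G\<^esub> b"
      unfolding cj_def using w b by (intro G.normal_conj_coset[OF N(1)]) auto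
    ultimately show ?thesis using G.commutator_mod_cong[OF N(1), of a "cj w b" a b] a b w by simp
  qed
  have KN: "commutator G a b \<in> N" if "a \<in> K" "b \<in> K" for a b
  proof -
    obtain x n y m where *: "x \<in> K0" "n \<in> N" "a = x \<cdot> n" "y \<in> K0" "m \<in> N" "b = y \<cdot> m"
      using \<open>a \<in> K\<close> \<open>b \<in> K\<close> unfolding K_def set_mult_def by blast
    then have c: "x \<in> carrier G" "y \<in> carrier G" by (auto simp: K0_def)
    have cs: "N #>\<^bsub>G\<^esub> (u \<cdot> v) = N #>\<^bsub>G\<^esub> u" if "u \<in> carrier G" "v \<in> N" for u v
      using that G.rcoset_eq_iff[OF N.subgroup_axioms, of "u \<cdot> v" u] N.inv_op_closed2 by simp
    show ?thesis
      using G.commutator_mod_cong[OF N(1) c _ _ _ _ K0N[OF *(1,4)], of a b] * c cs by simp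
  qed
  have dn: "derived G P \<lhd> G" by (rule G.derived_is_normal[OF normal_P])
  have PD: "commutator G a b \<in> derived G P" if "a \<in> P" "b \<in> P" for a b
    unfolding derived_def commutator_def using that by (auto intro!: generate.incl)
  have DK: "derived G P \<subseteq> K"
    unfolding derived_def using PK by (intro G.generate_subgroup_incl[OF _ K]) (auto simp:
        commutator_def)
  \<comment> \<open>Primeness of \<open>N\<close> is used twice: first for the derived subgroup of
    \<open>P\<close>, which commutes with itself modulo \<open>N\<close>, and then for
    \<open>P\<close>, whose finite index contradicts that of \<open>N\<close>.\<close>
  have "derived G P \<subseteq> N"
  proof (rule ccontr)
    assume "\<not> ?thesis"
    then obtain a b where "a \<in> derived G P" "b \<in> derived G P" "commutator G a b \<notin> N"
      using prime[OF dn _ dn] by blast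
    then show False using DK KN by blast
  qed
  then have "P \<subseteq> N" using prime[OF normal_P _ normal_P] PD by blast
  then show False using N(2) G.fin_index_mono[OF fin_index_P N.subgroup_axioms] by blast
qed

text \<open>Otherwise a maximal \<open>N\<close> of infinite index contains \<open>Rist\<close>,
  which excludes the first case of \<open>support_dichotomy\<close> and leaves a letter
  \<open>y\<close> whose sections control those at \<open>\<one>\<close> modulo \<open>N\<close>.
  For non-abelian \<open>R\<close> this contradicts \<open>transported_sections\<close>; for abelian
  \<open>R\<close> it makes some non-trivial rooted element central modulo \<open>N\<close>, hence a
  member of \<open>N\<close>.\<close>

lemma fin_index_Rist:
  assumes tor: "torsion G"
    and gen: "(\<forall>a\<in>X. \<forall>b\<in>X. a \<otimes> b = b \<otimes> a) \<or>
      (\<exists>d\<in>D. \<forall>y\<in>X. y \<noteq> \<one> \<longrightarrow>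
        generate R {ls d z | z. z \<in> X \<and> z \<noteq> \<one> \<and> z \<noteq> y} = X)"
    and two: "\<forall>y\<in>X. \<exists>d\<in>D. \<exists>z\<in>X. z \<noteq> \<one> \<and> z \<noteq> y \<and> ls d z \<noteq> \<one>"
  shows "fin_index G Rist"
proof (rule ccontr)
  assume "\<not> ?thesis"
  then obtain N where mN: "maximal_infinite_index G N" and RN: "Rist \<subseteq> N"
    using G.exists_maximal_infinite_index[OF gens normal_Rist] by blast
  then have N: "N \<lhd> G" "\<not> fin_index G N" unfolding maximal_infinite_index_def by blast+
  interpret N: normal N G by fact
  have "\<exists>y\<in>X. y \<noteq> \<one> \<and> (\<forall>q\<in>P. sec q y = \<one>\<^sub>G \<longrightarrow> sec q \<one> \<in> N)"
  proof -
    have "sec q \<one> \<in> N" if "q \<in> P" "off {\<one>} q" for q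
    proof -
      have "sec q \<one> \<in> Rist" unfolding Rist_def using that P_closed[OF that(1)] sec_closed[of q \<one>]
          by blast
      then show ?thesis using RN by (rule rev_subsetD)
    qed
    then show ?thesis
      using support_dichotomy[OF tor mN subgroup_P order_refl sec_surj[OF one_closed]] by blast
  qed
  then obtain y where y: "y \<in> X" "y \<noteq> \<one>"
    and imp: "\<And>q. q \<in> P \<Longrightarrow> sec q y = \<one>\<^sub>G \<Longrightarrow> sec q \<one> \<in> N" by blast
  show False
  proof (cases "\<forall>a\<in>X. \<forall>b\<in>X. a \<otimes> b = b \<otimes> a")
    case False
    then show False using gen transported_sections[OF N y imp] y by blast
  next
    case True
    \<comment> \<open>Avoiding \<open>inv y\<close> gives
      \<open>z \<otimes> y \<noteq> \<one>\<close>, so that \<open>p\<close> below has rooted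
      sections at both \<open>\<one>\<close> and \<open>y\<close>. Its commutators with
      \<open>D\<close> then vanish at \<open>y\<close>.\<close>
    obtain d z where d: "d \<in> D" "z \<in> X" "z \<noteq> \<one>" "z \<noteq> inv y" "ls d z \<noteq> \<one>"
      using two y by (meson inv_closed)
    have zy: "z \<otimes> y \<in> X" "z \<otimes> y \<noteq> \<one>" using d y by (auto simp: inv_equality)
    have c: "ls d z \<in> X" "ls d (z \<otimes> y) \<in> X" using letter_section(1) d zy by auto
    define p where "p = cj (inv z) d"
    have p: "p \<in> P" "sec p \<one> = rt (ls d z)" "sec p y = rt (ls d (z \<otimes> y))"
      unfolding p_def using d y zy letter_section(2) cj_D_in_P by auto
    let ?w = "rt (ls d z)"
    have "commutator G ?w g \<in> N" if g: "g \<in> gens" for g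
      using g
    proof
      assume "g \<in> rt ` X"
      then obtain r where r: "r \<in> X" "g = rt r" by blast
      have "commutator G ?w g = rt (ls d z \<otimes> r) \<cdot> inv\<^sub>G (rt (r \<otimes> ls d z))"
        using r c by (simp add: commutator_def rooted_mult G.inv_mult_group G.m_assoc)
      then show ?thesis using True r c by simp
    next
      assume g: "g \<in> D"
      have gP: "g \<in> P" using g by (intro P_memI) auto
      have cy: "ls g y \<in> X" "sec g y = rt (ls g y)" using letter_section[OF g y] by auto
      have s: "sec (commutator G p g) x = commutator G (sec p x) (sec g x)" if "x \<in> X" for x
        using sec_commutator P_closed P_root p(1) gP that by simp
      have "sec (commutator G p g) y = commutator G (rt (ls d (z \<otimes> y))) (rt (ls g y))"
        using s[OF y(1)] p cy by simp
      also have "\<dots> = rt (ls d (z \<otimes> y) \<otimes> ls g y) \<cdot> inv\<^sub>G (rt (ls g y \<otimes> ls d (z \<otimes> y)))"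
        using cy c by (simp add: commutator_def rooted_mult G.inv_mult_group G.m_assoc)
      also have "\<dots> = \<one>\<^sub>G" using True cy c by simp
      finally have "sec (commutator G p g) \<one> \<in> N"
        using root_commutator P_closed P_root p(1) gP by (intro imp P_memI) auto
      then show ?thesis using s[of \<one>] p g by simp
    qed
    then have "?w \<in> {a \<in> carrier G. \<forall>g\<in>carrier G. commutator G a g \<in> N}" (is "_ \<in> ?Z")
      using G.commutes_mod_generators[OF N(1) gens(2), of ?w] gens(3) c by auto
    \<comment> \<open>The centre modulo \<open>N\<close> is a normal subgroup commuting with itself,
      so primeness makes it trivial.\<close>
    moreover have "?Z \<subseteq> N"
    proof (rule ccontr)
      assume ns: "\<not> ?Z \<subseteq> N"
      have n: "?Z \<lhd> G" using N(1) by (rule G.commutes_mod_normal)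
      from G.prime_of_maximal_infinite_index[OF gens tor mN n ns n ns]
      obtain a b where "a \<in> ?Z" "b \<in> ?Z" "commutator G a b \<notin> N" by (elim bexE)
      then show False by simp
    qed
    ultimately have "?w \<in> N" by blast
    then show False using abelian_rooted_not_in_normal[OF tor _ mN c(1) d(5)] True by blast
  qed
qed

text \<open>If the rigid stabilisers of \<open>M\<close> are trivial, then \<open>q|\<^sub>e\<close> is a function of \<open>q|\<^sub>y\<close> for the
  \<open>q \<in> M\<close> fixing the first level. But the graph of a homomorphism is never dense in a product,
  and \<open>P\<close> contains the product of the rigid stabilisers.\<close>

lemma prodense_of_full_sections:
  assumes tor: "torsion G" and Rist: "fin_index G Rist" and M: "prodense G M"
    and full: "\<And>g. g \<in> carrier G \<Longrightarrow> \<exists>m\<in>M. root m = \<one> \<and> sec m \<one> = g"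
  shows "M = carrier G"
proof (rule G.prodense_fin_index_eq[OF M], rule ccontr)
  assume nfi: "\<not> fin_index G M"
  have sM: "subgroup M G" using M by (simp add: prodense_def)
  interpret M: subgroup M G by (rule sM)
  interpret P: subgroup P G by (rule subgroup_P)
  define Q where "Q = M \<inter> P"
  have Q: "subgroup Q G" "Q \<subseteq> P"
    unfolding Q_def using G.subgroups_Inter_pair[OF sM subgroup_P] by auto
  have surj: "\<exists>q\<in>Q. sec q \<one> = g" if g: "g \<in> carrier G" for g
  proof -
    obtain m where m: "m \<in> M" "root m = \<one>" "sec m \<one> = g" using full[OF g] by blast
    then have "m \<in> Q" unfolding Q_def using P_memI[of m] M.mem_carrier[of m] by blast
    then show ?thesis using m by blast
  qed
  have dense: "\<exists>m\<in>M. \<exists>h\<in>H. g = m \<cdot> h" if "fin_index G H" "g \<in> carrier G" for g H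
    using M that unfolding prodense_def by blast
  have Qd: "q \<in> M" "q \<in> P" "q \<in> carrier G" "root q = \<one>" if "q \<in> Q" for q
    using that P_closed P_root unfolding Q_def by blast+
  have QI: "q \<in> Q" if "q \<in> M" "root q = \<one>" for q
    using that M.mem_carrier P_memI unfolding Q_def by blast
  define N1 where "N1 = {g \<in> carrier G. \<exists>p\<in>M. off {\<one>} p \<and> sec p \<one> = g}"
  have N1: "N1 \<lhd> G" unfolding N1_def
    by (rule normal_off_sections[OF sM _ Q(2) surj]) (simp_all add: Qd(1))
  interpret N1: normal N1 G by (rule N1)
  have N1_triv: "N1 = {\<one>\<^sub>G}"
  proof (rule ccontr)
    assume "N1 \<noteq> {\<one>\<^sub>G}"
    then obtain g where g: "g \<in> N1" "g \<noteq> \<one>\<^sub>G" using N1.one_closed by blast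
    have f: "fin_index G N1" by (rule just_infinite[OF tor Rist N1 g])
    have "fin_index G M"
    proof (rule fin_index_of_off_sections[OF sM f])
      fix k x assume k: "k \<in> N1" and x: "x \<in> X"
      obtain m h where m: "m \<in> M" "h \<in> P" "rt x = m \<cdot> h" using dense[OF fin_index_P, of "rt x"] x
          by auto
      have mc: "m \<in> carrier G" using m by simp
      have mx: "root m = x"
      using arg_cong[OF m(3), of root] root_mult[OF mc P_closed[OF m(2)]] P_root[OF m(2)] mc x
      by (metis r_one root_closed root_rooted)
      \<comment> \<open>\<open>M\<close> need not contain rooted automorphisms. The transport from
        \<open>\<one>\<close> to \<open>x\<close> uses some \<open>m\<close> in \<open>M\<close>
        with root \<open>x\<close>, and conjugating \<open>k\<close> by \<open>s\<close> beforehand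
        undoes the twist by the section of \<open>m\<close>.\<close>
      define s where "s = sec m \<one>"
      have s: "s \<in> carrier G" using mc by (simp add: s_def)
      have "inv\<^sub>G s \<cdot> k \<cdot> s \<in> N1" using k s N1.inv_op_closed1 by simp
      then obtain p where p: "p \<in> M" "off {\<one>} p" "sec p \<one> = inv\<^sub>G s \<cdot> k \<cdot> s"
        unfolding N1_def mem_Collect_eq by blast
      define q where "q = m \<cdot> p \<cdot> inv\<^sub>G m"
      have pc: "p \<in> carrier G" "root p = \<one>" using p by (auto simp: off_def)
      have sq: "sec q z = sec m (inv x \<otimes> z) \<cdot> sec p (inv x \<otimes> z) \<cdot> inv\<^sub>G (sec m (inv x \<otimes> z))"
        if "z \<in> X" for z using that mc pc x mx by (simp add: q_def sec_mult sec_inv)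
      have "sec q x = k" using sq[OF x] x p k s N1.mem_carrier
          by (simp add: s_def[symmetric] G.m_assoc)
      moreover have "off {x} q"
        unfolding off_def
      proof (intro conjI ballI)
        show "root q = \<one>" using mc pc x mx by (simp add: q_def)
        fix z assume z: "z \<in> X - {x}"
        then have "inv x \<otimes> z \<noteq> \<one>" using x
            by (metis DiffE inv_closed inv_equality inv_inv singletonI)
        then show "sec q z = \<one>\<^sub>G" using sq[of z] z x p mc by (simp add: off_def)
      qed
      moreover have "q \<in> M" using m p by (simp add: q_def)
      ultimately show "\<exists>q\<in>M. off {x} q \<and> sec q x = k" by blast
    qed
    then show False using nfi by blast
  qed
  have off1: "sec q \<one> = \<one>\<^sub>G" if q: "q \<in> M" "off {\<one>} q" for q
  proof -
    have "sec q \<one> \<in> carrier G" using q M.mem_carrier by simp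
    then have "sec q \<one> \<in> N1" unfolding N1_def using q by blast
    then show ?thesis unfolding N1_triv by simp
  qed
  have triv: "\<not> fin_index G {\<one>\<^sub>G}"
    using nfi G.fin_index_mono[OF _ sM, of "{\<one>\<^sub>G}"] M.one_closed by blast
  have max: "K = {\<one>\<^sub>G}" if "K \<lhd> G" "{\<one>\<^sub>G} \<subseteq> K" "\<not> fin_index G K" for K
  proof -
    have "\<one>\<^sub>G \<in> K" using that(2) by simp
    moreover have "g = \<one>\<^sub>G" if "g \<in> K" for g
      using just_infinite[OF tor Rist \<open>K \<lhd> G\<close> that] \<open>\<not> fin_index G K\<close> by metis
    ultimately show ?thesis by blast
  qed
  \<comment> \<open>As \<open>G\<close> is just infinite, the trivial subgroup is a legitimate
    choice for \<open>N\<close> in \<open>support_dichotomy\<close>.\<close>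
  then have mt: "maximal_infinite_index G {\<one>\<^sub>G}"
    using triv G.one_is_normal unfolding maximal_infinite_index_def by blast
  obtain y where y: "y \<in> X" "y \<noteq> \<one>"
    and imp: "\<And>q. q \<in> Q \<Longrightarrow> sec q y = \<one>\<^sub>G \<Longrightarrow> sec q \<one> = \<one>\<^sub>G"
    using support_dichotomy[OF tor mt Q surj] off1 Qd(1) by (metis singletonD singletonI)
  have "Rist \<noteq> {\<one>\<^sub>G}" using Rist triv by auto
  then obtain l where l: "l \<in> Rist" "l \<noteq> \<one>\<^sub>G"
    using subgroup.one_closed[OF normal_imp_subgroup[OF normal_Rist]] by blast
  then obtain p where p: "p \<in> carrier G" "off {\<one>} p" "sec p \<one> = l"
    unfolding Rist_def mem_Collect_eq by blast
  then have pP: "p \<in> P" unfolding off_def by (intro P_memI) blast+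
  have lc: "l \<in> carrier G" using l by (simp add: Rist_def)
  obtain n where n: "l \<notin> St n" using St_separates[OF lc l(2)] by blast
  interpret St: subgroup "St n" G by (rule subgroup_St)
  have lift: "\<exists>q\<in>Q. sec q y = g" if g: "g \<in> carrier G" for g
  proof -
    obtain m h where m: "m \<in> M" "h \<in> P" "rt y = m \<cdot> h" using dense[OF fin_index_P, of "rt y"] y
        by auto
    have mc: "m \<in> carrier G" using m by simp
    have my: "root m = y"
      using arg_cong[OF m(3), of root] root_mult[OF mc P_closed[OF m(2)]] P_root[OF m(2)] mc y
      by (metis r_one root_closed root_rooted)
    define s where "s = sec m \<one>"
    have s: "s \<in> carrier G" using mc by (simp add: s_def)
    obtain q where q: "q \<in> Q" "sec q \<one> = inv\<^sub>G s \<cdot> g \<cdot> s" using surj[of "inv\<^sub>G s \<cdot> g \<cdot> s"] s g by auto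
    have qc: "q \<in> carrier G" "root q = \<one>" "q \<in> M" using Qd[OF q(1)] by simp_all
    have "sec (m \<cdot> q \<cdot> inv\<^sub>G m) y = g"
      using mc qc y my q s g by (simp add: sec_mult sec_inv s_def[symmetric] G.m_assoc)
    moreover have "m \<cdot> q \<cdot> inv\<^sub>G m \<in> Q"
      using mc qc m my y by (intro QI) simp_all
    ultimately show ?thesis by blast
  qed
  have det: "sec q \<one> = sec q' \<one>" if "q \<in> Q" "q' \<in> Q" "sec q y = sec q' y" for q q'
  proof -
    have c: "q \<in> carrier G" "q' \<in> carrier G" "root q = \<one>" "root q' = \<one>" 
      by (rule Qd(3)[OF that(1)], rule Qd(3)[OF that(2)], rule Qd(4)[OF that(1)], rule Qd(4)[OF
          that(2)])
    have "q \<cdot> inv\<^sub>G q' \<in> Q" using that subgroup.m_closed[OF Q(1)] subgroup.m_inv_closed[OF Q(1)]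
        by blast
    moreover have "sec (q \<cdot> inv\<^sub>G q') x = sec q x \<cdot> inv\<^sub>G (sec q' x)" if "x \<in> X" for x
      using c that by (simp add: sec_mult sec_inv)
    ultimately have "sec q \<one> \<cdot> inv\<^sub>G (sec q' \<one>) = \<one>\<^sub>G"
      using imp[of "q \<cdot> inv\<^sub>G q'"] y that c by simp
    then show ?thesis using c by (metis G.inv_closed G.inv_equality G.inv_inv one_closed sec_closed)
  qed
  \<comment> \<open>Sends \<open>sec q y\<close> to \<open>sec q \<one>\<close> for \<open>q\<close>
    in \<open>Q\<close>: well defined by \<open>det\<close>, defined on all of \<open>G\<close> by
    \<open>lift\<close>, and an endomorphism.\<close>
  define \<beta> where "\<beta> g = sec (SOME q. q \<in> Q \<and> sec q y = g) \<one>" for g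
  have \<beta>: "\<beta> (sec q y) = sec q \<one>" if "q \<in> Q" for q
  proof -
    have "(SOME q'. q' \<in> Q \<and> sec q' y = sec q y) \<in> Q \<and> sec (SOME q'. q' \<in> Q \<and> sec q' y = sec q y)
        y = sec q y"
      by (rule someI[of _ q]) (use that in simp)
    then show ?thesis unfolding \<beta>_def using det that by blast
  qed
  have \<beta>c: "\<beta> g \<in> carrier G" if "g \<in> carrier G" for g
    using lift[OF that] \<beta> Q(2) P_closed by (metis one_closed sec_closed subsetD)
  have \<beta>m: "\<beta> (a \<cdot> inv\<^sub>G b) = \<beta> a \<cdot> inv\<^sub>G (\<beta> b)" if ab: "a \<in> carrier G" "b \<in> carrier G" for a b
  proof -
    obtain q q' where q: "q \<in> Q" "sec q y = a" "q' \<in> Q" "sec q' y = b"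
        using lift[OF ab(1)] lift[OF ab(2)] by blast
    have c: "q \<in> carrier G" "q' \<in> carrier G" "root q = \<one>" "root q' = \<one>" 
      by (rule Qd(3)[OF q(1)], rule Qd(3)[OF q(3)], rule Qd(4)[OF q(1)], rule Qd(4)[OF q(3)])
    have "q \<cdot> inv\<^sub>G q' \<in> Q" using q subgroup.m_closed[OF Q(1)] subgroup.m_inv_closed[OF Q(1)]
        by blast
    from \<beta>[OF this] show ?thesis using \<beta>[OF q(1)] \<beta>[OF q(3)] q c y by (simp add: sec_mult sec_inv)
  qed
  have \<beta>1: "\<beta> \<one>\<^sub>G = \<one>\<^sub>G"
    using \<beta>m[OF G.one_closed G.one_closed] G.r_inv[OF \<beta>c[OF G.one_closed]] by simp
  have \<beta>i: "\<beta> (inv\<^sub>G b) = inv\<^sub>G (\<beta> b)" if "b \<in> carrier G" for b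
    using \<beta>m[OF G.one_closed that] \<beta>1 \<beta>c[OF that] that by simp
  have \<beta>mult: "\<beta> (a \<cdot> b) = \<beta> a \<cdot> \<beta> b" if "a \<in> carrier G" "b \<in> carrier G" for a b
    using \<beta>m[OF that(1) G.inv_closed[OF that(2)]] \<beta>i[OF that(2)] \<beta>c[OF that(2)] that by simp
  \<comment> \<open>The preimage of a level stabiliser under \<open>\<beta>\<close>. The level
    \<open>n\<close> was chosen so that \<open>St n\<close> misses \<open>l\<close>.\<close>
  define K where "K = {g \<in> carrier G. \<beta> g \<in> St n}"
  have K: "fin_index G K"
  proof (rule G.fin_indexI[where F = "\<lambda>g. St n #>\<^bsub>G\<^esub> \<beta> g"])
    show "subgroup K G"
    proof
      show "K \<subseteq> carrier G" unfolding K_def by blast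
      show "\<one>\<^sub>G \<in> K" unfolding K_def using \<beta>1 St.one_closed by simp
      show "a \<cdot> b \<in> K" if "a \<in> K" "b \<in> K" for a b
        using that \<beta>mult unfolding K_def by simp
      show "inv\<^sub>G a \<in> K" if "a \<in> K" for a
        using that \<beta>i unfolding K_def by simp
    qed
    have "(\<lambda>g. St n #>\<^bsub>G\<^esub> \<beta> g) ` carrier G \<subseteq> (\<lambda>a. St n #>\<^bsub>G\<^esub> a) ` carrier G"
      using \<beta>c by blast
    then show "finite ((\<lambda>g. St n #>\<^bsub>G\<^esub> \<beta> g) ` carrier G)"
      using G.fin_index_cosets[OF fin_index_St] finite_subset by blast
    fix a b assume ab: "a \<in> carrier G" "b \<in> carrier G" "St n #>\<^bsub>G\<^esub> \<beta> a = St n #>\<^bsub>G\<^esub> \<beta> b"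
    then have "\<beta> a \<cdot> inv\<^sub>G (\<beta> b) \<in> St n"
      using G.rcoset_eq_iff[OF subgroup_St] \<beta>c by blast
    then show "a \<cdot> inv\<^sub>G b \<in> K" using ab \<beta>m unfolding K_def by simp
  qed
  have sK: "subgroup K G" using K by (simp add: fin_index_def)
  \<comment> \<open>Density replaces \<open>p\<close> by some \<open>q\<close> in \<open>M\<close>
    up to an error \<open>h\<close> that is small at both letters. As \<open>p\<close> vanishes at
    \<open>y\<close>, \<open>q\<close> has a section in \<open>K\<close> there, so its section at
    \<open>\<one>\<close> is in \<open>St n\<close>, and then so is \<open>l\<close>.\<close>
  have "fin_index G ({h \<in> P. sec h \<one> \<in> St n} \<inter> {h \<in> P. sec h y \<in> K})"
    by (intro G.fin_index_inter fin_index_section fin_index_St K y one_closed)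
  from dense[OF this p(1)] obtain q h
    where qh: "q \<in> M" "h \<in> P" "sec h \<one> \<in> St n" "sec h y \<in> K" "p = q \<cdot> h" by auto
  have hc: "h \<in> carrier G" "root h = \<one>" using qh P_closed P_root by auto
  have "q = p \<cdot> inv\<^sub>G h" using qh hc by simp
  then have "q \<in> P" using P.m_closed[OF pP P.m_inv_closed[OF qh(2)]] by simp
  then have qQ: "q \<in> Q" and qc: "q \<in> carrier G" "root q = \<one>"
    using qh(1) P_closed P_root unfolding Q_def by simp_all
  have "sec q y \<cdot> sec h y = \<one>\<^sub>G"
    using p(2) y sec_mult[OF qc(1) hc(1) y(1)] hc(2) unfolding off_def qh(5)[symmetric] by simp
  then have "sec q y = inv\<^sub>G (sec h y)" using qc hc y by (metis G.inv_equality sec_closed)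
  then have "sec q y \<in> K" using subgroup.m_inv_closed[OF sK qh(4)] by metis
  then have "sec q \<one> \<in> St n" using \<beta>[OF qQ] by (simp add: K_def)
  moreover have "l = sec q \<one> \<cdot> sec h \<one>"
    using sec_mult[OF qc(1) hc(1) one_closed] hc(2) p(3) unfolding qh(5)[symmetric] by simp
  ultimately show False using St.m_closed[OF _ qh(3)] n by metis
qed

end

section \<open>Length and characters\<close>

context constant_spinal
begin

lemma subgroup_D_G: "subgroup D G"
proof
  interpret D: subgroup D A by (rule subgroup_D)
  show "D \<subseteq> carrier G" by auto
  show "\<one>\<^sub>G \<in> D" by (simp only: one_G D.one_closed)
  show "a \<cdot> b \<in> D" if "a \<in> D" "b \<in> D" for a b using that by (simp only: mult_G D.m_closed)
  show "inv\<^sub>G a \<in> D" if "a \<in> D" for a using that by (simp only: inv_G D_closed D.m_inv_closed)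
qed

interpretation DG: subgroup D G by (rule subgroup_D_G)

text \<open>\<open>W B \<phi> n a g\<close>: the element \<open>g\<close> is a product of \<open>n\<close> conjugates of elements of \<open>D\<close> by
  rooted automorphisms and of a rooted automorphism, and \<open>a\<close> is the product of the values
  of \<open>\<phi>\<close> at these elements of \<open>D\<close>.\<close>

inductive W :: "('c, 'd) monoid_scheme \<Rightarrow> (('a list \<Rightarrow> 'a list) \<Rightarrow> 'c) \<Rightarrow> nat \<Rightarrow> 'c \<Rightarrow> ('a list \<Rightarrow> 'a
    list) \<Rightarrow> bool"
  for B :: "('c, 'd) monoid_scheme" and \<phi> :: "('a list \<Rightarrow> 'a list) \<Rightarrow> 'c" where
  W_rooted: "r \<in> X \<Longrightarrow> W B \<phi> 0 \<one>\<^bsub>B\<^esub> (rt r)"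
| W_cj: "W B \<phi> n a g \<Longrightarrow> s \<in> X \<Longrightarrow> d \<in> D \<Longrightarrow> W B \<phi> (Suc n) (\<phi> d \<otimes>\<^bsub>B\<^esub> a) (cj s d \<cdot> g)"

text \<open>The homomorphism from \<open>G\<close> to \<open>B\<close> that extends
  \<open>\<phi>\<close> and kills the rooted automorphisms. For commutative \<open>B\<close> and a
  homomorphism \<open>\<phi>\<close>, uniqueness of the value comes down to
  \<open>W_one\<close>.\<close>

definition Phi :: "('c, 'd) monoid_scheme \<Rightarrow> (('a list \<Rightarrow> 'a list) \<Rightarrow> 'c) \<Rightarrow> ('a list \<Rightarrow> 'a list) \<Rightarrow> 'c"
    where
  "Phi B \<phi> g = (THE a. \<exists>n. W B \<phi> n a g)"

text \<open>The stabilised section at a letter: as \<open>R\<close> acts regularly on the letters, every orbit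
  of \<open>g\<close> on letters has length \<open>ord (root g)\<close>.\<close>

definition st :: "('a list \<Rightarrow> 'a list) \<Rightarrow> 'a \<Rightarrow> 'a list \<Rightarrow> 'a list" where
  "st g x = sec (g [^]\<^bsub>G\<^esub> ord (root g)) x"

text \<open>The stabilised section computed letter by letter; \<open>stabilised_section_eq\<close>
  identifies it with the given definition.\<close>

primrec ssec :: "('a list \<Rightarrow> 'a list) \<Rightarrow> 'a list \<Rightarrow> 'a list \<Rightarrow> 'a list" where
  "ssec g [] = g"
| "ssec g (x # v) = ssec (st g x) v"

lemma ord_root_pos: "g \<in> carrier G \<Longrightarrow> 0 < ord (root g)"
  using ord_ge_1[OF finite_R, of "root g"] by simp

lemma root_pow_ord: "g \<in> carrier G \<Longrightarrow> root (g [^]\<^bsub>G\<^esub> ord (root g)) = \<one>"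
  by simp

lemma st_closed [simp]: "g \<in> carrier G \<Longrightarrow> x \<in> X \<Longrightarrow> st g x \<in> carrier G"
  by (simp add: st_def)

lemma inj_orbit:
  assumes "g \<in> carrier G" "x \<in> X"
  shows "inj_on (\<lambda>i. root g [^] i \<otimes> x) {..<ord (root g)}"
proof
  fix i j assume ij: "i \<in> {..<ord (root g)}" "j \<in> {..<ord (root g)}" "root g [^] i \<otimes> x = root g
      [^] j \<otimes> x"
  then have "root g [^] i = root g [^] j" using assms by simp
  moreover have "inj_on (\<lambda>i. root g [^] i) {0 .. ord (root g) - 1}"
    using ord_inj finite_R assms by simp
  ultimately show "i = j" using ij by (auto simp: inj_on_def)
qed

lemma pow_section_mult:
  assumes "g \<in> carrier G" "x \<in> X"
  shows "sec (g [^]\<^bsub>G\<^esub> Suc k) x = sec g (root g [^] k \<otimes> x) \<cdot> sec (g [^]\<^bsub>G\<^esub> k) x"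
proof -
  have "g [^]\<^bsub>G\<^esub> Suc k = g \<cdot> g [^]\<^bsub>G\<^esub> k" using assms by (metis G.nat_pow_Suc2)
  then show ?thesis using assms by (simp add: sec_mult)
qed

lemma sec_pow_fixed:
  assumes "g \<in> carrier G" "root g = \<one>" "x \<in> X"
  shows "sec (g [^]\<^bsub>G\<^esub> (k::nat)) x = sec g x [^]\<^bsub>G\<^esub> k"
  by (induction k) (use assms in \<open>auto simp: sec_mult\<close>)

section \<open>Extension of a character of \<open>D\<close> to the whole group\<close>

context
  fixes B :: "('c, 'd) monoid_scheme" and \<phi> :: "('a list \<Rightarrow> 'a list) \<Rightarrow> 'c"
  assumes B: "comm_group B" and \<phi>: "\<phi> \<in> hom (directed_group R D) B"
begin

interpretation B: comm_group B by (rule B)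

lemma char_closed: "d \<in> D \<Longrightarrow> \<phi> d \<in> carrier B"
  using \<phi> by (auto simp: hom_def directed_group_def)

lemma char_mult: "d \<in> D \<Longrightarrow> e \<in> D \<Longrightarrow> \<phi> (d \<cdot> e) = \<phi> d \<otimes>\<^bsub>B\<^esub> \<phi> e"
  using \<phi> by (auto simp: hom_def directed_group_def mult_G)

lemma char_one: "\<phi> \<one>\<^sub>G = \<one>\<^bsub>B\<^esub>"
  using char_mult[of "\<one>\<^sub>G" "\<one>\<^sub>G"] char_closed[of "\<one>\<^sub>G"] by (simp add: DG.one_closed)

lemma char_inv: "d \<in> D \<Longrightarrow> \<phi> (inv\<^sub>G d) = inv\<^bsub>B\<^esub> (\<phi> d)"
  using char_mult[of "inv\<^sub>G d" d] char_one char_closed by (simp add: B.inv_equality)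

lemma W_closed: "W B \<phi> n a g \<Longrightarrow> a \<in> carrier B \<and> g \<in> carrier G"
  by (induction rule: W.induct) (auto simp: char_closed)

lemma W_rooted_mult: "W B \<phi> n a g \<Longrightarrow> r \<in> X \<Longrightarrow> W B \<phi> n a (rt r \<cdot> g)"
proof (induction rule: W.induct)
  case (W_rooted s)
  then show ?case using W.W_rooted[of "r \<otimes> s" B \<phi>] by (simp add: rooted_mult)
next
  case (W_cj n a g s d)
  have g: "g \<in> carrier G" using W_closed W_cj by blast
  have "rt r \<cdot> (cj s d \<cdot> g) = cj (r \<otimes> s) d \<cdot> (rt r \<cdot> g)"
    using W_cj g by (simp add: cj_def rooted_mult G.inv_mult_group G.m_assoc)
  then show ?case using W.W_cj[OF W_cj.IH, of "r \<otimes> s" d] W_cj by simp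
qed

lemma W_mult: "W B \<phi> n a g \<Longrightarrow> W B \<phi> m b h \<Longrightarrow> W B \<phi> (n + m) (a \<otimes>\<^bsub>B\<^esub> b) (g \<cdot> h)"
proof (induction rule: W.induct)
  case (W_rooted s)
  then show ?case using W_rooted_mult W_closed by simp
next
  case (W_cj n a g s d)
  have c: "g \<in> carrier G" "h \<in> carrier G" "a \<in> carrier B" "b \<in> carrier B"
    using W_closed W_cj by blast+
  then show ?case using W.W_cj[OF W_cj.IH[OF W_cj.prems], of s d] W_cj char_closed
    by (simp add: G.m_assoc B.m_assoc)
qed

lemma W_directed: "d \<in> D \<Longrightarrow> s \<in> X \<Longrightarrow> W B \<phi> (Suc 0) (\<phi> d) (cj s d)"
  using W.W_cj[OF W.W_rooted[OF one_closed], of s d B \<phi>] char_closed by simp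

lemma W_inv: "W B \<phi> n a g \<Longrightarrow> W B \<phi> n (inv\<^bsub>B\<^esub> a) (inv\<^sub>G g)"
proof (induction rule: W.induct)
  case (W_rooted s)
  then show ?case using W.W_rooted[of "inv s" B \<phi>] by (simp add: rooted_inv)
next
  case (W_cj n a g s d)
  have c: "g \<in> carrier G" "a \<in> carrier B" using W_closed W_cj by blast+
  have i: "inv\<^sub>G (cj s d) = cj s (inv\<^sub>G d)" using W_cj
      by (simp add: cj_def G.inv_mult_group G.m_assoc)
  have "W B \<phi> (n + Suc 0) (inv\<^bsub>B\<^esub> a \<otimes>\<^bsub>B\<^esub> \<phi> (inv\<^sub>G d)) (inv\<^sub>G g \<cdot> cj s (inv\<^sub>G d))"
    using W_mult[OF W_cj.IH W_directed] W_cj DG.m_inv_closed by blast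
  then show ?case using W_cj c i char_closed
      by (simp add: G.inv_mult_group B.inv_mult_group char_inv)
qed

lemma W_ex: "g \<in> carrier G \<Longrightarrow> \<exists>n a. W B \<phi> n a g"
proof -
  assume "g \<in> carrier G"
  then have "g \<in> generate G gens" using gens(3) by simp
  then show ?thesis
  proof (induction g rule: generate.induct)
    case one then show ?case using W_rooted[of \<one>] by auto
  next
    case (incl h)
    then show ?case
    proof
      assume "h \<in> rt ` X" then show ?thesis using W_rooted by blast
    next
      assume "h \<in> D" then show ?thesis using W_directed[of h \<one>] by auto
    qed
  next
    case (inv h)
    then show ?case
    proof
      assume "h \<in> rt ` X" then show ?thesis using W_rooted W_inv by blast
    next
      assume "h \<in> D" then show ?thesis using W_inv[OF W_directed[of h \<one>]] by auto
    qed
  next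
    case (eng h k) then show ?case using W_mult by blast
  qed
qed

text \<open>The letters of a word for \<open>g\<close> are distributed over the sections of \<open>g\<close>; all of them go
  to the same section only if \<open>g\<close> is a conjugate of an element of \<open>D\<close> times a rooted element.\<close>

lemma W_sections:
  assumes "W B \<phi> n a g"
  shows "\<exists>\<nu> \<alpha>. (\<forall>x\<in>X. W B \<phi> (\<nu> x) (\<alpha> x) (sec g x)) \<and> (\<Sum>x\<in>X. \<nu> x) = n \<and>
    finprod B \<alpha> X = a \<and>
    (\<forall>x\<in>X. \<nu> x < n \<or> (\<exists>d\<in>D. \<exists>r\<in>X. g = cj (root g \<otimes> x) d \<cdot> rt r \<and> a = \<phi> d))"
  using assms
proof (induction rule: W.induct)
  case (W_rooted r)
  have "W B \<phi> 0 \<one>\<^bsub>B\<^esub> (sec (rt r) x)" if "x \<in> X" for x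
    using W.W_rooted[OF one_closed, of B \<phi>] that W_rooted by (simp add: sec_rooted)
  \<comment> \<open>With \<open>n = 0\<close> no section can be shorter; the second alternative
    holds with the identity as the element of \<open>D\<close>.\<close>
  moreover have "rt r = cj (root (rt r) \<otimes> x) \<one>\<^sub>G \<cdot> rt r" if "x \<in> X" for x
    using that W_rooted by (simp add: cj_def)
  ultimately show ?case
    using W_rooted char_one DG.one_closed
    by (intro exI[of _ "\<lambda>_. 0"] exI[of _ "\<lambda>_. \<one>\<^bsub>B\<^esub>"] conjI ballI disjI2) (auto intro!: bexI[of _
        "\<one>\<^sub>G"] bexI[of _ r])
next
  case (W_cj n a g s d)
  then obtain \<nu> \<alpha> where w: "\<And>x. x \<in> X \<Longrightarrow> W B \<phi> (\<nu> x) (\<alpha> x) (sec g x)"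
    and \<nu>: "(\<Sum>x\<in>X. \<nu> x) = n" and \<alpha>: "finprod B \<alpha> X = a"
    and c: "\<And>x. x \<in> X \<Longrightarrow> \<nu> x < n \<or> (\<exists>d\<in>D. \<exists>r\<in>X. g = cj (root g \<otimes> x) d \<cdot> rt r \<and> a = \<phi> d)"
    by blast
  have g: "g \<in> carrier G" "a \<in> carrier B" using W_closed W_cj by blast+
  \<comment> \<open>The only letter that \<open>g\<close> sends to \<open>s\<close>: there the new
    factor contributes \<open>d\<close> itself, at all other letters merely an element of
    \<open>R\<close>.\<close>
  define y where "y = inv (root g) \<otimes> s"
  have y: "y \<in> X" "root g \<otimes> y = s" using g W_cj by (auto simp: y_def)
  have ne: "inv s \<otimes> (root g \<otimes> x) \<noteq> \<one>" if "x \<in> X" "x \<noteq> y" for x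
  proof
    assume "inv s \<otimes> (root g \<otimes> x) = \<one>"
    then have "s \<otimes> (inv s \<otimes> (root g \<otimes> x)) = s" using W_cj by simp
    then have "root g \<otimes> x = s" using that g W_cj by simp
    then show False using that g by (auto simp: y_def)
  qed
  define g' where "g' = cj s d \<cdot> g"
  have rg: "root g' = root g" using g W_cj by (simp add: g'_def)
  have sg: "sec g' x = sec d (inv s \<otimes> (root g \<otimes> x)) \<cdot> sec g x" if "x \<in> X" for x
    using g W_cj that by (simp add: g'_def sec_mult)
  define \<nu>' where "\<nu>' x = \<nu> x + (if x = y then 1 else 0)" for x
  define \<alpha>' where "\<alpha>' x = (if x = y then \<phi> d else \<one>\<^bsub>B\<^esub>) \<otimes>\<^bsub>B\<^esub> \<alpha> x" for x
  have \<alpha>c: "\<alpha> x \<in> carrier B" if "x \<in> X" for x using w[OF that] W_closed by blast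
  have "W B \<phi> (\<nu>' x) (\<alpha>' x) (sec g' x)" if x: "x \<in> X" for x
  proof (cases "x = y")
    case True
    have "sec g' x = cj \<one> d \<cdot> sec g x" using sg[OF x] y True W_cj by simp
    then show ?thesis using W.W_cj[OF w[OF x] one_closed W_cj.hyps(3)] True
        by (simp add: \<nu>'_def \<alpha>'_def)
  next
    case False
    have z: "inv s \<otimes> (root g \<otimes> x) \<in> X" using x g W_cj by simp
    have "sec g' x = rt (ls d (inv s \<otimes> (root g \<otimes> x))) \<cdot> sec g x"
      using sg[OF x] letter_section(2)[OF W_cj.hyps(3) z ne[OF x False]] by simp
    then show ?thesis
      using W_rooted_mult[OF w[OF x] letter_section(1)[OF W_cj.hyps(3) z ne[OF x False]]] False
          \<alpha>c[OF x]
      by (simp add: \<nu>'_def \<alpha>'_def)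
  qed
  moreover have "(\<Sum>x\<in>X. \<nu>' x) = Suc n"
    using \<nu> y finite_R by (simp add: \<nu>'_def sum.distrib)
  moreover have "finprod B \<alpha>' X = \<phi> d \<otimes>\<^bsub>B\<^esub> a"
  proof -
    have "finprod B \<alpha>' X = finprod B (\<lambda>x. if x = y then \<phi> d else \<one>\<^bsub>B\<^esub>) X \<otimes>\<^bsub>B\<^esub> finprod B \<alpha> X"
      unfolding \<alpha>'_def using char_closed W_cj \<alpha>c by (intro B.finprod_multf) auto
    also have "finprod B (\<lambda>x. if x = y then \<phi> d else \<one>\<^bsub>B\<^esub>) X = \<phi> d"
      using B.finprod_singleton_swap[OF y(1) finite_R, of "\<lambda>_. \<phi> d"] char_closed W_cj by simp
    finally show ?thesis using \<alpha> by simp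
  qed
  moreover have "\<nu>' x < Suc n \<or> (\<exists>e\<in>D. \<exists>r\<in>X. g' = cj (root g' \<otimes> x) e \<cdot> rt r \<and> \<phi> d \<otimes>\<^bsub>B\<^esub> a = \<phi> e)"
    if x: "x \<in> X" for x
  proof (cases "x = y \<and> \<not> \<nu> x < n")
    case False
    have "\<nu> x \<le> n" using member_le_sum[of x "X" \<nu>] x finite_R \<nu> by simp
    then show ?thesis using False by (auto simp: \<nu>'_def)
  next
    case True
    \<comment> \<open>All earlier letters have gone into the section at \<open>y\<close> too. So
      \<open>g\<close> is a conjugate of \<open>e\<close> by the same \<open>s\<close>, up to a
      rooted factor, and the new letter merges with \<open>e\<close> into one element of
      \<open>D\<close>.\<close>
    then obtain e r where e: "e \<in> D" "r \<in> X" "g = cj s e \<cdot> rt r" "a = \<phi> e" using c[OF x] y by blast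
    have dc: "d \<in> carrier G" "e \<in> carrier G" using e(1) W_cj.hyps(3) by simp_all
    have "g' = cj s (d \<cdot> e) \<cdot> rt r"
      unfolding g'_def e(3) cj_def using dc e(2) W_cj.hyps(2) by (simp add: G.m_assoc)
    moreover have "root g' \<otimes> x = s" using rg True y(2) by simp
    moreover have "d \<cdot> e \<in> D" using DG.m_closed[OF W_cj.hyps(3) e(1)] .
    moreover have "\<phi> d \<otimes>\<^bsub>B\<^esub> a = \<phi> (d \<cdot> e)" using char_mult[OF W_cj.hyps(3) e(1)] e(4) by simp
    ultimately show ?thesis using e(2) by metis
  qed
  ultimately show ?case unfolding g'_def by blast
qed

text \<open>Induction on the word length. If all sections have shorter words, the value is the
  product of theirs; otherwise the word collapses to \<open>cj x d \<cdot> rt r\<close>, which is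
  trivial only for \<open>r = \<one>\<close> and trivial \<open>d\<close>.\<close>

lemma W_one: "W B \<phi> n a \<one>\<^sub>G \<Longrightarrow> a = \<one>\<^bsub>B\<^esub>"
proof (induction n arbitrary: a rule: less_induct)
  case (less n)
  obtain \<nu> \<alpha> where w: "\<And>x. x \<in> X \<Longrightarrow> W B \<phi> (\<nu> x) (\<alpha> x) (sec \<one>\<^sub>G x)"
    and \<alpha>: "finprod B \<alpha> X = a"
    and c: "\<And>x. x \<in> X \<Longrightarrow> \<nu> x < n \<or>
      (\<exists>d\<in>D. \<exists>r\<in>X. \<one>\<^sub>G = cj (root \<one>\<^sub>G \<otimes> x) d \<cdot> rt r \<and> a = \<phi> d)"
    using W_sections[OF less.prems] by blast
  show ?case
  proof (cases "\<forall>x\<in>X. \<nu> x < n")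
    case True
    have "\<alpha> x = \<one>\<^bsub>B\<^esub>" if "x \<in> X" for x using less.IH True w that by (metis sec_one)
    then have "finprod B \<alpha> X = finprod B (\<lambda>_. \<one>\<^bsub>B\<^esub>) X"
      by (intro B.finprod_cong') auto
    then show ?thesis using \<alpha> by simp
  next
    case False
    then obtain x where xR: "x \<in> X" "\<not> \<nu> x < n" by blast
    then obtain d r where "d \<in> D" "r \<in> X" "a = \<phi> d"
      "\<one>\<^sub>G = cj (root \<one>\<^sub>G \<otimes> x) d \<cdot> rt r" using c[of x] by blast
    then have x: "x \<in> X" "d \<in> D" "r \<in> X" "a = \<phi> d"
      and eq: "\<one>\<^sub>G = cj x d \<cdot> rt r" using xR by simp_all
    have "root (cj x d \<cdot> rt r) = r" using x by simp
    then have "r = root \<one>\<^sub>G" unfolding eq by (rule sym)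
    then have "r = \<one>" by simp
    then have "cj x d = \<one>\<^sub>G" using eq x by simp
    moreover have "sec (cj x d) x = d" using x by simp
    ultimately have "d = \<one>\<^sub>G" using x by simp
    then show ?thesis using x char_one by simp
  qed
qed

lemma Phi_eq: "W B \<phi> n a g \<Longrightarrow> Phi B \<phi> g = a"
  unfolding Phi_def
proof (rule the_equality)
  assume w: "W B \<phi> n a g"
  then show "\<exists>n. W B \<phi> n a g" by blast
  fix b assume "\<exists>n. W B \<phi> n b g"
  then obtain m where w': "W B \<phi> m b g" by blast
  have c: "a \<in> carrier B" "b \<in> carrier B" "g \<in> carrier G" using W_closed w w' by blast+
  have "W B \<phi> (m + n) (b \<otimes>\<^bsub>B\<^esub> inv\<^bsub>B\<^esub> a) \<one>\<^sub>G" using W_mult[OF w' W_inv[OF w]] c by simp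
  then have "b \<otimes>\<^bsub>B\<^esub> inv\<^bsub>B\<^esub> a = \<one>\<^bsub>B\<^esub>" by (rule W_one)
  then show "b = a" using c by (metis B.inv_closed B.inv_equality B.inv_inv)
qed

lemma Phi_closed: "g \<in> carrier G \<Longrightarrow> Phi B \<phi> g \<in> carrier B"
  using W_ex Phi_eq W_closed by metis

lemma Phi_mult: "g \<in> carrier G \<Longrightarrow> h \<in> carrier G \<Longrightarrow> Phi B \<phi> (g \<cdot> h) = Phi B \<phi> g \<otimes>\<^bsub>B\<^esub> Phi B \<phi> h"
  using W_ex Phi_eq W_mult by metis

lemma Phi_D: "d \<in> D \<Longrightarrow> Phi B \<phi> d = \<phi> d"
  using Phi_eq[OF W_directed[of d \<one>]] by simp

lemma Phi_sections: "g \<in> carrier G \<Longrightarrow> Phi B \<phi> g = finprod B (\<lambda>x. Phi B \<phi> (sec g x)) X"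
proof -
  assume "g \<in> carrier G"
  then obtain n a where w: "W B \<phi> n a g" using W_ex by blast
  then obtain \<nu> \<alpha> where *: "\<And>x. x \<in> X \<Longrightarrow> W B \<phi> (\<nu> x) (\<alpha> x) (sec g x)"
    and \<alpha>: "finprod B \<alpha> X = a" using W_sections by blast
  have "finprod B (\<lambda>x. Phi B \<phi> (sec g x)) X = finprod B \<alpha> X"
    using Phi_eq[OF *] W_closed[OF *] by (intro B.finprod_cong') auto
  then show ?thesis using \<alpha> Phi_eq[OF w] by simp
qed

lemma Phi_one: "Phi B \<phi> \<one>\<^sub>G = \<one>\<^bsub>B\<^esub>"
  using Phi_D[OF DG.one_closed] char_one by simp

lemma Phi_pow_section:
  assumes "g \<in> carrier G" "x \<in> X"
  shows "Phi B \<phi> (sec (g [^]\<^bsub>G\<^esub> (k::nat)) x) = finprod B (\<lambda>i. Phi B \<phi> (sec g (root g [^] i \<otimes> x)))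
      {..<k}"
proof (induction k)
  case 0
  then show ?case using assms Phi_one by simp
next
  case (Suc k)
  have "Phi B \<phi> (sec (g [^]\<^bsub>G\<^esub> Suc k) x) = Phi B \<phi> (sec g (root g [^] k \<otimes> x)) \<otimes>\<^bsub>B\<^esub> Phi B \<phi> (sec (g
      [^]\<^bsub>G\<^esub> k) x)"
    unfolding pow_section_mult[OF assms] using assms by (intro Phi_mult) auto
  also have "\<dots> = finprod B (\<lambda>i. Phi B \<phi> (sec g (root g [^] i \<otimes> x))) (insert k {..<k})"
    using assms Phi_closed Suc by (subst B.finprod_insert) auto
  also have "insert k {..<k} = {..<Suc k}" by auto
  finally show ?case .
qed

text \<open>The product of \<open>Phi\<close> over all sections splits along the orbits of
  \<open>root g\<close> on the letters, and the part belonging to one orbit is \<open>Phi\<close> of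
  the stabilised section at any of its points.\<close>

lemma Phi_stabilised:
  assumes g: "g \<in> carrier G" and ne: "Phi B \<phi> g \<noteq> \<one>\<^bsub>B\<^esub>"
  shows "\<exists>x\<in>X. Phi B \<phi> (st g x) \<noteq> \<one>\<^bsub>B\<^esub>"
proof (rule ccontr)
  assume "\<not> ?thesis"
  then have triv: "\<And>x. x \<in> X \<Longrightarrow> Phi B \<phi> (st g x) = \<one>\<^bsub>B\<^esub>" by blast
  let ?r = "root g" and ?o = "ord (root g)"
  have r: "?r \<in> X" using g by simp
  \<comment> \<open>Induction over unions of orbits, with one orbit removed at a time.\<close>
  have "finprod B (\<lambda>x. Phi B \<phi> (sec g x)) Y = \<one>\<^bsub>B\<^esub>"
    if "Y \<subseteq> X" "\<forall>y\<in>Y. ?r \<otimes> y \<in> Y" for Y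
    using that
  proof (induction "card Y" arbitrary: Y rule: less_induct)
    case less
    have finY: "finite Y" using less.prems finite_R finite_subset by blast
    show ?case
    proof (cases "Y = {}")
      case True then show ?thesis by simp
    next
      case False
      then obtain x where x: "x \<in> Y" "x \<in> X" using less.prems by blast
      define Orb where "Orb = (\<lambda>i. ?r [^] i \<otimes> x) ` {..<?o}"
      have inY: "?r [^] i \<otimes> x \<in> Y" for i :: nat
      proof (induction i)
        case (Suc i)
        have "?r [^] Suc i \<otimes> x = ?r \<otimes> (?r [^] i \<otimes> x)"
          using r x by (simp add: m_assoc[symmetric] nat_pow_Suc2[symmetric])
        then show ?case using Suc less.prems by simp
      qed (use x in simp)
      have Orb: "Orb \<subseteq> Y" "x \<in> Orb" "finite Orb"
        using inY ord_root_pos[OF g] x unfolding Orb_def by (auto intro!: image_eqI[of _ _ 0])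
      \<comment> \<open>Backward invariance of the orbit, which is what makes its complement in
        \<open>Y\<close> invariant again.\<close>
      have bwd: "y \<in> Orb" if "y \<in> X" "?r \<otimes> y \<in> Orb" for y
      proof -
        obtain i where i: "i < ?o" "?r \<otimes> y = ?r [^] i \<otimes> x" using \<open>?r \<otimes> y \<in> Orb\<close>
            by (auto simp: Orb_def)
        have "\<exists>j<?o. ?r [^] i = ?r \<otimes> ?r [^] j"
        proof (cases i)
          case 0
          have "?r \<otimes> ?r [^] (?o - 1) = ?r [^] ?o"
            using ord_root_pos[OF g] r by (metis Suc_diff_1 nat_pow_Suc2)
          then show ?thesis using 0 ord_root_pos[OF g] r by (intro exI[of _ "?o - 1"]) simp
        next
          case (Suc j)
          then show ?thesis using i r by (intro exI[of _ j]) (metis Suc_lessD nat_pow_Suc2)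
        qed
        then obtain j where j: "j < ?o" "?r [^] i = ?r \<otimes> ?r [^] j" by blast
        have "?r \<otimes> y = ?r \<otimes> (?r [^] j \<otimes> x)" using i j r x by (simp add: m_assoc)
        then have "y = ?r [^] j \<otimes> x" using that r x by simp
        then show ?thesis using j by (auto simp: Orb_def)
      qed
      have "finprod B (\<lambda>x. Phi B \<phi> (sec g x)) Orb = finprod B (\<lambda>i. Phi B \<phi> (sec g (?r [^] i \<otimes> x)))
          {..<?o}"
        unfolding Orb_def using inj_orbit[OF g x(2)] Phi_closed g x
            by (intro B.finprod_reindex) auto
      also have "\<dots> = Phi B \<phi> (st g x)" unfolding st_def using Phi_pow_section[OF g x(2)] by simp
      also have "\<dots> = \<one>\<^bsub>B\<^esub>" using triv x by blast
      finally have 1: "finprod B (\<lambda>x. Phi B \<phi> (sec g x)) Orb = \<one>\<^bsub>B\<^esub>" .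
      have "card (Y - Orb) < card Y" using Orb finY x by (intro psubset_card_mono) auto
      then have 2: "finprod B (\<lambda>x. Phi B \<phi> (sec g x)) (Y - Orb) = \<one>\<^bsub>B\<^esub>"
        using less.hyps[of "Y - Orb"] less.prems bwd by blast
      have "finprod B (\<lambda>x. Phi B \<phi> (sec g x)) (Orb \<union> (Y - Orb)) = \<one>\<^bsub>B\<^esub>"
        using Orb finY less.prems Phi_closed g 1 2 by (subst B.finprod_Un_disjoint) auto
      moreover have "Orb \<union> (Y - Orb) = Y" using Orb by blast
      ultimately show ?thesis by simp
    qed
  qed
  from this[of "X"] have "Phi B \<phi> g = \<one>\<^bsub>B\<^esub>" using Phi_sections[OF g] r by simp
  then show False using ne by simp
qed

lemma Phi_ssec:
  "g \<in> carrier G \<Longrightarrow> Phi B \<phi> g \<noteq> \<one>\<^bsub>B\<^esub> \<Longrightarrow> \<exists>v\<in>lists X. length v = n \<and> Phi B \<phi> (ssec g v) \<noteq> \<one>\<^bsub>B\<^esub>"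
proof (induction n arbitrary: g)
  case 0 then show ?case by (intro bexI[of _ "[]"]) auto
next
  case (Suc n)
  then obtain x where x: "x \<in> X" "Phi B \<phi> (st g x) \<noteq> \<one>\<^bsub>B\<^esub>" using Phi_stabilised by blast
  then obtain v where "v \<in> lists X" "length v = n" "Phi B \<phi> (ssec (st g x) v) \<noteq> \<one>\<^bsub>B\<^esub>"
    using Suc.IH[of "st g x"] Suc.prems by auto
  then show ?case using x by (intro bexI[of _ "x # v"]) auto
qed

lemma W_pow_section:
  assumes g: "g \<in> carrier G" and x: "x \<in> X"
    and w: "\<And>x. x \<in> X \<Longrightarrow> \<exists>a. W B \<phi> (\<nu> x) a (sec g x)"
  shows "\<exists>a. W B \<phi> (\<Sum>i<k. \<nu> (root g [^] i \<otimes> x)) a (sec (g [^]\<^bsub>G\<^esub> (k::nat)) x)"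
proof (induction k)
  case 0 then show ?case using W_rooted[OF one_closed, of B \<phi>] x by auto
next
  case (Suc k)
  then obtain a where a: "W B \<phi> (\<Sum>i<k. \<nu> (root g [^] i \<otimes> x)) a (sec (g [^]\<^bsub>G\<^esub> k) x)" by blast
  have "root g [^] k \<otimes> x \<in> X" using g x by simp
  then obtain b where b: "W B \<phi> (\<nu> (root g [^] k \<otimes> x)) b (sec g (root g [^] k \<otimes> x))" using w
      by blast
  show ?case unfolding pow_section_mult[OF g x] using W_mult[OF b a] by (auto simp: add.commute)
qed

text \<open>The points of an orbit are distinct letters, so the stabilised section collects every
  letter of the word at most once.\<close>

lemma W_st:
  assumes w: "W B \<phi> n a g" and x: "x \<in> X"
  shows "\<exists>k\<le>n. \<exists>b. W B \<phi> k b (st g x)"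
proof -
  have g: "g \<in> carrier G" using W_closed w by blast
  obtain \<nu> \<alpha> where *: "\<And>x. x \<in> X \<Longrightarrow> W B \<phi> (\<nu> x) (\<alpha> x) (sec g x)"
    and \<nu>: "(\<Sum>x\<in>X. \<nu> x) = n" using W_sections[OF w] by blast
  have "(\<Sum>i<ord (root g). \<nu> (root g [^] i \<otimes> x)) = sum \<nu> ((\<lambda>i. root g [^] i \<otimes> x) ` {..<ord (root
      g)})"
    using inj_orbit[OF g x] by (simp add: sum.reindex)
  also have "\<dots> \<le> sum \<nu> X"
    by (rule sum_mono2[OF finite_R]) (use g x in auto)
  finally show ?thesis using W_pow_section[OF g x, of \<nu> "ord (root g)"] * \<nu> unfolding st_def
      by blast
qed

lemma W_ssec: "W B \<phi> n a g \<Longrightarrow> v \<in> lists X \<Longrightarrow> \<exists>k\<le>n. \<exists>b. W B \<phi> k b (ssec g v)"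
proof (induction v arbitrary: g n a)
  case (Cons x v)
  then obtain k b where k: "k \<le> n" "W B \<phi> k b (st g x)" using W_st by (metis Cons_in_lists_iff)
  then show ?case using Cons.IH[OF k(2)] Cons.prems by (auto intro: order_trans)
qed auto

lemma finite_W: "finite {g. \<exists>k\<le>n. \<exists>a. W B \<phi> k a g}"
proof -
  have "finite {g. \<exists>a. W B \<phi> k a g}" for k
  proof (induction k)
    case 0
    have "{g. \<exists>a. W B \<phi> 0 a g} \<subseteq> rt ` X" by (auto elim: W.cases)
    then show ?case using finite_R finite_subset by blast
  next
    case (Suc k)
    have "{g. \<exists>a. W B \<phi> (Suc k) a g} \<subseteq> (\<lambda>(s, d, g). cj s d \<cdot> g) ` (X \<times> D \<times> {g. \<exists>a. W B \<phi> k a g})"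
    proof
      fix g assume "g \<in> {g. \<exists>a. W B \<phi> (Suc k) a g}"
      then obtain a where "W B \<phi> (Suc k) a g" by blast
      then show "g \<in> (\<lambda>(s, d, g). cj s d \<cdot> g) ` (X \<times> D \<times> {g. \<exists>a. W B \<phi> k a g})"
        by cases (auto intro!: image_eqI)
    qed
    then show ?case using Suc finite_R finite_D by (meson finite_SigmaI finite_imageI finite_subset)
  qed
  moreover have "{g. \<exists>k\<le>n. \<exists>a. W B \<phi> k a g} = (\<Union>k\<le>n. {g. \<exists>a. W B \<phi> k a g})" by blast
  ultimately show ?thesis by simp
qed

end

end

context constant_spinal
begin

subsection \<open>Stabilised sections\<close>

lemma pow_apply_Cons:
  assumes "g \<in> carrier G" "x \<in> X" "v \<in> lists X"
  shows "(g [^]\<^bsub>G\<^esub> (k::nat)) (x # v) = (root g [^] k \<otimes> x) # sec (g [^]\<^bsub>G\<^esub> k) x v"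
proof -
  have c: "g [^]\<^bsub>G\<^esub> k \<in> carrier G" using assms by simp
  show ?thesis
    using tree_aut_append[OF G_in_A[OF c], of "[x]" v] assms act_G[OF c assms(2)]
        by (simp add: sec_def)
qed

lemma pow_fixes_Cons_iff:
  assumes g: "g \<in> carrier G" and x: "x \<in> X" and v: "v \<in> lists X"
  shows "(g [^]\<^bsub>G\<^esub> (k::nat)) (x # v) = x # v \<longleftrightarrow>
    (\<exists>j. k = ord (root g) * j \<and> (st g x [^]\<^bsub>G\<^esub> j) v = v)"
proof -
  have r: "root g \<in> X" using g by simp
  have s: "sec (g [^]\<^bsub>G\<^esub> (ord (root g) * j)) x = st g x [^]\<^bsub>G\<^esub> j" for j
  proof -
    have "g [^]\<^bsub>G\<^esub> (ord (root g) * j) = (g [^]\<^bsub>G\<^esub> ord (root g)) [^]\<^bsub>G\<^esub> j" using g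
        by (simp add: G.nat_pow_pow)
    then show ?thesis
      unfolding st_def using sec_pow_fixed[OF G.nat_pow_closed[OF g] root_pow_ord[OF g] x] by simp
  qed
  have "(g [^]\<^bsub>G\<^esub> k) (x # v) = x # v \<longleftrightarrow> root g [^] k = \<one> \<and> sec (g [^]\<^bsub>G\<^esub> k) x v = v"
    unfolding pow_apply_Cons[OF assms] using r x by (auto simp: l_cancel_one)
  also have "\<dots> \<longleftrightarrow> ord (root g) dvd k \<and> sec (g [^]\<^bsub>G\<^esub> k) x v = v" using pow_eq_id[OF r] by simp
  finally show ?thesis using s by (auto simp: dvd_def)
qed

lemma pow_fixes_exists:
  "g \<in> carrier G \<Longrightarrow> v \<in> lists X \<Longrightarrow> \<exists>k\<ge>1. (g [^]\<^bsub>G\<^esub> (k::nat)) v = v"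
proof (induction v arbitrary: g)
  case Nil
  then have "g [] = []" using tree_aut_length[OF G_in_A, of g "[]"] by simp
  then show ?case using Nil by (intro exI[of _ 1]) simp
next
  case (Cons x v)
  then obtain j where j: "j \<ge> 1" "(st g x [^]\<^bsub>G\<^esub> (j::nat)) v = v"
      by (metis Cons_in_lists_iff st_closed)
  then have "(g [^]\<^bsub>G\<^esub> (ord (root g) * j)) (x # v) = x # v" using pow_fixes_Cons_iff Cons.prems
      by auto
  moreover have "1 \<le> ord (root g) * j" using j ord_root_pos[OF Cons.prems(1)] by simp
  ultimately show ?case by blast
qed

text \<open>First return times multiply along a word: the orbit length of the first letter times the
  return time of the remaining word under the stabilised section there.\<close>

lemma stabilised_section_eq:
  "g \<in> carrier G \<Longrightarrow> v \<in> lists X \<Longrightarrow> stabilised_section X g v = ssec g v"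
proof (induction v arbitrary: g)
  case Nil
  have "g [] = []" using tree_aut_length[OF G_in_A[OF Nil(1)], of "[]"] by simp
  then have "(LEAST k::nat. 1 \<le> k \<and> (g [^]\<^bsub>G\<^esub> k) [] = []) = 1"
    using Nil by (intro Least_equality) auto
  moreover have "tree_section X g [] = g"
    using tree_aut_memD(2)[OF G_in_A[OF Nil(1)]]
        by (auto simp: tree_section_def extensional_restrict)
  moreover have "g [^]\<^bsub>G\<^esub> (1::nat) = g" using Nil by simp
  ultimately show ?case unfolding stabilised_section_def pow_G[symmetric] by (simp only: ssec.simps)
next
  case (Cons x v)
  then have xv: "x \<in> X" "v \<in> lists X" by auto
  define j where "j = (LEAST j::nat. 1 \<le> j \<and> (st g x [^]\<^bsub>G\<^esub> j) v = v)"
  have k: "(LEAST k::nat. 1 \<le> k \<and> (g [^]\<^bsub>G\<^esub> k) (x # v) = x # v) = ord (root g) * j"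
    unfolding j_def
    by (rule Least_multiple[OF ord_root_pos[OF Cons.prems(1)] pow_fixes_Cons_iff[OF Cons.prems(1)
        xv]])
      (rule pow_fixes_exists[OF st_closed[OF Cons.prems(1) xv(1)] xv(2)])
  have p: "g [^]\<^bsub>G\<^esub> (ord (root g) * j) = (g [^]\<^bsub>G\<^esub> ord (root g)) [^]\<^bsub>G\<^esub> j"
    using Cons.prems by (simp add: G.nat_pow_pow)
  have "stabilised_section X g (x # v) = tree_section X (g [^]\<^bsub>G\<^esub> (ord (root g) * j)) ([x] @ v)"
    using k by (simp add: stabilised_section_def flip: pow_G)
  also have "\<dots> = tree_section X (sec (g [^]\<^bsub>G\<^esub> (ord (root g) * j)) x) v"
    unfolding sec_def using Cons.prems xv by (intro tree_section_append G_in_A) auto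
  also have "sec (g [^]\<^bsub>G\<^esub> (ord (root g) * j)) x = st g x [^]\<^bsub>G\<^esub> j"
    unfolding p st_def
    using sec_pow_fixed[OF G.nat_pow_closed[OF Cons.prems(1)] root_pow_ord[OF Cons.prems(1)]
        xv(1)] by simp
  also have "tree_section X (st g x [^]\<^bsub>G\<^esub> j) v = stabilised_section X (st g x) v"
    by (simp add: stabilised_section_def j_def flip: pow_G)
  also have "\<dots> = ssec (st g x) v" using Cons xv by simp
  finally show ?case by simp
qed

text \<open>With this target the character is void and \<open>W\<close> records word length
  alone.\<close>

abbreviation "trivial_group_monoid \<equiv> \<lparr>carrier = {()}, monoid.mult = \<lambda>_ _. (), one = ()\<rparr>"

lemma trivial_char:
  "comm_group trivial_group_monoid" "(\<lambda>_. ()) \<in> hom (directed_group R D) trivial_group_monoid"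
  by (auto intro!: comm_groupI simp: hom_def)

text \<open>The stabilised sections below level \<open>n\<close> form a decreasing sequence of
  finite sets, as word length does not grow. The sequence becomes stationary, and its final value
  lies in the set of every level, hence in the nucleus.\<close>

lemma deep_sections_in_D:
  assumes SN: "stabilised_nucleus X (carrier G) \<subseteq> D" and g: "g \<in> carrier G"
  shows "\<exists>N. \<forall>w\<in>lists X. N \<le> length w \<longrightarrow> ssec g w \<in> D"
proof -
  define S where "S n = ssec g ` {w \<in> lists X. n \<le> length w}" for n
  have anti: "S m \<subseteq> S n" if "n \<le> m" for n m using that unfolding S_def by auto
  obtain n a where w: "W trivial_group_monoid (\<lambda>_. ()) n a g" using W_ex[OF trivial_char g] by blast
  have "S 0 \<subseteq> {h. \<exists>k\<le>n. \<exists>b. W trivial_group_monoid (\<lambda>_. ()) k b h}"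
    unfolding S_def using W_ssec[OF trivial_char w] by blast
  then have fin: "finite (S n)" for n
    using finite_W[OF trivial_char] anti[of 0 n] by (meson finite_subset le0)
  \<comment> \<open>A level of least cardinality; from there on the sets agree.\<close>
  define N where "N = (ARG_MIN (\<lambda>n. card (S n)) n. True)"
  have min: "card (S N) \<le> card (S n)" for n
    unfolding N_def by (rule arg_min_nat_le) simp
  have "S N = S n" if "N \<le> n" for n
    using anti[OF that] min[of n] fin[of N] by (metis card_seteq)
  then have SNn: "S N \<subseteq> S n" for n using anti[of n N] by (metis nat_le_linear order_refl)
  have Sn: "S n \<subseteq> {stabilised_section X g (u @ v) | u v.
        u \<in> lists X \<and> length u = n \<and> v \<in> lists X}" for n
  proof
    fix h assume "h \<in> S n"
    then obtain w where w: "w \<in> lists X" "n \<le> length w" "h = ssec g w" by (auto simp: S_def)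
    then have "h = stabilised_section X g (take n w @ drop n w)"
      using stabilised_section_eq[OF g w(1)] by simp
    moreover have "take n w \<in> lists X" "drop n w \<in> lists X" "length (take n w) = n"
      using w by (auto dest: in_set_takeD in_set_dropD)
    ultimately show "h \<in> {stabilised_section X g (u @ v) | u v.
        u \<in> lists X \<and> length u = n \<and> v \<in> lists X}" by blast
  qed
  have "S N \<subseteq> (\<Inter>n. {stabilised_section X g (u @ v) | u v.
        u \<in> lists X \<and> length u = n \<and> v \<in> lists X})"
    by (rule INT_greatest) (rule order_trans[OF SNn Sn])
  also have "\<dots> \<subseteq> stabilised_nucleus X (carrier G)"
    unfolding stabilised_nucleus_def by (rule UN_upper[OF g])
  also note SN
  finally have "S N \<subseteq> D" .
  then show ?thesis unfolding S_def by blast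
qed

text \<open>Induction on the depth below which all stabilised sections lie in the finite group
  \<open>D\<close>. A power of \<open>g\<close> fixes all letters and has the stabilised sections as
  its sections; the product of their orders annihilates it.\<close>

lemma torsion_of_nucleus:
  assumes SN: "stabilised_nucleus X (carrier G) \<subseteq> D"
  shows "torsion G"
  unfolding torsion_def
proof
  fix g assume g: "g \<in> carrier G"
  interpret DG: subgroup D G by (rule subgroup_D_G)
  have D: "\<exists>k>0. d [^]\<^bsub>G\<^esub> (k::nat) = \<one>\<^sub>G" if d: "d \<in> D" for d
  proof -
    have pD: "d [^]\<^bsub>G\<^esub> (k::nat) \<in> D" for k by (induction k) (use d DG.m_closed DG.one_closed in auto)
    have "\<not> inj (\<lambda>k::nat. d [^]\<^bsub>G\<^esub> k)"
      using finite_D pD by (metis (no_types, lifting) finite_imageD finite_subset image_subset_iff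
          infinite_UNIV_nat)
    then obtain i j where ij: "i < j" "d [^]\<^bsub>G\<^esub> (i::nat) = d [^]\<^bsub>G\<^esub> (j::nat)"
      by (metis injI linorder_neqE_nat)
    have "d [^]\<^bsub>G\<^esub> i \<cdot> d [^]\<^bsub>G\<^esub> (j - i) = d [^]\<^bsub>G\<^esub> i"
      using ij d G.nat_pow_mult[of d i "j - i"] by simp
    then have "d [^]\<^bsub>G\<^esub> (j - i) = \<one>\<^sub>G" using d by (metis D_closed G.l_cancel_one G.nat_pow_closed)
    then show ?thesis using ij by (intro exI[of _ "j - i"]) simp
  qed
  obtain N where N: "\<And>w. w \<in> lists X \<Longrightarrow> N \<le> length w \<Longrightarrow> ssec g w \<in> D"
    using deep_sections_in_D[OF SN g] by blast
  have "(\<And>w. w \<in> lists X \<Longrightarrow> n \<le> length w \<Longrightarrow> ssec g w \<in> D) \<Longrightarrow> g \<in> carrier G \<Longrightarrow>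
      \<exists>k>0. g [^]\<^bsub>G\<^esub> (k::nat) = \<one>\<^sub>G" for n g
  proof (induction n arbitrary: g)
    case 0
    then show ?case using D[of g] "0.prems"(1)[of "[]"] by simp
  next
    case (Suc n)
    have "\<exists>k>0. st g x [^]\<^bsub>G\<^esub> (k::nat) = \<one>\<^sub>G" if x: "x \<in> X" for x
    proof (rule Suc.IH)
      fix w assume "w \<in> lists X" "n \<le> length w"
      then show "ssec (st g x) w \<in> D" using Suc.prems(1)[of "x # w"] x by simp
    qed (use Suc.prems x in simp)
    then obtain f where f: "\<And>x. x \<in> X \<Longrightarrow> f x > 0 \<and> st g x [^]\<^bsub>G\<^esub> (f x :: nat) = \<one>\<^sub>G" by metis
    define K where "K = (\<Prod>x\<in>X. f x)"
    have "K > 0" unfolding K_def using f by (intro prod_pos) auto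
    define h where "h = g [^]\<^bsub>G\<^esub> ord (root g)"
    have h: "h \<in> carrier G" "root h = \<one>" "\<And>x. sec h x = st g x"
      using Suc.prems(2) by (simp_all add: h_def st_def)
    have "h [^]\<^bsub>G\<^esub> K = \<one>\<^sub>G"
    proof (rule spinal_ext)
      fix x assume x: "x \<in> X"
      have "f x dvd K" unfolding K_def using finite_R x by (rule dvd_prodI)
      then obtain m where m: "K = f x * m" by blast
      have "sec (h [^]\<^bsub>G\<^esub> K) x = st g x [^]\<^bsub>G\<^esub> K" using sec_pow_fixed[OF h(1,2) x] h(3) by simp
      also have "\<dots> = (st g x [^]\<^bsub>G\<^esub> f x) [^]\<^bsub>G\<^esub> m"
        unfolding m using Suc.prems(2) x by (simp add: G.nat_pow_pow)
      also have "\<dots> = \<one>\<^sub>G" using f[OF x] by simp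
      finally show "sec (h [^]\<^bsub>G\<^esub> K) x = sec \<one>\<^sub>G x" using x by simp
    qed (use h in auto)
    then have "g [^]\<^bsub>G\<^esub> (ord (root g) * K) = \<one>\<^sub>G" using Suc.prems(2) by (simp add: h_def G.nat_pow_pow)
    then show ?case using \<open>K > 0\<close> ord_root_pos[OF Suc.prems(2)]
        by (intro exI[of _ "ord (root g) * K"]) simp
  qed
  then show "\<exists>k>0. g [^]\<^bsub>G\<^esub> (k::nat) = \<one>\<^sub>G" using N g by blast
qed

subsection \<open>Sections of prodense subgroups\<close>

text \<open>\<open>R\<close> acts regularly on the letters, so an element fixing \<open>x\<close>
  fixes the first level: \<open>root m = \<one>\<close> describes the stabiliser of \<open>x\<close>
  in \<open>M\<close>.\<close>

definition msec :: "('a list \<Rightarrow> 'a list) set \<Rightarrow> 'a \<Rightarrow> ('a list \<Rightarrow> 'a list) set" where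
  "msec M x = {sec m x | m. m \<in> M \<and> root m = \<one>}"

definition mconj :: "('a list \<Rightarrow> 'a list) \<Rightarrow> ('a list \<Rightarrow> 'a list) set \<Rightarrow> ('a list \<Rightarrow> 'a list) set" where
  "mconj h M = (\<lambda>m. h \<cdot> m \<cdot> inv\<^sub>G h) ` M"

lemma msecI: "m \<in> M \<Longrightarrow> root m = \<one> \<Longrightarrow> sec m x \<in> msec M x"
  unfolding msec_def by blast

lemma prodenseD: "prodense G M \<Longrightarrow> fin_index G H \<Longrightarrow> g \<in> carrier G \<Longrightarrow> \<exists>m\<in>M. \<exists>h\<in>H. g = m \<cdot> h"
  unfolding prodense_def by blast

lemma prodense_subgroup: "prodense G M \<Longrightarrow> subgroup M G"
  by (simp add: prodense_def)

lemma prodense_root: "prodense G M \<Longrightarrow> r \<in> X \<Longrightarrow> \<exists>m\<in>M. root m = r"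
proof -
  assume M: "prodense G M" and r: "r \<in> X"
  obtain m h where m: "m \<in> M" "h \<in> P" "rt r = m \<cdot> h"
    using prodenseD[OF M fin_index_P rooted_closed[OF r]] by blast
  have mc: "m \<in> carrier G" using m(1) subgroup.mem_carrier[OF prodense_subgroup[OF M]] by blast
  have "root m = r"
    using arg_cong[OF m(3), of root] root_mult[OF mc P_closed[OF m(2)]] P_root[OF m(2)] mc r
    by (metis r_one root_closed root_rooted)
  then show ?thesis using m(1) by blast
qed

text \<open>Lift \<open>g\<close> to some \<open>p\<close> in \<open>P\<close> and approximate
  \<open>p\<close> by \<open>m\<close> in \<open>M\<close> up to an error in \<open>P\<close> whose
  section at \<open>x\<close> is in \<open>H\<close>. The root of \<open>m\<close> is then
  automatically \<open>\<one>\<close>.\<close>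

lemma prodense_msec:
  assumes M: "prodense G M" and x: "x \<in> X"
  shows "prodense G (msec M x)"
  unfolding prodense_def
proof (intro conjI allI impI ballI)
  interpret M: subgroup M G by (rule prodense_subgroup[OF M])
  show "subgroup (msec M x) G"
  proof
    show "msec M x \<subseteq> carrier G" unfolding msec_def using x by auto
    show "\<one>\<^sub>G \<in> msec M x" using msecI[OF M.one_closed, of x] x by simp
  next
    fix a b assume "a \<in> msec M x" "b \<in> msec M x"
    then obtain m k where *: "m \<in> M" "root m = \<one>" "a = sec m x" "k \<in> M" "root k = \<one>" "b = sec k x"
      unfolding msec_def by blast
    then have "sec (m \<cdot> k) x = a \<cdot> b" using x by (simp add: sec_mult)
    then show "a \<cdot> b \<in> msec M x" using msecI[of "m \<cdot> k" M x] * by simp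
  next
    fix a assume "a \<in> msec M x"
    then obtain m where *: "m \<in> M" "root m = \<one>" "a = sec m x" unfolding msec_def by blast
    then have "sec (inv\<^sub>G m) x = inv\<^sub>G a" using x by (simp add: sec_inv)
    then show "inv\<^sub>G a \<in> msec M x" using msecI[of "inv\<^sub>G m" M x] * by simp
  qed
  fix H g assume H: "fin_index G H" and g: "g \<in> carrier G"
  obtain p where p: "p \<in> P" "sec p x = g" using sec_surj[OF x g] by blast
  obtain m h where m: "m \<in> M" "h \<in> P" "sec h x \<in> H" "p = m \<cdot> h"
    using prodenseD[OF M fin_index_section[OF H x] P_closed[OF p(1)]] by blast
  have c: "m \<in> carrier G" "h \<in> carrier G" "root h = \<one>" using m P_closed P_root by auto
  have "root m = \<one>" using P_root[OF p(1)] c unfolding m(4) by simp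
  moreover have "g = sec m x \<cdot> sec h x" using p(2) c x unfolding m(4) by (simp add: sec_mult)
  ultimately show "\<exists>k\<in>msec M x. \<exists>h\<in>H. g = k \<cdot> h" using m msecI by blast
qed

lemma prodense_mconj:
  assumes M: "prodense G M" and h: "h \<in> carrier G"
  shows "prodense G (mconj h M)"
  unfolding prodense_def
proof (intro conjI allI impI ballI)
  interpret M: subgroup M G by (rule prodense_subgroup[OF M])
  show "subgroup (mconj h M) G"
  proof
    show "mconj h M \<subseteq> carrier G" unfolding mconj_def using h by auto
    show "\<one>\<^sub>G \<in> mconj h M"
      unfolding mconj_def using h by (intro image_eqI[of _ _ "\<one>\<^sub>G"]) auto
  next
    fix a b assume "a \<in> mconj h M" "b \<in> mconj h M"
    then obtain m k where *: "m \<in> M" "k \<in> M" "a = h \<cdot> m \<cdot> inv\<^sub>G h" "b = h \<cdot> k \<cdot> inv\<^sub>G h"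
      unfolding mconj_def by blast
    then have "a \<cdot> b = h \<cdot> (m \<cdot> k) \<cdot> inv\<^sub>G h" using h by (simp add: G.m_assoc)
    then show "a \<cdot> b \<in> mconj h M" unfolding mconj_def using * M.m_closed by blast
  next
    fix a assume "a \<in> mconj h M"
    then obtain m where *: "m \<in> M" "a = h \<cdot> m \<cdot> inv\<^sub>G h"
      unfolding mconj_def by blast
    then have "inv\<^sub>G a = h \<cdot> inv\<^sub>G m \<cdot> inv\<^sub>G h" using h by (simp add: G.m_assoc G.inv_mult_group)
    then show "inv\<^sub>G a \<in> mconj h M" unfolding mconj_def using * M.m_inv_closed by blast
  qed
  fix H g assume H: "fin_index G H" and g: "g \<in> carrier G"
  obtain K where K: "K \<lhd> G" "fin_index G K" "K \<subseteq> H" using G.fin_index_core[OF H] by blast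
  interpret K: normal K G by (rule K(1))
  obtain m k where m: "m \<in> M" "k \<in> K" "inv\<^sub>G h \<cdot> g \<cdot> h = m \<cdot> k"
    using prodenseD[OF M K(2), of "inv\<^sub>G h \<cdot> g \<cdot> h"] g h by auto
  have "g = h \<cdot> (inv\<^sub>G h \<cdot> g \<cdot> h) \<cdot> inv\<^sub>G h" using g h by (simp add: G.m_assoc)
  also have "\<dots> = (h \<cdot> m \<cdot> inv\<^sub>G h) \<cdot> (h \<cdot> k \<cdot> inv\<^sub>G h)"
    unfolding m(3) using m(1,2) h by (simp add: G.m_assoc)
  finally have "g = (h \<cdot> m \<cdot> inv\<^sub>G h) \<cdot> (h \<cdot> k \<cdot> inv\<^sub>G h)" .
  moreover have "h \<cdot> k \<cdot> inv\<^sub>G h \<in> H" using K.inv_op_closed2[OF h m(2)] K(3) by blast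
  moreover have "h \<cdot> m \<cdot> inv\<^sub>G h \<in> mconj h M" unfolding mconj_def using m(1) by blast
  ultimately show "\<exists>m\<in>mconj h M. \<exists>k\<in>H. g = m \<cdot> k" by blast
qed

inductive Desc :: "('a list \<Rightarrow> 'a list) set \<Rightarrow> ('a list \<Rightarrow> 'a list) set \<Rightarrow> bool"
  for M :: "('a list \<Rightarrow> 'a list) set" where
  Desc_refl: "Desc M M"
| Desc_msec: "Desc M L \<Longrightarrow> x \<in> X \<Longrightarrow> Desc M (msec L x)"
| Desc_mconj: "Desc M L \<Longrightarrow> h \<in> carrier G \<Longrightarrow> Desc M (mconj h L)"

lemma Desc_trans: "Desc L K \<Longrightarrow> Desc M L \<Longrightarrow> Desc M K"
  by (induction rule: Desc.induct) (auto intro: Desc.intros)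

lemma Desc_prodense: "Desc M L \<Longrightarrow> prodense G M \<Longrightarrow> prodense G L"
  by (induction rule: Desc.induct) (auto intro: prodense_msec prodense_mconj)

primrec msecs :: "('a list \<Rightarrow> 'a list) set \<Rightarrow> 'a list \<Rightarrow> ('a list \<Rightarrow> 'a list) set" where
  "msecs M [] = M"
| "msecs M (x # v) = msecs (msec M x) v"

lemma Desc_msecs: "v \<in> lists X \<Longrightarrow> Desc M (msecs M v)"
proof (induction v arbitrary: M)
  case Nil then show ?case by (simp add: Desc_refl)
next
  case (Cons x v)
  then have "Desc (msec M x) (msecs (msec M x) v)" "Desc M (msec M x)" by (auto intro: Desc.intros)
  then show ?case using Desc_trans by simp
qed

lemma ssec_in_msecs:
  "prodense G M \<Longrightarrow> g \<in> M \<Longrightarrow> v \<in> lists X \<Longrightarrow> ssec g v \<in> msecs M v"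
proof (induction v arbitrary: M g)
  case (Cons x v)
  interpret M: subgroup M G by (rule prodense_subgroup[OF Cons.prems(1)])
  have g: "g \<in> carrier G" using Cons.prems by simp
  have "g [^]\<^bsub>G\<^esub> (k::nat) \<in> M" for k by (induction k) (use Cons.prems in auto)
  then have "st g x \<in> msec M x" unfolding st_def using root_pow_ord[OF g] by (intro msecI)
  then show ?case using Cons prodense_msec by simp
qed simp

text \<open>By density \<open>M\<close> contains an element with root \<open>inv x\<close>;
  conjugation by it carries the full section from \<open>x\<close> to \<open>\<one>\<close>.\<close>

lemma prodense_eq_of_msec:
  assumes tor: "torsion G" and Rist: "fin_index G Rist" and M: "prodense G M"
    and x: "x \<in> X" and full: "msec M x = carrier G"
  shows "M = carrier G"
proof (rule prodense_of_full_sections[OF tor Rist M])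
  interpret M: subgroup M G by (rule prodense_subgroup[OF M])
  fix g assume g: "g \<in> carrier G"
  obtain m where m: "m \<in> M" "root m = inv x" using prodense_root[OF M] x by blast
  have mc: "m \<in> carrier G" using m by simp
  define s where "s = sec m x"
  have s: "s \<in> carrier G" using mc x by (simp add: s_def)
  have "inv\<^sub>G s \<cdot> g \<cdot> s \<in> msec M x" unfolding full using s g by simp
  then obtain q where q: "q \<in> M" "root q = \<one>" "sec q x = inv\<^sub>G s \<cdot> g \<cdot> s"
    unfolding msec_def by auto
  have qc: "q \<in> carrier G" using q by simp
  have "sec (m \<cdot> q \<cdot> inv\<^sub>G m) \<one> = g"
    using mc qc q(2,3) m(2) x s g by (simp add: sec_mult sec_inv s_def[symmetric] G.m_assoc)
  moreover have "root (m \<cdot> q \<cdot> inv\<^sub>G m) = \<one>" using mc qc q(2) m(2) x by simp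
  moreover have "m \<cdot> q \<cdot> inv\<^sub>G m \<in> M" using m q by simp
  ultimately show "\<exists>q\<in>M. root q = \<one> \<and> sec q \<one> = g" by blast
qed

lemma Desc_full:
  assumes tor: "torsion G" and Rist: "fin_index G Rist"
  shows "Desc M L \<Longrightarrow> prodense G M \<Longrightarrow> L = carrier G \<Longrightarrow> M = carrier G"
proof (induction rule: Desc.induct)
  case (Desc_msec L x)
  then show ?case using prodense_eq_of_msec[OF tor Rist Desc_prodense] by blast
next
  case (Desc_mconj L h)
  interpret L: subgroup L G using Desc_mconj Desc_prodense prodense_subgroup by blast
  have "g \<in> L" if g: "g \<in> carrier G" for g
  proof -
    have "h \<cdot> g \<cdot> inv\<^sub>G h \<in> mconj h L" using Desc_mconj g by simp
    then obtain l where l: "l \<in> L" "h \<cdot> g \<cdot> inv\<^sub>G h = h \<cdot> l \<cdot> inv\<^sub>G h" unfolding mconj_def by blast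
    then have "g = l" using g Desc_mconj.hyps(2) L.mem_carrier[OF l(1)] by simp
    then show ?thesis using l by simp
  qed
  then have "L = carrier G" using L.subset by blast
  then show ?case using Desc_mconj by blast
qed auto

section \<open>Finding elements of \<open>D\<close> in the sections of a dense subgroup\<close>

lemma directed_group_simps:
  "carrier (directed_group R D) = D" "monoid.mult (directed_group R D) = monoid.mult G"
  "\<one>\<^bsub>directed_group R D\<^esub> = \<one>\<^sub>G"
  by (simp_all add: directed_group_def mult_G one_G)

lemma group_directed: "group (directed_group R D)"
  unfolding directed_group_def by (rule subgroup.subgroup_is_group[OF subgroup_D A.group_axioms])

lemma inv_directed: "d \<in> D \<Longrightarrow> inv\<^bsub>directed_group R D\<^esub> d = inv\<^sub>G d"
  using A.m_inv_consistent[OF subgroup_D] by (simp add: directed_group_def inv_G)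

lemma commutator_directed:
  "a \<in> D \<Longrightarrow> b \<in> D \<Longrightarrow> commutator (directed_group R D) a b = commutator G a b"
  by (simp add: commutator_def directed_group_simps inv_directed)

text \<open>The projection of \<open>D\<close> onto its abelian quotient by \<open>E\<close> extends
  to \<open>G\<close> with a kernel of finite index, so \<open>L\<close> contains some
  \<open>m\<close> with the same value as \<open>d\<close>. Non-triviality survives in suitable
  stabilised sections at every level, and the deep ones belong to \<open>D\<close>. Used with
  \<open>E\<close> the kernel of the given character modulo \<open>p\<close>, and again with an
  \<open>E\<close> containing \<open>D \<inter> L\<close>.\<close>

lemma section_outside_subgroup:
  assumes SN: "stabilised_nucleus X (carrier G) \<subseteq> D" and L: "prodense G L"
    and E: "subgroup E (directed_group R D)"
    and comm: "\<And>a b. a \<in> D \<Longrightarrow> b \<in> D \<Longrightarrow> commutator G a b \<in> E"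
    and d: "d \<in> D" "d \<notin> E"
  shows "\<exists>v\<in>lists X. \<exists>e\<in>msecs L v. e \<in> D \<and> e \<notin> E"
proof -
  interpret DD: group "directed_group R D" by (rule group_directed)
  interpret E: subgroup E "directed_group R D" by (rule E)
  have Ec: "commutator (directed_group R D) a b \<in> E"
    if "a \<in> carrier (directed_group R D)" "b \<in> carrier (directed_group R D)" for a b
    using that comm commutator_directed by (simp add: directed_group_simps)
  note q = DD.comm_quotient_of_commutators[OF E Ec]
  interpret E: normal E "directed_group R D" by (rule q(1))
  let ?B = "directed_group R D Mod E" and ?\<phi> = "\<lambda>d. E #>\<^bsub>directed_group R D\<^esub> d"
  have \<phi>: "?\<phi> \<in> hom (directed_group R D) ?B" by (rule E.r_coset_hom_Mod)
  note B = q(2) \<phi>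
  interpret B: comm_group ?B by (rule q(2))
  have triv: "?\<phi> e = \<one>\<^bsub>?B\<^esub> \<longleftrightarrow> e \<in> E" if "e \<in> D" for e
    using DD.coset_join1[OF _ _ E] DD.coset_join2[OF _ E] that by (auto simp: directed_group_simps)
  let ?\<Phi> = "Phi ?B ?\<phi>"
  let ?K = "{g \<in> carrier G. ?\<Phi> g = \<one>\<^bsub>?B\<^esub>}"
  have \<Phi>i: "?\<Phi> (inv\<^sub>G g) = inv\<^bsub>?B\<^esub> (?\<Phi> g)" if "g \<in> carrier G" for g
    using Phi_mult[OF B G.inv_closed[OF that] that] Phi_one[OF B] Phi_closed[OF B] that
    by (metis B.inv_equality G.inv_closed G.l_inv)
  have K: "fin_index G ?K"
  proof (rule G.fin_indexI[where F = ?\<Phi>])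
    show "subgroup ?K G"
    proof
      show "\<one>\<^sub>G \<in> ?K" using Phi_one[OF B] by simp
      show "x \<cdot> y \<in> ?K" if "x \<in> ?K" "y \<in> ?K" for x y
        using that Phi_mult[OF B] by (simp add: B.r_one[OF B.one_closed, simplified])
      show "inv\<^sub>G x \<in> ?K" if "x \<in> ?K" for x using that \<Phi>i B.inv_one by simp
    qed auto
    have "?\<Phi> ` carrier G \<subseteq> carrier ?B" using Phi_closed[OF B] by blast
    moreover have "finite (carrier ?B)" using finite_D
        by (simp add: carrier_FactGroup directed_group_simps)
    ultimately show "finite (?\<Phi> ` carrier G)" by (rule finite_subset)
    fix a b assume ab: "a \<in> carrier G" "b \<in> carrier G" "?\<Phi> a = ?\<Phi> b"
    have "?\<Phi> (a \<cdot> inv\<^sub>G b) = ?\<Phi> b \<otimes>\<^bsub>?B\<^esub> inv\<^bsub>?B\<^esub> (?\<Phi> b)"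
      using Phi_mult[OF B ab(1) G.inv_closed[OF ab(2)]] \<Phi>i[OF ab(2)] ab(3) by metis
    also have "\<dots> = \<one>\<^bsub>?B\<^esub>" using Phi_closed[OF B ab(2)] by (rule B.r_inv)
    finally show "a \<cdot> inv\<^sub>G b \<in> ?K" using ab by simp
  qed
  obtain m k where m: "m \<in> L" "k \<in> ?K" "d = m \<cdot> k" using prodenseD[OF L K D_closed[OF d(1)]]
      by blast
  have mc: "m \<in> carrier G" using m(1) subgroup.mem_carrier[OF prodense_subgroup[OF L]] by blast
  have "?\<Phi> d = ?\<Phi> m \<otimes>\<^bsub>?B\<^esub> ?\<Phi> k" unfolding m(3) using Phi_mult[OF B mc] m(2) by blast
  also have "?\<Phi> k = \<one>\<^bsub>?B\<^esub>" using m(2) by blast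
  also have "?\<Phi> m \<otimes>\<^bsub>?B\<^esub> \<one>\<^bsub>?B\<^esub> = ?\<Phi> m" using Phi_closed[OF B mc] by (rule B.r_one)
  finally have "?\<Phi> m \<noteq> \<one>\<^bsub>?B\<^esub>" using Phi_D[OF B d(1)] triv[OF d(1)] d(2) by metis
  moreover obtain N where N: "\<And>w. w \<in> lists X \<Longrightarrow> N \<le> length w \<Longrightarrow> ssec m w \<in> D"
    using deep_sections_in_D[OF SN mc] by blast
  ultimately obtain v where v: "v \<in> lists X" "length v = N" "?\<Phi> (ssec m v) \<noteq> \<one>\<^bsub>?B\<^esub>"
    using Phi_ssec[OF B mc] by blast
  have sD: "ssec m v \<in> D" using N[OF v(1)] v(2) by simp
  then have "ssec m v \<notin> E" using v(3) Phi_D[OF B sD] triv[OF sD] by metis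
  then show ?thesis using v(1) sD ssec_in_msecs[OF L m(1) v(1)] by blast
qed

end

context constant_spinal
begin

subsection \<open>The abelianised graph\<close>

abbreviation "C \<equiv> comm_subgroup R"
abbreviation "Q \<equiv> abelianisation R"
abbreviation "cls \<equiv> ab_class R"

interpretation C: normal C R by (rule derived_self_is_normal)
interpretation Q: group Q by (rule C.factorgroup_is_group)

lemma cls_eq_iff: "a \<in> X \<Longrightarrow> b \<in> X \<Longrightarrow> cls a = cls b \<longleftrightarrow> a \<otimes> inv b \<in> C"
  by (rule rcoset_eq_iff[OF C.subgroup_axioms])

lemma cls_self: "a \<in> X \<Longrightarrow> a \<in> cls a"
  by (rule rcos_self[OF _ C.subgroup_axioms])

lemma cls_of_mem: "b \<in> carrier Q \<Longrightarrow> a \<in> b \<Longrightarrow> a \<in> X \<and> cls a = b"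
proof -
  assume "b \<in> carrier Q" and a: "a \<in> b"
  then obtain r where r: "r \<in> X" "b = cls r" by (auto simp: carrier_FactGroup)
  then show ?thesis using a repr_independence[OF _ r(1) C.subgroup_axioms] C.elemrcos_carrier[OF
      group_axioms r(1)]
    by blast
qed

lemma cls_closed: "a \<in> X \<Longrightarrow> cls a \<in> carrier Q"
  by (auto simp: carrier_FactGroup)

lemma commutator_in_C: "a \<in> X \<Longrightarrow> b \<in> X \<Longrightarrow> commutator R a b \<in> C"
  unfolding derived_def commutator_def by (rule generate.incl) blast

lemma cls_conj: "a \<in> X \<Longrightarrow> b \<in> X \<Longrightarrow> cls (a \<otimes> b \<otimes> inv a) = cls b"
  using commutator_in_C[of a b] by (simp add: cls_eq_iff commutator_def)

lemma cls_pow: "a \<in> X \<Longrightarrow> cls (a [^] (n::nat)) = cls a [^]\<^bsub>Q\<^esub> n"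
  by (simp add: C.FactGroup_pow)

lemma arc_cases:
  assumes "e \<in> arcs (ab_graph R d)"
  obtains b l b' where "e = (b, l, b')" "(b, l, b') \<in> arcs (ab_graph R d)"
    "tail (ab_graph R d) e = b" "head (ab_graph R d) e = b'"
  using assms by (cases e) (auto simp: ab_graph_def)

lemma arc_ends:
  assumes "(b, l, b') \<in> arcs (ab_graph R d)"
  shows "b \<in> carrier Q" "b' \<in> carrier Q" "1 \<le> l" "l < Q.ord b" "b \<noteq> C"
proof -
  obtain r s where *: "b = cls r" "b' = cls s" "r \<in> X" "s \<in> X" "l \<in> {1..<Q.ord (cls r)}"
    using assms by (auto simp: ab_graph_def)
  then show "b \<in> carrier Q" "b' \<in> carrier Q" "1 \<le> l" "l < Q.ord b" using cls_closed by auto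
  then have "Q.ord b \<noteq> 1" by linarith
  then show "b \<noteq> C" using Q.ord_id by auto
qed

lemma cls_pow_neq:
  assumes b: "b \<in> carrier Q" and s: "s \<in> b" and l: "l < Q.ord b" "l' < Q.ord b" "l \<noteq> l'"
  shows "cls (s [^] l) \<noteq> cls (s [^] (l'::nat))"
proof -
  have s': "s \<in> X" "cls s = b" using cls_of_mem[OF b s] by auto
  have fin: "finite (carrier Q)" using finite_R by (simp add: carrier_FactGroup)
  have "inj_on (\<lambda>i. b [^]\<^bsub>Q\<^esub> i) {0 .. Q.ord b - 1}" using Q.ord_inj fin b by blast
  then have "b [^]\<^bsub>Q\<^esub> l \<noteq> b [^]\<^bsub>Q\<^esub> l'" using l by (auto simp: inj_on_def)
  then show ?thesis using cls_pow[OF s'(1)] s'(2) by metis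
qed

text \<open>An arc is witnessed by a single representative of its source. Compatibility makes the
  class of the section the same at every letter congruent to \<open>s [^] l\<close>, and the bound
  on the label keeps these letters away from \<open>\<one>\<close>.\<close>

lemma arc_step:
  assumes d: "compatible R d" and arc: "(b, l, b') \<in> arcs (ab_graph R d)"
    and s: "s \<in> b" and z: "z \<in> X" "cls z = cls (s [^] l)"
  shows "z \<noteq> \<one>" "cls (ls d z) = b'"
proof -
  obtain r s0 t where *: "b = cls r" "b' = cls s0" "r \<in> X" "s0 \<in> X"
    and t: "t \<in> C" "cls (ls d ((r \<otimes> t) [^] l)) = cls s0"
    using arc by (auto simp: ab_graph_def)
  note e = arc_ends[OF arc]
  have ne: "cls z \<noteq> cls \<one>" using cls_pow_neq[OF e(1) s e(4), of 0] e(3,4) z(2) by simp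
  then show "z \<noteq> \<one>" by blast
  have tc: "t \<in> X" using t by simp
  have s': "s \<in> X" "cls s = b" using cls_of_mem[OF e(1) s] by auto
  have "r \<otimes> t \<otimes> inv r \<in> C" using C.inv_op_closed2[OF *(3) t(1)] .
  then have "cls (r \<otimes> t) = b" using * tc by (simp add: cls_eq_iff)
  define w where "w = (r \<otimes> t) [^] l"
  have w: "w \<in> X" using * tc by (simp add: w_def)
  have cw: "cls w = cls z"
    unfolding w_def z(2) using cls_pow * tc s' \<open>cls (r \<otimes> t) = b\<close> by simp
  have wne: "w \<noteq> \<one>" using cw ne by metis
  have "z \<otimes> inv w \<in> C" using cls_eq_iff[OF z(1) w] cw by simp
  then have "inv w \<otimes> (z \<otimes> inv w) \<otimes> w \<in> C" using C.inv_op_closed1[OF w] by blast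
  then have u: "inv w \<otimes> z \<in> C" using w z by (simp add: m_assoc)
  have zw: "w \<otimes> (inv w \<otimes> z) = z" using w z by simp
  have "cls (ls d (w \<otimes> (inv w \<otimes> z))) = cls (ls d w)"
    using d u w wne \<open>z \<noteq> \<one>\<close> unfolding compatible_def zw by (metis zw)
  then show "cls (ls d z) = b'" unfolding zw using t(2) * w_def by simp
qed

lemma ls_conj:
  assumes "g \<in> D" "d \<in> D" "z \<in> X" "z \<noteq> \<one>"
  shows "ls (g \<cdot> d \<cdot> inv\<^sub>G g) z = ls g z \<otimes> ls d z \<otimes> inv (ls g z)"
    and "g \<cdot> d \<cdot> inv\<^sub>G g \<in> D"
proof -
  interpret DG: subgroup D G by (rule subgroup_D_G)
  show D: "g \<cdot> d \<cdot> inv\<^sub>G g \<in> D" using assms by simp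
  have c: "ls g z \<in> X" "ls d z \<in> X" using letter_section(1) assms by auto
  have "rt (ls (g \<cdot> d \<cdot> inv\<^sub>G g) z) = sec (g \<cdot> d \<cdot> inv\<^sub>G g) z"
    using letter_section(2)[OF D assms(3,4)] by simp
  also have "\<dots> = rt (ls g z \<otimes> ls d z \<otimes> inv (ls g z))"
    using assms c letter_section(2)[OF assms(1,3,4)] letter_section(2)[OF assms(2,3,4)]
    by (simp add: sec_mult sec_inv rooted_mult rooted_inv)
  finally show "ls (g \<cdot> d \<cdot> inv\<^sub>G g) z = ls g z \<otimes> ls d z \<otimes> inv (ls g z)"
    by (rule rooted_inj[rotated 2]) (use letter_section(1)[OF D assms(3,4)] c in auto)
qed

text \<open>Conjugation inside \<open>D\<close> only conjugates the rooted sections, so the arcs of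
  \<open>d\<close> can be followed with any of its conjugates.\<close>

lemma cls_ls_conj:
  assumes "g \<in> D" "d \<in> D" "z \<in> X" "z \<noteq> \<one>"
  shows "cls (ls (g \<cdot> d \<cdot> inv\<^sub>G g) z) = cls (ls d z)"
  unfolding ls_conj[OF assms] by (rule cls_conj) (use letter_section(1) assms in auto)

text \<open>The second argument of \<open>F\<close> counts edges, as path lengths matter
  later.\<close>

lemma ab_path_induct:
  assumes "ab_path R d b p b'" and "F b 0"
    and step: "\<And>b l b' n. (b, l, b') \<in> arcs (ab_graph R d) \<Longrightarrow> F b n \<Longrightarrow> F b' (Suc n)"
  shows "F b' (length p)"
proof -
  have "pre_digraph.cas (ab_graph R d) b p b'" "set p \<subseteq> arcs (ab_graph R d)"
    using assms(1) by (auto simp: ab_path_def pre_digraph.awalk_def)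
  moreover have "pre_digraph.cas (ab_graph R d) b p b' \<Longrightarrow> set p \<subseteq> arcs (ab_graph R d) \<Longrightarrow> F b n
      \<Longrightarrow> F b' (n + length p)" for n
  proof (induction p arbitrary: b n)
    case Nil then show ?case by (simp add: pre_digraph.cas.simps)
  next
    case (Cons e p)
    then have "e \<in> arcs (ab_graph R d)" by simp
    then obtain u l u' where e: "e = (u, l, u')" "(u, l, u') \<in> arcs (ab_graph R d)"
      "tail (ab_graph R d) e = u" "head (ab_graph R d) e = u'" by (rule arc_cases)
    then have "b = u" "pre_digraph.cas (ab_graph R d) u' p b'" using Cons.prems
        by (auto simp: pre_digraph.cas.simps)
    then show ?case using Cons.IH[of u' "Suc n"] step[OF e(2)] Cons.prems by simp
  qed
  ultimately show ?thesis using assms(2) by (metis add_0)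
qed

lemma ab_path_first:
  assumes "ab_path R d b p b'"
  obtains l u q where "(b, l, u) \<in> arcs (ab_graph R d)" "l = first_label p"
    "q = [] \<and> u = b' \<or> ab_path R d u q b'"
proof -
  have p: "p \<noteq> []" "pre_digraph.cas (ab_graph R d) b p b'" "set p \<subseteq> arcs (ab_graph R d)"
    using assms by (auto simp: ab_path_def pre_digraph.awalk_def)
  then obtain e q where eq: "p = e # q" by (cases p) auto
  then have "e \<in> arcs (ab_graph R d)" using p by simp
  then obtain c l u where e: "e = (c, l, u)" "(c, l, u) \<in> arcs (ab_graph R d)"
    "tail (ab_graph R d) e = c" "head (ab_graph R d) e = u" by (rule arc_cases)
  then have b: "b = c" "pre_digraph.cas (ab_graph R d) u q b'" using p eq
      by (auto simp: pre_digraph.cas.simps)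
  have "q = [] \<and> u = b' \<or> ab_path R d u q b'"
    using b p eq arc_ends(2)[OF e(2)]
    by (cases q) (auto simp: ab_path_def pre_digraph.awalk_def pre_digraph.cas.simps ab_graph_def)
  then show ?thesis using that e b eq by (auto simp: first_label_def)
qed

lemma reach_closure_subset:
  assumes "c \<in> carrier Q" shows "reach_closure R d {c} \<subseteq> carrier Q"
proof -
  have "reach R d (carrier Q) \<subseteq> carrier Q"
  proof
    fix b' assume "b' \<in> reach R d (carrier Q)"
    then obtain b p where b: "b \<in> carrier Q" "ab_path R d b p b'" by (auto simp: reach_def)
    show "b' \<in> carrier Q"
      by (rule ab_path_induct[OF b(2), where F = "\<lambda>b _. b \<in> carrier Q"]) (use b arc_ends(2) in auto)
  qed
  then show ?thesis unfolding reach_closure_def using assms Q.subgroup_self by blast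
qed

lemma forking_point_labels:
  assumes d: "d \<in> D" "compatible R d" and c: "forking_point R d c"
  obtains p p' k k' u u' q q' where "c \<in> carrier Q" "ab_path R d c p c" "ab_path R d c p' c"
    "coprime (length p) (length p')" "k \<noteq> k'"
    "(c, k, u) \<in> arcs (ab_graph R d)" "q = [] \<and> u = c \<or> ab_path R d u q c"
    "(c, k', u') \<in> arcs (ab_graph R d)" "q' = [] \<and> u' = c \<or> ab_path R d u' q' c"
proof -
  obtain p p' where *: "c \<in> carrier Q" "ab_path R d c p c" "ab_path R d c p' c"
    "coprime (length p) (length p')" "first_label p' \<noteq> first_label p"
    using c unfolding forking_point_def by blast
  obtain k u q where 1: "(c, k, u) \<in> arcs (ab_graph R d)" "k = first_label p" "q = [] \<and> u = c \<or>
      ab_path R d u q c"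
    using ab_path_first[OF *(2)] by metis
  obtain k' u' q' where 2: "(c, k', u') \<in> arcs (ab_graph R d)" "k' = first_label p'" "q' = [] \<and> u'
      = c \<or> ab_path R d u' q' c"
    using ab_path_first[OF *(3)] by metis
  have "k \<noteq> k'" using *(5) 1(2) 2(2) by simp
  then show ?thesis using that *(1-4) 1(1,3) 2(1,3) by blast
qed

subsection \<open>Consequences of the filling condition for the rigid stabiliser\<close>

text \<open>The two labels at the forking point give distinct letters \<open>r [^] k\<close> and
  \<open>r [^] k'\<close>. Their sections are non-trivial because the arcs end in vertices that have
  outgoing arcs themselves, hence differ from the trivial coset. At most one of the two letters is
  \<open>y\<close>.\<close>

lemma filling_two_letters:
  assumes d: "d \<in> D" "compatible R d" and c: "forking_point R d c" and y: "y \<in> X"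
  shows "\<exists>z\<in>X. z \<noteq> \<one> \<and> z \<noteq> y \<and> ls d z \<noteq> \<one>"
proof -
  obtain p p' k k' u u' q q' where *: "c \<in> carrier Q" "ab_path R d c p c" "ab_path R d c p' c"
    "coprime (length p) (length p')" "k \<noteq> k'"
    "(c, k, u) \<in> arcs (ab_graph R d)" "q = [] \<and> u = c \<or> ab_path R d u q c"
    "(c, k', u') \<in> arcs (ab_graph R d)" "q' = [] \<and> u' = c \<or> ab_path R d u' q' c"
    by (rule forking_point_labels[OF d c])
  obtain r where r: "r \<in> X" "c = cls r" using *(1) by (auto simp: carrier_FactGroup)
  have rc: "r \<in> c" using r cls_self by simp
  have ne: "ls d (r [^] l) \<noteq> \<one>" "r [^] l \<noteq> \<one>"
    if arc: "(c, l, v) \<in> arcs (ab_graph R d)" and path: "w = [] \<and> v = c \<or> ab_path R d v w c" for l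
        v w
  proof -
    have z: "r [^] l \<in> X" using r by simp
    show "r [^] l \<noteq> \<one>" using arc_step(1)[OF d(2) arc rc z] by simp
    have "v \<noteq> C"
    proof (cases "v = c")
      case True then show ?thesis using arc_ends(5)[OF arc] by simp
    next
      case False
      then have "ab_path R d v w c" using path by blast
      then show ?thesis using ab_path_first arc_ends(5) by metis
    qed
    moreover have "cls (ls d (r [^] l)) = v" using arc_step(2)[OF d(2) arc rc z] by simp
    moreover have "cls \<one> = C" using C.subset by (simp add: coset_mult_one)
    ultimately show "ls d (r [^] l) \<noteq> \<one>" by metis
  qed
  have "cls (r [^] k) \<noteq> cls (r [^] k')"
    using cls_pow_neq[OF *(1) rc arc_ends(4)[OF *(6)] arc_ends(4)[OF *(8)] *(5)] .
  then have "r [^] k \<noteq> r [^] k'" by metis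
  then have "r [^] k \<noteq> y \<or> r [^] k' \<noteq> y" by metis
  then show ?thesis using ne[OF *(6,7)] ne[OF *(8,9)] r by (meson nat_pow_closed)
qed

text \<open>When \<open>R\<close> is not abelian, every coset of the commutator subgroup has at
  least two elements, so the selection in the filling condition can avoid \<open>y\<close>.\<close>

lemma filling_generates:
  assumes fill: "filling R D d" and nab: "a \<in> X" "b \<in> X" "a \<otimes> b \<noteq> b \<otimes> a"
    and y: "y \<in> X" "y \<noteq> \<one>"
  shows "generate R {ls d z | z. z \<in> X \<and> z \<noteq> \<one> \<and> z \<noteq> y} = X"
proof -
  interpret DG: subgroup D G by (rule subgroup_D_G)
  have d: "d \<in> D" using fill by (simp add: filling_def)
  obtain c where c: "forking_point R d c" and gen: "\<And>g \<sigma>. g \<in> D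
      \<Longrightarrow> \<sigma> \<in> (\<Pi> b\<in>reach_closure R d {c}. b) \<Longrightarrow>
      generate R {ls (g \<otimes>\<^bsub>A\<^esub> d \<otimes>\<^bsub>A\<^esub> inv\<^bsub>A\<^esub> g) (\<sigma> b) | b. b \<in> reach_closure R d {c} \<and> \<sigma> b \<noteq> \<one>} = X"
    using fill unfolding filling_def Let_def by blast
  have sub: "reach_closure R d {c} \<subseteq> carrier Q"
    using c reach_closure_subset by (simp add: forking_point_def)
  have ex: "\<exists>s\<in>b'. s \<noteq> y" if b': "b' \<in> reach_closure R d {c}" for b'
  proof -
    obtain r where r: "r \<in> X" "b' = cls r" using b' sub by (auto simp: carrier_FactGroup)
    let ?u = "commutator R a b"
    have u: "?u \<in> C" "?u \<in> X" using commutator_in_C nab by auto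
    have "?u \<noteq> \<one>"
    proof
      assume "?u = \<one>"
      then have "a \<otimes> b \<otimes> inv a \<otimes> inv b \<otimes> b \<otimes> a = b \<otimes> a" using nab by (simp add: commutator_def)
      then show False using nab by (simp add: m_assoc)
    qed
    then have "?u \<otimes> r \<noteq> r" using u r by simp
    moreover have "?u \<otimes> r \<in> b'" "r \<in> b'" using r u cls_self unfolding r(2) r_coset_def by auto
    ultimately show ?thesis by metis
  qed
  define \<sigma> where "\<sigma> b' = (SOME s. s \<in> b' \<and> s \<noteq> y)" for b'
  have \<sigma>: "\<sigma> b' \<in> b' \<and> \<sigma> b' \<noteq> y" if b': "b' \<in> reach_closure R d {c}" for b'
  proof -
    obtain s where "s \<in> b' \<and> s \<noteq> y" using ex[OF b'] by blast
    then show ?thesis unfolding \<sigma>_def by (rule someI)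
  qed
  have e: "\<one>\<^sub>G \<otimes>\<^bsub>A\<^esub> d \<otimes>\<^bsub>A\<^esub> inv\<^bsub>A\<^esub> \<one>\<^sub>G = d"
    using d directed_memD(1) by (simp add: one_G)
  have full: "generate R {ls d (\<sigma> b) | b. b \<in> reach_closure R d {c} \<and> \<sigma> b \<noteq> \<one>} = X"
  proof -
    have "\<sigma> \<in> (\<Pi> b\<in>reach_closure R d {c}. b)" using \<sigma> by simp
    from gen[OF DG.one_closed this] show ?thesis unfolding e .
  qed
  have "{ls d (\<sigma> b) | b. b \<in> reach_closure R d {c} \<and> \<sigma> b \<noteq> \<one>} \<subseteq>
      {ls d z | z. z \<in> X \<and> z \<noteq> \<one> \<and> z \<noteq> y}"
  proof
    fix w assume "w \<in> {ls d (\<sigma> b) | b. b \<in> reach_closure R d {c} \<and> \<sigma> b \<noteq> \<one>}"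
    then obtain b where b: "w = ls d (\<sigma> b)" "b \<in> reach_closure R d {c}" "\<sigma> b \<noteq> \<one>" by blast
    have "\<sigma> b \<in> X"
      using cls_of_mem[OF subsetD[OF sub b(2)] conjunct1[OF \<sigma>[OF b(2)]]] by (rule conjunct1)
    then show "w \<in> {ls d z | z. z \<in> X \<and> z \<noteq> \<one> \<and> z \<noteq> y}"
      unfolding mem_Collect_eq b(1) using b(3) \<sigma>[OF b(2)] by (intro exI[of _ "\<sigma> b"]) simp
  qed
  then have "generate R {ls d (\<sigma> b) | b. b \<in> reach_closure R d {c} \<and> \<sigma> b \<noteq> \<one>} \<subseteq>
      generate R {ls d z | z. z \<in> X \<and> z \<noteq> \<one> \<and> z \<noteq> y}" by (rule mono_generate)
  moreover have "generate R {ls d z | z. z \<in> X \<and> z \<noteq> \<one> \<and> z \<noteq> y} \<subseteq> X"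
    using letter_section(1)[OF d] by (intro generate_incl) auto
  ultimately show ?thesis using full by simp
qed

lemma fin_index_Rist_of_filling:
  assumes "torsion G" and fill: "filling R D d"
  shows "fin_index G Rist"
proof (rule fin_index_Rist[OF assms(1)])
  have d: "d \<in> D" "compatible R d" using fill by (auto simp: filling_def)
  obtain c where c: "forking_point R d c" using fill unfolding filling_def by blast
  show "\<forall>y\<in>X. \<exists>d\<in>D. \<exists>z\<in>X. z \<noteq> \<one> \<and> z \<noteq> y \<and> ls d z \<noteq> \<one>"
    using filling_two_letters[OF d c] d by blast
  show "(\<forall>a\<in>X. \<forall>b\<in>X. a \<otimes> b = b \<otimes> a) \<or>
      (\<exists>d\<in>D. \<forall>y\<in>X. y \<noteq> \<one> \<longrightarrow>
        generate R {ls d z | z. z \<in> X \<and> z \<noteq> \<one> \<and> z \<noteq> y} = X)"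
    using filling_generates[OF fill] d by blast
qed

subsection \<open>Shortening conjugators\<close>

definition dlen :: "nat \<Rightarrow> ('a list \<Rightarrow> 'a list) \<Rightarrow> bool" where
  "dlen n g \<longleftrightarrow> (\<exists>a. W trivial_group_monoid (\<lambda>_. ()) n a g)"

lemma dlen_ex: "g \<in> carrier G \<Longrightarrow> \<exists>n. dlen n g"
  unfolding dlen_def using W_ex[OF trivial_char] by blast

lemma dlen_closed: "dlen n g \<Longrightarrow> g \<in> carrier G"
  unfolding dlen_def using W_closed[OF trivial_char] by blast

lemma dlen_mult_inv: "dlen n g \<Longrightarrow> dlen m h \<Longrightarrow> dlen (n + m) (g \<cdot> inv\<^sub>G h)"
  unfolding dlen_def using W_mult[OF trivial_char] W_inv[OF trivial_char] by blast

lemma dlen_sections: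
  assumes "dlen n g"
  obtains \<nu> where "\<And>x. x \<in> X \<Longrightarrow> dlen (\<nu> x) (sec g x)" "(\<Sum>x\<in>X. \<nu> x) = n"
    "\<And>x. x \<in> X \<Longrightarrow> \<nu> x < n \<or> (\<exists>d\<in>D. \<exists>r\<in>X. g = cj (root g \<otimes> x) d \<cdot> rt r)"
proof -
  obtain a where "W trivial_group_monoid (\<lambda>_. ()) n a g" using assms dlen_def by blast
  from W_sections[OF trivial_char this] show ?thesis using that unfolding dlen_def by metis
qed

text \<open>The length of the conjugator enters as an upper bound, which makes the state monotone in
  \<open>n\<close> and lets a whole path be followed with \<open>n\<close> unchanged.\<close>

definition conj_state :: "('a list \<Rightarrow> 'a list) set \<Rightarrow> ('a list \<Rightarrow> 'a list) \<Rightarrow> nat \<Rightarrow> 'a set \<Rightarrow> bool" where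
  "conj_state M d n b \<longleftrightarrow> (\<exists>L g s k. Desc M L \<and> d \<in> L \<and> k \<le> n \<and> dlen k g \<and> s \<in> b \<and>
     g \<cdot> rt s \<cdot> inv\<^sub>G g \<in> L)"

lemma sec_conj:
  assumes "h \<in> carrier G" "d \<in> D" "x \<in> X"
  shows "sec (inv\<^sub>G h \<cdot> d \<cdot> h) x = inv\<^sub>G (sec h x) \<cdot> sec d (root h \<otimes> x) \<cdot> sec h x"
    and "root (inv\<^sub>G h \<cdot> d \<cdot> h) = \<one>"
  using assms by (simp_all add: sec_mult sec_inv)

text \<open>Conjugate by the inverse of \<open>g\<close>, so that \<open>rt s\<close> becomes
  available and \<open>d\<close> turns into a conjugate by \<open>g\<close>. That conjugate has at
  \<open>x\<close> a conjugate of \<open>d\<close> as its section, and at \<open>y\<close> a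
  conjugate of \<open>rt (ls d z)\<close>; conjugation by a power of \<open>rt s\<close> brings the
  second section to \<open>x\<close>. Undoing the conjugation by \<open>sec g x\<close> restores
  \<open>d\<close> and leaves the new conjugator, made of two sections of \<open>g\<close>.\<close>

lemma conj_section_step:
  assumes L: "prodense G L" and d: "d \<in> D" "d \<in> L" and g: "g \<in> carrier G" and s: "s \<in> X"
    and m: "g \<cdot> rt s \<cdot> inv\<^sub>G g \<in> L"
    and xy: "x = inv (root g)" "y = s [^] (l::nat) \<otimes> x" "z = root g \<otimes> y" and z: "z \<noteq> \<one>"
  shows "\<exists>L'. Desc L L' \<and> d \<in> L' \<and>
    (sec g x \<cdot> inv\<^sub>G (sec g y)) \<cdot> rt (ls d z) \<cdot> inv\<^sub>G (sec g x \<cdot> inv\<^sub>G (sec g y)) \<in> L'"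
proof -
  have c: "x \<in> X" "y \<in> X" "z \<in> X" "d \<in> carrier G" using xy g s d by auto
  define L2 where "L2 = mconj (inv\<^sub>G g) L"
  have L2: "prodense G L2" unfolding L2_def using prodense_mconj[OF L] g by simp
  interpret L2: subgroup L2 G by (rule prodense_subgroup[OF L2])
  have "inv\<^sub>G g \<cdot> (g \<cdot> rt s \<cdot> inv\<^sub>G g) \<cdot> inv\<^sub>G (inv\<^sub>G g) \<in> L2"
    unfolding L2_def mconj_def using m by blast
  then have s2: "rt s \<in> L2" using g s by (simp add: G.m_assoc)
  have "inv\<^sub>G g \<cdot> d \<cdot> inv\<^sub>G (inv\<^sub>G g) \<in> L2"
    unfolding L2_def mconj_def using d by blast
  then have e2: "inv\<^sub>G g \<cdot> d \<cdot> g \<in> L2" (is "?e \<in> L2") using g by simp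
  have ec: "?e \<in> carrier G" "root ?e = \<one>" using g d sec_conj(2)[OF g d(1) one_closed] by auto
  have "rt (s [^] l) \<in> L2" using s2 s by (induction l) (simp_all add: rooted_mult)
  then have f2: "cj (inv (s [^] l)) ?e \<in> L2"
    using e2 s by (simp add: cj_def rooted_inv)
  have ex: "sec ?e x \<in> msec L2 x" using e2 ec by (intro msecI)
  have "sec (cj (inv (s [^] l)) ?e) x \<in> msec L2 x" using f2 ec s by (intro msecI) auto
  then have ey: "sec ?e y \<in> msec L2 x" using ec s c xy(2) by simp
  define L3 where "L3 = mconj (sec g x) (msec L2 x)"
  have "Desc L L2" unfolding L2_def using g by (intro Desc.intros) simp
  then have D3: "Desc L L3" unfolding L3_def using g c by (intro Desc.intros) simp_all
  have sx: "sec ?e x = inv\<^sub>G (sec g x) \<cdot> d \<cdot> sec g x"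
    using sec_conj(1)[OF g d(1) c(1)] xy(1) g d by simp
  have sy: "sec ?e y = inv\<^sub>G (sec g y) \<cdot> rt (ls d z) \<cdot> sec g y"
    using sec_conj(1)[OF g d(1) c(2)] letter_section(2)[OF d(1) c(3) z] xy(3) by simp
  have "sec g x \<cdot> sec ?e x \<cdot> inv\<^sub>G (sec g x) \<in> L3"
    "sec g x \<cdot> sec ?e y \<cdot> inv\<^sub>G (sec g x) \<in> L3"
    unfolding L3_def mconj_def using ex ey by blast+
  then have "d \<in> L3"
    "sec g x \<cdot> inv\<^sub>G (sec g y) \<cdot> rt (ls d z) \<cdot> inv\<^sub>G (sec g x \<cdot> inv\<^sub>G (sec g y)) \<in> L3"
    unfolding sx sy using c g letter_section(1)[OF d(1) c(3) z]
        by (simp_all add: G.m_assoc G.inv_mult_group)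
  then show ?thesis using D3 by blast
qed

lemma conj_state_step_sections:
  assumes M: "prodense G M" and L: "Desc M L" and d: "d \<in> D" "compatible R d" "d \<in> L"
    and arc: "(b, l, b') \<in> arcs (ab_graph R d)" and s: "s \<in> b"
    and g: "g \<in> carrier G" and m: "g \<cdot> rt s \<cdot> inv\<^sub>G g \<in> L"
    and \<nu>: "\<And>x. x \<in> X \<Longrightarrow> dlen (\<nu> x) (sec g x)"
  shows "conj_state M d (\<nu> (inv (root g)) + \<nu> (s [^] l \<otimes> inv (root g))) b'"
proof -
  define x where "x = inv (root g)"
  define y where "y = s [^] l \<otimes> x"
  define z where "z = root g \<otimes> y"
  have sR: "s \<in> X" using cls_of_mem[OF arc_ends(1)[OF arc] s] by simp
  have c: "x \<in> X" "y \<in> X" "z \<in> X" using g sR by (auto simp: x_def y_def z_def)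
  have "z = root g \<otimes> s [^] l \<otimes> inv (root g)" using g sR by (simp add: x_def y_def z_def m_assoc)
  then have "cls z = cls (s [^] l)" using cls_conj g sR by simp
  note st = arc_step[OF d(2) arc s c(3) this]
  obtain L' where L': "Desc L L'" "d \<in> L'"
    "(sec g x \<cdot> inv\<^sub>G (sec g y)) \<cdot> rt (ls d z) \<cdot> inv\<^sub>G (sec g x \<cdot> inv\<^sub>G (sec g y)) \<in> L'"
    using conj_section_step[OF Desc_prodense[OF L M] d(1,3) g sR m x_def y_def z_def st(1)] by blast
  have "dlen (\<nu> x + \<nu> y) (sec g x \<cdot> inv\<^sub>G (sec g y))" using dlen_mult_inv \<nu> c by blast
  moreover have "ls d z \<in> b'" using st cls_self letter_section(1)[OF d(1) c(3) st(1)] by blast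
  ultimately have "conj_state M d (\<nu> x + \<nu> y) b'"
    unfolding conj_state_def using Desc_trans[OF L'(1) L] L'(2,3) by blast
  then show ?thesis by (simp add: x_def y_def)
qed

lemma shifted_letters_distinct:
  assumes "(b, l, b') \<in> arcs (ab_graph R d)" "s \<in> b" "x \<in> X"
  shows "s [^] l \<otimes> x \<noteq> x" "s [^] l \<otimes> x \<in> X"
    and "(b, l', b'') \<in> arcs (ab_graph R d) \<Longrightarrow> l \<noteq> l' \<Longrightarrow> s [^] l \<otimes> x \<noteq> s [^] l' \<otimes> x"
proof -
  note e = arc_ends[OF assms(1)]
  have s: "s \<in> X" using cls_of_mem[OF e(1) assms(2)] by simp
  then show "s [^] l \<otimes> x \<in> X" using assms by simp
  have "cls (s [^] l) \<noteq> cls (s [^] (0::nat))"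
      using cls_pow_neq[OF e(1) assms(2) e(4), of 0] e(3,4) by simp
  then have "s [^] l \<noteq> \<one>" by auto
  then show "s [^] l \<otimes> x \<noteq> x" using s assms(3) by simp
  assume "(b, l', b'') \<in> arcs (ab_graph R d)" "l \<noteq> l'"
  then have "cls (s [^] l) \<noteq> cls (s [^] l')" using cls_pow_neq[OF e(1) assms(2) e(4)] arc_ends(4)
      by blast
  then show "s [^] l \<otimes> x \<noteq> s [^] l' \<otimes> x" using s assms(3) by auto
qed

text \<open>The two sections that form the new conjugator sit at different letters, so their lengths
  add up to at most that of the old one.\<close>

lemma conj_state_step:
  assumes M: "prodense G M" and d: "d \<in> D" "compatible R d"
    and arc: "(b, l, b') \<in> arcs (ab_graph R d)" and st: "conj_state M d n b"
  shows "conj_state M d n b'"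
proof -
  obtain L g s k where *: "Desc M L" "d \<in> L" "k \<le> n" "dlen k g" "s \<in> b"
     "g \<cdot> rt s \<cdot> inv\<^sub>G g \<in> L" using st unfolding conj_state_def by blast
  have g: "g \<in> carrier G" using dlen_closed *(4) by blast
  obtain \<nu> where \<nu>: "\<And>x. x \<in> X \<Longrightarrow> dlen (\<nu> x) (sec g x)" "(\<Sum>x\<in>X. \<nu> x) = k"
    using dlen_sections[OF *(4)] by blast
  define x where "x = inv (root g)"
  have x: "x \<in> X" using g by (simp add: x_def)
  note y = shifted_letters_distinct(1,2)[OF arc *(5) x]
  have "\<nu> x + \<nu> (s [^] l \<otimes> x) = sum \<nu> {x, s [^] l \<otimes> x}" using y(1) by (simp add: eq_commute)
  also have "\<dots> \<le> k" unfolding \<nu>(2)[symmetric] using x y by (intro sum_mono2[OF finite_R]) auto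
  finally have "\<nu> x + \<nu> (s [^] l \<otimes> x) \<le> n" using *(3) by simp
  moreover have "conj_state M d (\<nu> x + \<nu> (s [^] l \<otimes> x)) b'"
    unfolding x_def by (rule conj_state_step_sections[OF M *(1) d *(2) arc *(5) g *(6) \<nu>(1)])
  ultimately show ?thesis unfolding conj_state_def by (meson order_trans)
qed

lemma conj_state_path:
  assumes M: "prodense G M" and d: "d \<in> D" "compatible R d"
    and path: "q = [] \<and> u = c \<or> ab_path R d u q c" and st: "conj_state M d n u"
  shows "conj_state M d n c"
proof (cases "q = [] \<and> u = c")
  case True then show ?thesis using st by simp
next
  case False
  then have p: "ab_path R d u q c" using path by blast
  show ?thesis
    by (rule ab_path_induct[OF p, where F =
        "\<lambda>b _. conj_state M d n b"]) (use st conj_state_step[OF M d] in auto)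
qed

text \<open>Take a conjugator \<open>g\<close> of minimal length \<open>n\<close>. The two edges leaving the forking point
  lead to conjugators of lengths \<open>\<nu> x + \<nu> y\<close> and \<open>\<nu> x + \<nu> y'\<close>, both at least \<open>n\<close>, although
  \<open>\<nu> x + \<nu> y + \<nu> y' \<le> n\<close>. So \<open>\<nu> x = n\<close>, that is, \<open>g\<close> is an element of \<open>D\<close> times a rooted one.\<close>

lemma rooted_in_descendant:
  assumes M: "prodense G M" and d: "d \<in> D" "compatible R d" "d \<in> M" and c: "forking_point R d c"
  shows "\<exists>L e s. Desc M L \<and> e \<in> D \<and> e \<cdot> d \<cdot> inv\<^sub>G e \<in> L \<and> s \<in> c \<and> rt s \<in> L"
proof -
  interpret DG: subgroup D G by (rule subgroup_D_G)
  interpret M: subgroup M G by (rule prodense_subgroup[OF M])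
  obtain p p' k k' u u' q q' where *: "c \<in> carrier Q" "ab_path R d c p c" "ab_path R d c p' c"
    "coprime (length p) (length p')" "k \<noteq> k'"
    "(c, k, u) \<in> arcs (ab_graph R d)" "q = [] \<and> u = c \<or> ab_path R d u q c"
    "(c, k', u') \<in> arcs (ab_graph R d)" "q' = [] \<and> u' = c \<or> ab_path R d u' q' c"
    by (rule forking_point_labels[OF d(1,2) c])
  obtain r where r: "r \<in> X" "c = cls r" using *(1) by (auto simp: carrier_FactGroup)
  have rc: "r \<in> c" using r cls_self by simp
  have "\<exists>n. conj_state M d n u"
  proof -
    \<comment> \<open>Starting point: \<open>M\<close> need not contain a rooted element from
      \<open>c\<close>, but density yields an element with root \<open>r\<close>. Conjugating
      \<open>d\<close> by its power \<open>h\<close> produces, as a section, a conjugate of a rooted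
      element from the coset \<open>u\<close>.\<close>
    obtain m where m: "m \<in> M" "root m = r" using prodense_root[OF M r(1)] by blast
    define h where "h = m [^]\<^bsub>G\<^esub> k"
    have hM: "h \<in> M" unfolding h_def by (induction k) (use m in auto)
    have hc: "h \<in> carrier G" "root h = r [^] k" using m hM by (auto simp: h_def)
    have z: "r [^] k \<in> X" using r by simp
    note st = arc_step[OF d(2) *(6) rc z refl]
    have "inv\<^sub>G h \<cdot> d \<cdot> h \<in> M" using hM d(3) by simp
    then have "sec (inv\<^sub>G h \<cdot> d \<cdot> h) \<one> \<in> msec M \<one>"
      using sec_conj(2)[OF hc(1) d(1) one_closed] by (rule msecI)
    moreover have "sec (inv\<^sub>G h \<cdot> d \<cdot> h) \<one> =
        inv\<^sub>G (sec h \<one>) \<cdot> rt (ls d (r [^] k)) \<cdot> inv\<^sub>G (inv\<^sub>G (sec h \<one>))"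
      using sec_conj(1)[OF hc(1) d(1) one_closed] hc letter_section(2)[OF d(1) z st(1)] r by simp
    moreover have "sec d \<one> \<in> msec M \<one>" using d by (intro msecI) auto
    then have "d \<in> msec M \<one>" using d by simp
    moreover obtain n where "dlen n (inv\<^sub>G (sec h \<one>))" using dlen_ex[of "inv\<^sub>G (sec h \<one>)"] hc by auto
    moreover have "ls d (r [^] k) \<in> u" using st(2) cls_self letter_section(1)[OF d(1) z st(1)]
        by blast
    moreover have "Desc M (msec M \<one>)" by (intro Desc.intros) simp
    ultimately have "conj_state M d n u" unfolding conj_state_def by (metis order_refl)
    then show ?thesis by blast
  qed
  then obtain n0 where "conj_state M d n0 c" using conj_state_path[OF M d(1,2) *(7)] by blast
  define n where "n = (LEAST n. conj_state M d n c)"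
  have n: "conj_state M d n c" unfolding n_def using \<open>conj_state M d n0 c\<close> by (rule LeastI)
  have least: "n \<le> i" if "conj_state M d i c" for i unfolding n_def using that by (rule Least_le)
  obtain L g s i where L: "Desc M L" "d \<in> L" "i \<le> n" "dlen i g" "s \<in> c"
     "g \<cdot> rt s \<cdot> inv\<^sub>G g \<in> L" using n unfolding conj_state_def by blast
  then have "conj_state M d i c" unfolding conj_state_def by blast
  then have i: "i = n" using least L(3) by fastforce
  have g: "g \<in> carrier G" using dlen_closed L(4) by blast
  have sR: "s \<in> X" using cls_of_mem[OF *(1) L(5)] by simp
  obtain \<nu> where \<nu>: "\<And>x. x \<in> X \<Longrightarrow> dlen (\<nu> x) (sec g x)" "(\<Sum>x\<in>X. \<nu> x) = n"
    "\<And>x. x \<in> X \<Longrightarrow> \<nu> x < n \<or> (\<exists>d\<in>D. \<exists>r\<in>X. g = cj (root g \<otimes> x) d \<cdot> rt r)"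
    using dlen_sections[OF L(4)] unfolding i by metis
  define x where "x = inv (root g)"
  have x: "x \<in> X" using g by (simp add: x_def)
  define y where "y = s [^] k \<otimes> x"
  define y' where "y' = s [^] k' \<otimes> x"
  have y: "y \<in> X" "y \<noteq> x" "y' \<in> X" "y' \<noteq> x" "y \<noteq> y'"
    unfolding y_def y'_def using shifted_letters_distinct[OF *(6) L(5) x]
        shifted_letters_distinct[OF *(8) L(5) x] *(5,8) by auto
  have "conj_state M d (\<nu> x + \<nu> y) u" "conj_state M d (\<nu> x + \<nu> y') u'"
    unfolding x_def y_def y'_def
    using conj_state_step_sections[OF M L(1) d(1,2) L(2) *(6) L(5) g L(6) \<nu>(1)]
      conj_state_step_sections[OF M L(1) d(1,2) L(2) *(8) L(5) g L(6) \<nu>(1)] by auto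
  then have "n \<le> \<nu> x + \<nu> y" "n \<le> \<nu> x + \<nu> y'"
    using conj_state_path[OF M d(1,2) *(7)] conj_state_path[OF M d(1,2) *(9)] least by blast+
  moreover have "\<nu> x + \<nu> y + \<nu> y' \<le> n"
  proof -
    have "\<nu> x + \<nu> y + \<nu> y' = sum \<nu> {x, y, y'}" using y by auto
    also have "\<dots> \<le> n" unfolding \<nu>(2)[symmetric] using x y by (intro sum_mono2[OF finite_R]) auto
    finally show ?thesis .
  qed
  ultimately have "\<not> \<nu> x < n" by linarith
  then obtain e t where e: "e \<in> D" "t \<in> X" "g = cj (root g \<otimes> x) e \<cdot> rt t" using \<nu>(3)[OF x] by blast
  \<comment> \<open>By the choice of \<open>x\<close> the product \<open>root g \<otimes> x\<close>
    is \<open>\<one>\<close>, so the rooted conjugation of \<open>e\<close> disappears.\<close>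
  have ge: "g = e \<cdot> rt t" using e g by (simp add: x_def)
  have ec: "e \<in> carrier G" using e by simp
  define L' where "L' = mconj (inv\<^sub>G e) L"
  have "Desc M L'" unfolding L'_def using L(1) ec by (intro Desc.intros) simp_all
  moreover have "inv\<^sub>G e \<cdot> d \<cdot> inv\<^sub>G (inv\<^sub>G e) \<in> L'" unfolding L'_def mconj_def using L(2) by blast
  moreover have "inv\<^sub>G e \<cdot> (g \<cdot> rt s \<cdot> inv\<^sub>G g) \<cdot> inv\<^sub>G (inv\<^sub>G e) \<in> L'"
    unfolding L'_def mconj_def using L(6) by blast
  then have "rt (t \<otimes> s \<otimes> inv t) \<in> L'"
    unfolding ge using e(2) sR ec by (simp add: G.m_assoc G.inv_mult_group rooted_mult rooted_inv)
  moreover have "t \<otimes> s \<otimes> inv t \<in> c"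
    using cls_conj[OF e(2) sR] cls_of_mem[OF *(1) L(5)] cls_self[of "t \<otimes> s \<otimes> inv t"] e(2) sR by simp
  moreover have "inv\<^sub>G e \<in> D" using e(1) by simp
  ultimately show ?thesis by blast
qed

subsection \<open>Filling elements produce the full rooted group\<close>

lemma msecs_append: "msecs L (u @ v) = msecs (msecs L u) v"
  by (induction u arbitrary: L) auto

text \<open>\<open>F b n\<close> below says that the \<open>n\<close>-th section of \<open>L\<close> along \<open>e e e \<dots>\<close> contains a rooted element
  from the coset \<open>b\<close>. As the two closed paths at \<open>c\<close> have coprime lengths, the cosets \<open>b\<close> with
  \<open>F b n\<close> for all large \<open>n\<close> form a subgroup containing \<open>c\<close> and closed under \<open>reach\<close>.\<close>

lemma full_rooted_descendant:
  assumes L: "prodense G L" and d: "d \<in> D" "compatible R d" and e: "e \<in> D"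
    and t: "t = e \<cdot> d \<cdot> inv\<^sub>G e" "t \<in> L"
    and c: "forking_point R d c" and s: "s \<in> c" "rt s \<in> L"
    and gen: "\<And>\<sigma>. \<sigma> \<in> (\<Pi> b\<in>reach_closure R d {c}. b) \<Longrightarrow>
      generate R {ls t (\<sigma> b) | b. b \<in> reach_closure R d {c} \<and> \<sigma> b \<noteq> \<one>} = X"
  shows "\<exists>L'. Desc L L' \<and> t \<in> L' \<and> rt ` X \<subseteq> L' \<and>
    generate R {ls t z | z. z \<in> X \<and> z \<noteq> \<one>} = X"
proof -
  obtain p p' k k' u u' q q' where *: "c \<in> carrier Q" "ab_path R d c p c" "ab_path R d c p' c"
    "coprime (length p) (length p')"
    using c unfolding forking_point_def by blast
  define Ln where "Ln n = msecs L (replicate n \<one>)" for n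
  have Desc_Ln: "Desc L (Ln n)" for n unfolding Ln_def by (rule Desc_msecs) auto
  have Suc_Ln: "Ln (Suc n) = msec (Ln n) \<one>" for n
  proof -
    have "replicate (Suc n) \<one> = replicate n \<one> @ [\<one>]" by (simp add: replicate_append_same)
    then show ?thesis by (simp only: Ln_def msecs_append msecs.simps)
  qed
  have sLn: "subgroup (Ln n) G" for n using prodense_subgroup[OF Desc_prodense[OF Desc_Ln L]] .
  have tD: "t \<in> D" unfolding t(1) using ls_conj(2)[OF e d(1)] subgroup_D_G
    by (metis d(1) e subgroup.m_closed subgroup.m_inv_closed)
  have tL: "t \<in> Ln n" for n
  proof (induction n)
    case 0 then show ?case using t by (simp add: Ln_def)
  next
    case (Suc n)
    then have "sec t \<one> \<in> msec (Ln n) \<one>" using tD by (intro msecI) auto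
    then show ?case using tD by (simp add: Suc_Ln)
  qed
  \<comment> \<open>\<open>t\<close> lies in every \<open>Ln n\<close>, and its conjugate by the
    rooted element at hand shows \<open>ls t z\<close> as the section at
    \<open>\<one>\<close>.\<close>
  have section_in: "rt (ls t z) \<in> Ln (Suc n)" if z: "z \<in> X" "z \<noteq> \<one>" "rt z \<in> Ln n" for z n
  proof -
    interpret Ln: subgroup "Ln n" G by (rule sLn)
    have "cj (inv z) t \<in> Ln n" using z tL[of n] by (simp add: cj_def rooted_inv)
    then have "sec (cj (inv z) t) \<one> \<in> msec (Ln n) \<one>" using z tD by (intro msecI) auto
    then show ?thesis using z tD letter_section(2)[OF tD z(1,2)] by (simp add: Suc_Ln)
  qed
  define F where "F b n \<longleftrightarrow> (\<exists>s\<in>b. s \<in> X \<and> rt s \<in> Ln n)" for b n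
  have F_step: "F b' (Suc n)" if arc: "(b, l, b') \<in> arcs (ab_graph R d)" and F: "F b n" for b l b' n
  proof -
    obtain s where s: "s \<in> b" "s \<in> X" "rt s \<in> Ln n" using F F_def by blast
    interpret Ln: subgroup "Ln n" G by (rule sLn)
    have sl: "rt (s [^] l) \<in> Ln n" using s by (induction l) (simp_all add: rooted_mult)
    have z: "s [^] l \<in> X" using s by simp
    note st = arc_step[OF d(2) arc s(1) z refl]
    have "cls (ls t (s [^] l)) = b'" unfolding t(1) using cls_ls_conj[OF e d(1) z st(1)] st(2)
        by simp
    moreover have "ls t (s [^] l) \<in> X" using letter_section(1)[OF tD z st(1)] .
    ultimately show ?thesis unfolding F_def using section_in[OF z st(1) sl] cls_self by blast
  qed
  have F_path: "F b' (n + length p)" if p: "ab_path R d b p b'" and F: "F b n" for b p b' n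
    by (rule ab_path_induct[OF p, where F = "\<lambda>b i. F b (n + i)"]) (use F F_step in auto)
  \<comment> \<open>\<open>F b n\<close> need not imply \<open>F b (Suc n)\<close>, since passing to
    a section changes the available rooted elements; requiring all large \<open>n\<close> provides a
    common level for products.\<close>
  define S where "S = {b \<in> carrier Q. \<exists>N. \<forall>n\<ge>N. F b n}"
  have Fc: "F c 0" unfolding F_def Ln_def using s cls_of_mem[OF *(1) s(1)] by auto
  have "F c (i * length p + j * length p')" for i j
  proof (induction i)
    case 0
    show ?case
    proof (induction j)
      case (Suc j) then show ?case using F_path[OF *(3) Suc] by (simp add: algebra_simps)
    qed (use Fc in simp)
  next
    case (Suc i) then show ?case using F_path[OF *(2) Suc] by (simp add: algebra_simps)
  qed
  moreover have "length p' > 0" using *(3) by (auto simp: ab_path_def)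
  \<comment> \<open>Every large number is a sum of multiples of the two coprime lengths, so going
    round the two closed paths realises every large level.\<close>
  ultimately have "\<forall>n\<ge>length p * length p'. F c n" using coprime_combination[OF *(4)] by metis
  then have cS: "{c} \<subseteq> S" using *(1) S_def by blast
  have "subgroup S Q"
  proof
    show "S \<subseteq> carrier Q" by (auto simp: S_def)
    have "F C n" for n
      unfolding F_def using C.one_closed subgroup.one_closed[OF sLn, of n]
          by (intro bexI[of _ \<one>]) auto
    then show "\<one>\<^bsub>Q\<^esub> \<in> S" using Q.one_closed by (simp add: S_def)
  next
    fix a b assume "a \<in> S" "b \<in> S"
    then obtain N N' where ab: "a \<in> carrier Q" "b \<in> carrier Q" "\<forall>n\<ge>N. F a n" "\<forall>n\<ge>N'. F b n"
      unfolding S_def by blast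
    have "F (a \<otimes>\<^bsub>Q\<^esub> b) n" if "n \<ge> max N N'" for n
    proof -
      have "F a n" "F b n" using ab that by auto
      then obtain x y where "x \<in> a" "x \<in> X" "rt x \<in> Ln n" "y \<in> b" "y \<in> X" "rt y \<in> Ln n"
        unfolding F_def by blast
      then have "x \<otimes> y \<in> a \<otimes>\<^bsub>Q\<^esub> b" "x \<otimes> y \<in> X" "rt (x \<otimes> y) \<in> Ln n"
        using subgroup.m_closed[OF sLn] by (auto simp: set_mult_def rooted_mult)
      then show ?thesis unfolding F_def by blast
    qed
    then show "a \<otimes>\<^bsub>Q\<^esub> b \<in> S" using Q.m_closed[OF ab(1,2)] unfolding S_def by blast
  next
    fix a assume "a \<in> S"
    then obtain N where a: "a \<in> carrier Q" "\<forall>n\<ge>N. F a n" unfolding S_def by blast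
    have "F (inv\<^bsub>Q\<^esub> a) n" if "n \<ge> N" for n
    proof -
      have "F a n" using a(2) that by blast
      then obtain x where x: "x \<in> a" "x \<in> X" "rt x \<in> Ln n" unfolding F_def by blast
      have "a = cls x" using cls_of_mem[OF a(1) x(1)] by simp
      then have "inv\<^bsub>Q\<^esub> a = cls (inv x)" using C.rcos_inv[OF x(2)] C.inv_FactGroup[OF a(1)] by simp
      then have "inv x \<in> inv\<^bsub>Q\<^esub> a" using cls_self x by simp
      moreover have "rt (inv x) \<in> Ln n" using x subgroup.m_inv_closed[OF sLn x(3)]
          by (simp add: rooted_inv)
      ultimately show ?thesis unfolding F_def using x by blast
    qed
    then show "inv\<^bsub>Q\<^esub> a \<in> S" using Q.inv_closed[OF a(1)] unfolding S_def by blast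
  qed
  moreover have "reach R d S \<subseteq> S"
  proof
    fix b' assume "b' \<in> reach R d S"
    then obtain b p where b: "b \<in> S" "ab_path R d b p b'" by (auto simp: reach_def)
    obtain N where N: "b \<in> carrier Q" "\<forall>n\<ge>N. F b n" using b(1) by (auto simp: S_def)
    have "b' \<in> carrier Q"
      by (rule ab_path_induct[OF b(2), where F = "\<lambda>b _. b \<in> carrier Q"]) (use N arc_ends(2) in auto)
    moreover have "F b' n" if "n \<ge> N + length p" for n
      using F_path[OF b(2), of "n - length p"] N(2) that by simp
    ultimately show "b' \<in> S" unfolding S_def by blast
  qed
  ultimately have RS: "reach_closure R d {c} \<subseteq> S" unfolding reach_closure_def using cS by blast
  have "finite S" using finite_R by (auto simp: S_def carrier_FactGroup intro: finite_subset[of _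
      "cls ` X"])
  have "\<exists>N. \<forall>b\<in>S. F b N"
  proof -
    have "\<forall>b\<in>S. \<exists>N. \<forall>n\<ge>N. F b n" by (auto simp: S_def)
    then obtain f where f: "\<forall>b\<in>S. \<forall>n\<ge>f b. F b n" by metis
    have "\<forall>b\<in>S. f b \<le> Max (f ` S)" using \<open>finite S\<close> by simp
    then show ?thesis using f by blast
  qed
  then obtain N where N: "\<And>b. b \<in> S \<Longrightarrow> F b N" by blast
  \<comment> \<open>Which representative of a coset occurs at level \<open>N\<close> cannot be
    controlled; hence the filling condition for every selection.\<close>
  define \<sigma> where "\<sigma> b = (SOME s. s \<in> b \<and> s \<in> X \<and> rt s \<in> Ln N)" for b
  have \<sigma>: "\<sigma> b \<in> b \<and> \<sigma> b \<in> X \<and> rt (\<sigma> b) \<in> Ln N" if b: "b \<in> reach_closure R d {c}" for b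
  proof -
    have "F b N" using N RS b by blast
    then obtain s where "s \<in> b \<and> s \<in> X \<and> rt s \<in> Ln N" unfolding F_def by blast
    then show ?thesis unfolding \<sigma>_def by (rule someI)
  qed
  let ?T = "{ls t (\<sigma> b) | b. b \<in> reach_closure R d {c} \<and> \<sigma> b \<noteq> \<one>}"
  have T: "generate R ?T = X" by (rule gen) (use \<sigma> in auto)
  have Tsub: "?T \<subseteq> {ls t z | z. z \<in> X \<and> z \<noteq> \<one>}" using \<sigma> by blast
  have Tc: "{ls t z | z. z \<in> X \<and> z \<noteq> \<one>} \<subseteq> X" using letter_section(1)[OF tD] by blast
  have "generate R {ls t z | z. z \<in> X \<and> z \<noteq> \<one>} = X"
  proof (rule subset_antisym)
    show "generate R {ls t z | z. z \<in> X \<and> z \<noteq> \<one>} \<subseteq> X" by (rule generate_incl[OF Tc])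
    have "generate R ?T \<subseteq> generate R {ls t z | z. z \<in> X \<and> z \<noteq> \<one>}" using Tsub by (rule mono_generate)
    then show "X \<subseteq> generate R {ls t z | z. z \<in> X \<and> z \<noteq> \<one>}" unfolding T .
  qed
  moreover have "rt h \<in> Ln (Suc N)" if "h \<in> ?T" for h using that section_in \<sigma> by blast
  then have "rt r \<in> Ln (Suc N)" if "r \<in> generate R ?T" for r
    using rooted_generate[OF sLn order_trans[OF Tsub Tc]] that by blast
  then have "rt ` X \<subseteq> Ln (Suc N)" using T by blast
  ultimately show ?thesis using Desc_Ln tL by blast
qed

text \<open>With all rooted automorphisms in \<open>L\<close>, conjugation by them shows any element
  of \<open>D \<inter> L\<close>, and every generator \<open>ls t z\<close> of \<open>R\<close>, as
  a section at any letter. So nothing gained in \<open>D\<close> is lost under further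
  sections.\<close>

lemma msecs_contains:
  assumes t: "t \<in> D" "generate R {ls t z | z. z \<in> X \<and> z \<noteq> \<one>} = X"
  shows "v \<in> lists X \<Longrightarrow> prodense G L \<Longrightarrow> rt ` X \<subseteq> L \<Longrightarrow> t \<in> L \<Longrightarrow>
    rt ` X \<subseteq> msecs L v \<and> D \<inter> L \<subseteq> msecs L v"
proof (induction v arbitrary: L)
  case (Cons x v)
  have x: "x \<in> X" using Cons.prems by simp
  interpret L: subgroup L G by (rule prodense_subgroup[OF Cons.prems(2)])
  have L': "prodense G (msec L x)" using prodense_msec[OF Cons.prems(2) x] .
  interpret L': subgroup "msec L x" G by (rule prodense_subgroup[OF L'])
  have cjL: "cj y e \<in> L" if "y \<in> X" "e \<in> L" for y e
  proof -
    have "rt y \<in> L" using that(1) Cons.prems(3) by blast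
    then show ?thesis unfolding cj_def using that(2) by simp
  qed
  have DL: "D \<inter> L \<subseteq> msec L x"
  proof
    fix e assume e: "e \<in> D \<inter> L"
    then have "sec (cj x e) x \<in> msec L x" using x by (intro msecI cjL) auto
    then show "e \<in> msec L x" using e x by simp
  qed
  have inc: "rt (ls t z) \<in> msec L x" if "z \<in> X" "z \<noteq> \<one>" for z
  proof -
    have "sec (cj (x \<otimes> inv z) t) x \<in> msec L x" using x that t(1) Cons.prems(4)
        by (intro msecI cjL) auto
    moreover have "inv (x \<otimes> inv z) \<otimes> x = z" using x that by (simp add: inv_mult_group m_assoc)
    ultimately show ?thesis using x that t(1) letter_section(2)[OF t(1) that] by simp
  qed
  have Tc: "{ls t z | z. z \<in> X \<and> z \<noteq> \<one>} \<subseteq> X" using letter_section(1)[OF t(1)] by blast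
  have "rt r \<in> msec L x" if "r \<in> generate R {ls t z | z. z \<in> X \<and> z \<noteq> \<one>}" for r
    using rooted_generate[OF L'.subgroup_axioms Tc _ that] inc by blast
  then have RL: "rt ` X \<subseteq> msec L x" using t(2) by blast
  have "t \<in> msec L x" using DL t(1) Cons.prems(4) by blast
  then have "rt ` X \<subseteq> msecs (msec L x) v \<and> D \<inter> msec L x \<subseteq> msecs (msec L x) v"
    using Cons.IH[OF _ L' RL] Cons.prems by simp
  then show ?case using DL by auto
qed auto

text \<open>Induction on the number of elements of \<open>D\<close> missing from \<open>L\<close>.
  Nilpotency places \<open>D \<inter> L\<close> in a proper subgroup \<open>E\<close> containing all
  commutators, and some section of \<open>L\<close> holds an element of \<open>D\<close> outside
  \<open>E\<close>, a new one.\<close>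

lemma descendant_full:
  assumes SN: "stabilised_nucleus X (carrier G) \<subseteq> D" and nil: "nilpotent_group (directed_group R D)"
    and t: "t \<in> D" "generate R {ls t z | z. z \<in> X \<and> z \<noteq> \<one>} = X"
  shows "prodense G L \<Longrightarrow> rt ` X \<subseteq> L \<Longrightarrow> t \<in> L \<Longrightarrow> Desc L (carrier G)"
proof (induction "card (D - L)" arbitrary: L rule: less_induct)
  case less
  interpret L: subgroup L G by (rule prodense_subgroup[OF less.prems(1)])
  interpret DG: subgroup D G by (rule subgroup_D_G)
  interpret DD: group "directed_group R D" by (rule group_directed)
  show ?case
  proof (cases "D \<subseteq> L")
    case True
    then have "generate G gens \<subseteq> L" using less.prems(2)
        by (intro G.generate_subgroup_incl[OF _ L.subgroup_axioms]) auto
    then have "L = carrier G" using gens(3) L.subset by auto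
    then show ?thesis using Desc_refl by metis
  next
    case False
    have E0: "subgroup (D \<inter> L) (directed_group R D)"
    proof
      show "D \<inter> L \<subseteq> carrier (directed_group R D)" by (simp add: directed_group_simps)
      show "\<one>\<^bsub>directed_group R D\<^esub> \<in> D \<inter> L" by (simp add: directed_group_simps)
      show "x \<otimes>\<^bsub>directed_group R D\<^esub> y \<in> D \<inter> L" if "x \<in> D \<inter> L" "y \<in> D \<inter> L" for x y
        using that by (simp add: directed_group_simps)
      show "inv\<^bsub>directed_group R D\<^esub> x \<in> D \<inter> L" if "x \<in> D \<inter> L" for x
        using that by (simp add: inv_directed)
    qed
    have "D \<inter> L \<noteq> carrier (directed_group R D)" using False by (auto simp: directed_group_simps)
    then obtain E where E: "subgroup E (directed_group R D)" "D \<inter> L \<subseteq> E" "E \<noteq> D"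
      "\<And>a b. a \<in> D \<Longrightarrow> b \<in> D \<Longrightarrow> commutator (directed_group R D) a b \<in> E"
      using DD.nilpotent_proper_subgroup[OF _ nil E0] finite_D by (auto simp: directed_group_simps)
    have "E \<subseteq> D" using subgroup.subset[OF E(1)] by (simp add: directed_group_simps)
    then obtain d where d: "d \<in> D" "d \<notin> E" using E(3) by blast
    have "\<exists>v\<in>lists X. \<exists>e\<in>msecs L v. e \<in> D \<and> e \<notin> E"
      by (rule section_outside_subgroup[OF SN less.prems(1) E(1) _ d]) (use E(4)
          commutator_directed in simp)
    then obtain v e where v: "v \<in> lists X" "e \<in> msecs L v" "e \<in> D" "e \<notin> E" by blast
    have c: "rt ` X \<subseteq> msecs L v" "D \<inter> L \<subseteq> msecs L v"
      using msecs_contains[OF t v(1) less.prems] by auto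
    have "e \<notin> L" using v E(2) by blast
    then have "D - msecs L v \<subset> D - L" using c v by blast
    then have "card (D - msecs L v) < card (D - L)" using finite_D by (intro psubset_card_mono) auto
    moreover have De: "Desc L (msecs L v)" using Desc_msecs v(1) by blast
    ultimately have "Desc (msecs L v) (carrier G)"
      using less.hyps[of "msecs L v"] Desc_prodense[OF De less.prems(1)] c t(1) less.prems(3)
          by blast
    then show ?thesis using Desc_trans De by blast
  qed
qed

lemma prodense_descends_to_full:
  assumes SN: "stabilised_nucleus X (carrier G) \<subseteq> D" and nil: "nilpotent_group (directed_group R D)"
    and M: "prodense G M" and d: "d \<in> M" and fill: "filling R D d"
  shows "Desc M (carrier G)"
proof -
  have dD: "d \<in> D" "compatible R d" using fill by (auto simp: filling_def)
  obtain c where c: "forking_point R d c" and gen: "\<And>g \<sigma>. g \<in> D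
      \<Longrightarrow> \<sigma> \<in> (\<Pi> b\<in>reach_closure R d {c}. b) \<Longrightarrow>
      generate R {ls (g \<otimes>\<^bsub>A\<^esub> d \<otimes>\<^bsub>A\<^esub> inv\<^bsub>A\<^esub> g) (\<sigma> b) | b. b \<in> reach_closure R d {c} \<and> \<sigma> b \<noteq> \<one>} = X"
    using fill unfolding filling_def Let_def by blast
  obtain L e s where L: "Desc M L" "e \<in> D" "e \<cdot> d \<cdot> inv\<^sub>G e \<in> L" "s \<in> c" "rt s \<in> L"
    using rooted_in_descendant[OF M dD d c] by blast
  define t where "t = e \<cdot> d \<cdot> inv\<^sub>G e"
  have tA: "t = e \<otimes>\<^bsub>A\<^esub> d \<otimes>\<^bsub>A\<^esub> inv\<^bsub>A\<^esub> e" using L(2) by (simp add: t_def mult_G inv_G)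
  have tD: "t \<in> D" unfolding t_def using subgroup_D_G dD(1) L(2)
    by (metis subgroup.m_closed subgroup.m_inv_closed)
  have pL: "prodense G L" using Desc_prodense[OF L(1) M] .
  have tL: "t \<in> L" using L(3) by (simp add: t_def)
  obtain L' where L': "Desc L L'" "t \<in> L'" "rt ` X \<subseteq> L'"
    "generate R {ls t z | z. z \<in> X \<and> z \<noteq> \<one>} = X"
    using full_rooted_descendant[OF pL dD L(2) t_def tL c L(4,5) gen[OF L(2), folded tA]] by blast
  have "Desc L' (carrier G)"
    using descendant_full[OF SN nil tD L'(4) Desc_prodense[OF L'(1) pL] L'(3,2)] .
  then show ?thesis using Desc_trans L(1) L'(1) by blast
qed

end

theorem mainTheorem7:
  fixes R :: "('a, 'b) monoid_scheme"
    and D :: "('a list \<Rightarrow> 'a list) set"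
    and p n :: nat
    and \<eta> :: "('a list \<Rightarrow> 'a list) \<Rightarrow> int"
  assumes "constant_spinal R D"
    and "stabilised_nucleus (carrier R) (carrier (spinal_group R D)) = D"
    and "\<forall>d\<in>D. compatible R d"
    and "nilpotent_group (directed_group R D)"
    and "prime p" and "n \<ge> 1"
    and "\<eta> \<in> epi (directed_group R D) (add_monoid (residue_ring (int (p ^ n))))"
    and "\<forall>d\<in>D. \<eta> d \<in> Units (residue_ring (int (p ^ n))) \<longrightarrow> filling R D d"
  shows "MF (spinal_group R D)"
proof -
  interpret constant_spinal R D by fact
  interpret DG: subgroup D G by (rule subgroup_D_G)
  interpret DD: group "directed_group R D" by (rule group_directed)
  have pn: "1 < int (p ^ n)" using assms(5,6)
      by (metis less_le_trans of_nat_1 of_nat_less_iff one_less_power prime_gt_1_nat zero_less_one)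
  interpret Z: residues "int (p ^ n)" "residue_ring (int (p ^ n))"
      by unfold_locales (use pn in auto)
  have SN: "stabilised_nucleus (carrier R) (carrier G) \<subseteq> D" using assms(2) by simp
  note tor = torsion_of_nucleus[OF SN]
  have \<eta>: "\<eta> (a \<cdot> b) = (\<eta> a + \<eta> b) mod int (p ^ n)" "\<eta> a \<in> {0..int (p ^ n) - 1}"
      if "a \<in> D" "b \<in> D" for a b
    using assms(7) that by (auto simp: epi_def hom_def directed_group_simps residue_ring_def)
  have surj: "\<eta> ` D = {0..int (p ^ n) - 1}"
    using assms(7) by (simp add: epi_def directed_group_simps residue_ring_def)
  have pdvd: "int p dvd int (p ^ n)" using assms(6) by (simp add: dvd_power)
  have \<eta>_dvd: "int p dvd \<eta> (a \<cdot> b) \<longleftrightarrow> int p dvd \<eta> a + \<eta> b" if "a \<in> D" "b \<in> D" for a b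
    using \<eta>(1)[OF that] pdvd by (simp add: dvd_mod_iff)
  \<comment> \<open>The kernel of the character modulo \<open>p\<close>. For a prime power modulus
    the units are the residues prime to \<open>p\<close>, so every element of \<open>D\<close>
    outside \<open>E\<close> is filling.\<close>
  define E where "E = {d \<in> D. int p dvd \<eta> d}"
  have \<eta>0: "\<eta> \<one>\<^sub>G = 0"
  proof -
    have "\<eta> \<one>\<^sub>G = (\<eta> \<one>\<^sub>G + \<eta> \<one>\<^sub>G) mod int (p ^ n)" using \<eta>(1)[OF DG.one_closed DG.one_closed] by simp
    moreover have "0 \<le> \<eta> \<one>\<^sub>G" "\<eta> \<one>\<^sub>G < int (p ^ n)" using \<eta>(2)[OF DG.one_closed DG.one_closed] by auto
    ultimately show ?thesis
      by (metis add_cancel_right_right mod_add_self2 mod_pos_pos_trivial mod_eq_0_iff_dvd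
          mod_mod_trivial add_diff_cancel_left' mod_eq_dvd_iff zdvd_not_zless not_less_iff_gr_or_eq)
  qed
  have "subgroup E (directed_group R D)"
  proof
    show "E \<subseteq> carrier (directed_group R D)" by (auto simp: E_def directed_group_simps)
    show "\<one>\<^bsub>directed_group R D\<^esub> \<in> E" using \<eta>0 by (simp add: E_def directed_group_simps)
    show "a \<otimes>\<^bsub>directed_group R D\<^esub> b \<in> E" if "a \<in> E" "b \<in> E" for a b
      using that \<eta>_dvd by (simp add: E_def directed_group_simps)
    show "inv\<^bsub>directed_group R D\<^esub> a \<in> E" if "a \<in> E" for a
    proof -
      have a: "a \<in> D" "int p dvd \<eta> a" using that by (auto simp: E_def)
      have "int p dvd \<eta> (inv\<^sub>G a) + \<eta> a" using \<eta>_dvd[OF DG.m_inv_closed[OF a(1)] a(1)] \<eta>0 a(1)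
          by simp
      then have "int p dvd \<eta> (inv\<^sub>G a)" using a(2) by (simp add: dvd_add_left_iff)
      then show ?thesis using a(1) by (simp add: E_def inv_directed)
    qed
  qed
  moreover have "commutator G a b \<in> E" if ab: "a \<in> D" "b \<in> D" for a b
  proof -
    let ?c = "commutator G a b"
    have c: "?c \<in> D" using ab by (simp add: commutator_def)
    have "?c \<cdot> (b \<cdot> a) = a \<cdot> b" using ab by (simp add: commutator_def G.m_assoc)
    then have "(\<eta> ?c + (\<eta> b + \<eta> a) mod int (p ^ n)) mod int (p ^ n) = (\<eta> a + \<eta> b) mod int (p ^ n)"
      using \<eta>(1)[OF c DG.m_closed[OF ab(2,1)]] \<eta>(1)[OF ab] \<eta>(1)[OF ab(2,1)] by simp
    then have "int (p ^ n) dvd (\<eta> ?c + (\<eta> b + \<eta> a)) - (\<eta> a + \<eta> b)"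
      unfolding mod_add_right_eq by (simp only: mod_eq_dvd_iff)
    then have "int (p ^ n) dvd \<eta> ?c" by (simp add: algebra_simps)
    then show ?thesis using c pdvd dvd_trans by (auto simp: E_def)
  qed
  moreover obtain d1 where d1: "d1 \<in> D" "d1 \<notin> E"
  proof -
    have "1 \<in> \<eta> ` D" using surj pn by simp
    then obtain d where "d \<in> D" "\<eta> d = 1" by auto
    moreover have "\<not> int p dvd 1" using prime_gt_1_nat[OF assms(5)] by (simp add: zdvd1_eq)
    ultimately show ?thesis using that by (auto simp: E_def)
  qed
  ultimately have out: "\<exists>v\<in>lists (carrier R). \<exists>e\<in>msecs M v. e \<in> D \<and> e \<notin> E" if "prodense G M" for M
    using section_outside_subgroup[OF SN that] by blast
  have fill: "filling R D e" if e: "e \<in> D" "e \<notin> E" for e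
  proof -
    have nd: "\<not> int p dvd \<eta> e" using e by (simp add: E_def)
    then have "coprime (int p) (\<eta> e)" using assms(5) by (simp add: prime_imp_coprime)
    then have "coprime (\<eta> e) (int (p ^ n))" by (simp add: coprime_commute)
    moreover have "0 < \<eta> e" "\<eta> e < int (p ^ n)" using nd \<eta>(2)[OF e(1) e(1)]
        by (auto simp: order_le_less)
    ultimately have "\<eta> e \<in> Units (residue_ring (int (p ^ n)))" unfolding Z.res_units_eq by simp
    then show ?thesis using assms(8) e(1) by blast
  qed
  \<comment> \<open>No dense subgroup is proper, so a maximal subgroup of infinite index, which
    would be dense, cannot exist.\<close>
  have full: "M = carrier G" if M: "prodense G M" for M
  proof -
    obtain v e where v: "v \<in> lists (carrier R)" "e \<in> msecs M v" "e \<in> D" "e \<notin> E" using out[OF M]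
        by blast
    have De: "Desc M (msecs M v)" using Desc_msecs v(1) .
    have "Desc (msecs M v) (carrier G)"
      by (rule prodense_descends_to_full[OF SN assms(4) Desc_prodense[OF De M] v(2) fill[OF
          v(3,4)]])
    then have "Desc M (carrier G)" using Desc_trans De by blast
    then show ?thesis by (rule Desc_full[OF tor fin_index_Rist_of_filling[OF tor fill[OF v(3,4)]]
        _ M refl])
  qed
  show ?thesis
    unfolding MF_def
  proof (intro conjI allI impI)
    show "group G" by (rule group_G)
    fix M assume M: "maximal_subgroup M G"
    then have "M \<noteq> carrier G" by (simp add: maximal_subgroup_def)
    then have "fin_index G M" using full G.prodense_of_maximal[OF M] by blast
    then show "finite (rcosets\<^bsub>G\<^esub> M)" by (simp add: fin_index_def)
  qed
qed

end
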